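(* Let $3<q_1\le q_2\le\infty$ and let $n$ be a non-negative integer. Then there exist constants $c_1,c_2,c_3>0$ such that the following holds: if $u(t)$, $0\le t\le T_2$, is a solution to the three dimensional Navier-Stokes equation (in the sense given in the context), and if $0\le T_1\le T_2$, then for all $r\in(0,\sqrt{T_2-T_1})$ we have $$\left|A^{n,q_2}_{T_1+r^2,T_2}\big(c_1r^{3/q_2-n-1}\big)\right|\le c_2\left|A^{0,q_1}_{T_1,T_2}\big(c_3r^{3/q_1-1}\big)\right| ,$$ where, for $S_0\le S_1$, $\lambda\geq 0$, a non-negative integer $k$ and an exponent $q$, $$A^{k,q}_{S_0,S_1}(\lambda)=\{t\in[S_0,S_1]:\|\nabla^k u(t)\|_q\ge\lambda\}.$$
   Context: The three dimensional Navier-Stokes equation is the equation for a time dependent vector field $u=u(t)=u(x,t)$ on $\mathbb R^3$ ($t\ge 0$, $x\in\mathbb R^3$): $$\frac{\partial u}{\partial t}=\Delta u-L\,\mathrm{div}(u\otimes u),\qquad u(0)=u_0,$$ where $L$ is the Leray projection (the projection onto divergence-free vector fields) and $\mathrm{div}(u\otimes u)$ has components $\sum_j \partial_{x_j}(u_j u_i)$. Solution: $u(t)$, $0\le t\le T$, is called a solution of the Navier-Stokes equation if, whenever $u(t_0)$ is sufficiently regular for a mild solution $$u(t)=e^{(t-t_0)\Delta}u(t_0)-\int_{t_0}^t e^{(t-s)\Delta}L\,\mathrm{div}(u(s)\otimes u(s))\,ds$$ to exist for $t\in[t_0,t_0+\tau)$ for some $\tau>0$, then $u(t)$ is equal to that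 mild solution in $[t_0,t_0+\tau)$. Notation: $\|\cdot\|_q$ is the $L_q(\mathbb R^3)$ norm in the space variable (value $+\infty$ if the function is not in $L_q$); $\nabla^k u$ is the array of all $k$-th order spatial derivatives of $u$, with $\nabla^0u=u$; $|A|$ denotes the Lebesgue measure of a set $A$ of times; $3/q_i=0$ if $q_i=\infty$. *)

theory Defs
  imports "HOL-Analysis.Analysis" "HOL-Probability.Essential_Supremum"
begin

section \<open>Lebesgue norms on three-dimensional space\<close>

definition Lq_norm :: "ennreal \<Rightarrow> (real^3 \<Rightarrow> 'b::real_normed_vector) \<Rightarrow> ennreal" where
  "Lq_norm q f =
    (if f \<notin> borel_measurable lebesgue then \<infinity>
     else if q = \<infinity> then esssup lebesgue (\<lambda>x. ennreal (norm (f x)))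
     else let I = (\<integral>\<^sup>+ x. ennreal (norm (f x) powr enn2real q) \<partial>lebesgue)
          in if I = \<infinity> then \<infinity> else ennreal (enn2real I powr (1 / enn2real q)))"

definition three_over :: "ennreal \<Rightarrow> real" where
  "three_over q = (if q = \<infinity> then 0 else 3 / enn2real q)"


section \<open>Weak spatial derivatives\<close>

text \<open>Iterated partial derivatives are indexed by lists of coordinate directions. The value of
  \<open>frechet_derivative\<close> is only meaningful at points of differentiability; test functions are
  required to have all their iterated partial derivatives differentiable everywhere, which is
  the same as being infinitely differentiable.\<close>

primrec iter_partial :: "3 list \<Rightarrow> (real^3 \<Rightarrow> real) \<Rightarrow> real^3 \<Rightarrow> real" where
  "iter_partial [] \<phi> = \<phi>"
| "iter_partial (i # is) \<phi> =
     (\<lambda>x. frechet_derivative (iter_partial is \<phi>) (at x) (axis i 1))"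

definition test_function :: "(real^3 \<Rightarrow> real) \<Rightarrow> bool" where
  "test_function \<phi> \<longleftrightarrow>
     (\<forall>is x. iter_partial is \<phi> differentiable (at x)) \<and> bounded {x. \<phi> x \<noteq> 0}"

definition locally_integrable :: "(real^3 \<Rightarrow> real^3) \<Rightarrow> bool" where
  "locally_integrable f \<longleftrightarrow> (\<forall>K. compact K \<longrightarrow> set_integrable lebesgue K f)"

definition weak_partial :: "3 list \<Rightarrow> (real^3 \<Rightarrow> real^3) \<Rightarrow> (real^3 \<Rightarrow> real^3) \<Rightarrow> bool" where
  "weak_partial is f g \<longleftrightarrow>
     locally_integrable f \<and> locally_integrable g \<and>
     (\<forall>\<phi>. test_function \<phi> \<longrightarrow>
        (LINT x|lebesgue. iter_partial is \<phi> x *\<^sub>R f x)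
          = (- 1) ^ length is *\<^sub>R (LINT x|lebesgue. \<phi> x *\<^sub>R g x))"

text \<open>The norm of the array of all derivatives of order \<open>k\<close>, measured pointwise by its Euclidean
  norm. Weak derivatives are unique almost everywhere, so all members of the set over which the
  infimum is taken give the same value; the infimum is infinite if the distributional
  derivatives of order \<open>k\<close> are not functions.\<close>

definition grad_norm :: "nat \<Rightarrow> ennreal \<Rightarrow> (real^3 \<Rightarrow> real^3) \<Rightarrow> ennreal" where
  "grad_norm k q f =
     (INF G \<in> {G. \<forall>is. length is = k \<longrightarrow> weak_partial is f (G is)}.
        Lq_norm q (\<lambda>x. sqrt (\<Sum>is \<in> {is :: 3 list. length is = k}. (norm (G is x))\<^sup>2)))"


section \<open>The Navier-Stokes equation\<close>

definition heat :: "real \<Rightarrow> (real^3 \<Rightarrow> real^3) \<Rightarrow> real^3 \<Rightarrow> real^3" where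
  "heat t f x =
     (if t = 0 then f x
      else LINT y|lebesgue. ((4 * pi * t) powr (- 3/2) * exp (- (norm (x - y))\<^sup>2 / (4 * t))) *\<^sub>R f y)"

text \<open>The Leray projection is the Fourier multiplier whose symbol at the frequency \<open>\<xi>\<close> is the
  matrix of the orthogonal projection onto the plane perpendicular to \<open>\<xi>\<close> (the Fourier
  transform of a divergence-free field is perpendicular to \<open>\<xi>\<close>).\<close>

definition leray_symbol :: "real^3 \<Rightarrow> real^3^3" where
  "leray_symbol \<xi> = (\<chi> i j. (if i = j then 1 else 0) - \<xi> $ i * \<xi> $ j / (norm \<xi>)\<^sup>2)"

text \<open>The operator \<open>e\<^sup>t\<^sup>\<Delta> L div\<close>, for \<open>t > 0\<close>, maps a matrix field \<open>F\<close>, whose divergence has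
  components \<open>\<Sum>\<^sub>k \<partial>\<^sub>k F\<^sub>j\<^sub>k\<close>, to the vector field with Fourier transform
  \<open>exp (- t \<bar>\<xi>\<bar>\<^sup>2) (\<Sum>\<^sub>j \<Sum>\<^sub>k P\<^sub>i\<^sub>j(\<xi>) \<i> \<xi>\<^sub>k F'\<^sub>j\<^sub>k(\<xi>))\<close>, with \<open>P\<close> the Leray symbol and \<open>F'\<close> the Fourier transform of \<open>F\<close>. The inverse
  Fourier transform of its symbol converges absolutely, is real, and lies in every Lebesgue space, so
  that the operator is the convolution with this kernel.\<close>

definition heat_leray_div_kernel :: "real \<Rightarrow> real^3 \<Rightarrow> 3 \<Rightarrow> 3 \<Rightarrow> 3 \<Rightarrow> real" where
  "heat_leray_div_kernel t z i j k =
     Re ((LINT \<xi>|lebesgue.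
            cis (z \<bullet> \<xi>) * complex_of_real (exp (- t * (norm \<xi>)\<^sup>2))
              * complex_of_real (leray_symbol \<xi> $ i $ j) * (\<i> * complex_of_real (\<xi> $ k)))
         / (2 * pi) ^ 3)"

definition heat_leray_div :: "real \<Rightarrow> (real^3 \<Rightarrow> real^3^3) \<Rightarrow> real^3 \<Rightarrow> real^3" where
  "heat_leray_div t F x =
     (\<chi> i. \<Sum>j\<in>UNIV. \<Sum>k\<in>UNIV.
        LINT y|lebesgue. heat_leray_div_kernel t (x - y) i j k * F y $ j $ k)"

definition tensor :: "real^3 \<Rightarrow> real^3 \<Rightarrow> real^3^3" where
  "tensor a b = (\<chi> j k. a $ j * b $ k)"

text \<open>\<open>v\<close> is a mild solution on \<open>[t0, t0 + \<tau>)\<close> with initial value \<open>a\<close> at time \<open>t0\<close>. The data that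
  count as sufficiently regular are those in some \<open>L\<^sub>q\<close> with \<open>3 < q \<le> \<infinity>\<close>, and the solution is
  taken in the locally bounded \<open>L\<^sub>q\<close>-valued functions of time, where it exists for some \<open>\<tau> > 0\<close>
  and is unique up to null sets. (In much larger classes mild solutions need not be unique.)
  At \<open>t = t0\<close> the equation reads \<open>v t0 = a\<close>.\<close>

definition mild_solution ::
    "real \<Rightarrow> real \<Rightarrow> (real^3 \<Rightarrow> real^3) \<Rightarrow> (real \<Rightarrow> real^3 \<Rightarrow> real^3) \<Rightarrow> bool" where
  "mild_solution t0 \<tau> a v \<longleftrightarrow>
     (\<exists>q>3. Lq_norm q a < \<infinity> \<and>
        (\<forall>t\<in>{t0..<t0+\<tau>}. \<exists>M<\<infinity>. \<forall>s\<in>{t0..t}. Lq_norm q (v s) \<le> M)) \<and>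
     set_borel_measurable lebesgue ({t0..<t0+\<tau>} \<times> UNIV) (\<lambda>(s, x). v s x) \<and>
     (\<forall>t\<in>{t0..<t0+\<tau>}. AE x in lebesgue.
        set_integrable lebesgue {t0..t}
          (\<lambda>s. heat_leray_div (t - s) (\<lambda>y. tensor (v s y) (v s y)) x) \<and>
        v t x = heat (t - t0) a x
          - (LINT s:{t0..t}|lebesgue. heat_leray_div (t - s) (\<lambda>y. tensor (v s y) (v s y)) x))"

definition navier_stokes_solution :: "real \<Rightarrow> (real \<Rightarrow> real^3 \<Rightarrow> real^3) \<Rightarrow> bool" where
  "navier_stokes_solution T u \<longleftrightarrow>
     (\<forall>t0 \<tau> v. 0 \<le> t0 \<and> t0 \<le> T \<and> 0 < \<tau> \<and> mild_solution t0 \<tau> (u t0) v \<longrightarrow>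
        (\<forall>t\<in>{t0..<t0+\<tau>}. t \<le> T \<longrightarrow> (AE x in lebesgue. u t x = v t x)))"

definition large_times ::
    "(real \<Rightarrow> real^3 \<Rightarrow> real^3) \<Rightarrow> nat \<Rightarrow> ennreal \<Rightarrow> real \<Rightarrow> real \<Rightarrow> real \<Rightarrow> real set" where
  "large_times u k q S0 S1 l = {t\<in>{S0..S1}. grad_norm k q (u t) \<ge> ennreal l}"

text \<open>A solution is unconstrained at times where it is not regular, so that the set
  \<open>large_times u k q S0 S1 l\<close> need not be measurable. Its measure is therefore taken to be the
  Lebesgue outer measure, which is the Lebesgue measure on measurable sets.\<close>

definition time_measure :: "real set \<Rightarrow> ennreal" where
  "time_measure A = outer_measure_of lebesgue A"

end

theory Submission
  imports Defs "HOL-Complex_Analysis.Complex_Analysis" "HOL-Real_Asymp.Real_Asymp" "HOL-Probability.Probability"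
begin

no_notation fps_nth (infixl "$" 75)

text \<open>If \<open>u(t\<^sub>0)\<close> is small in \<open>L\<^bsub>q1\<^esub>\<close>, at the scale \<open>r powr (3/q1 - 1)\<close>, then Picard iteration
  produces a mild solution on \<open>[t\<^sub>0, t\<^sub>0 + 2r\<^sup>2)\<close>. The iterates extend holomorphically to the complex
  points \<open>x + sqrt t * \<eta>\<close> with \<open>\<eta>\<close> in a polydisc, and all of these translates are dominated by one
  real majorant that is bounded in \<open>L\<^bsub>q1\<^esub>\<close>. Cauchy's estimates therefore bound the derivatives
  at time \<open>t\<^sub>0 + r\<^sup>2\<close> in \<open>L\<^bsub>q1\<^esub>\<close>, averaging over translates bounds them in \<open>L\<^sub>\<infinity>\<close>, and interpolation
  gives \<open>L\<^bsub>q2\<^esub>\<close>. Hence a time at which the derivative is large forces a large \<open>L\<^bsub>q1\<^esub>\<close> norm exactly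
  \<open>r\<^sup>2\<close> earlier: one set is contained in a translate of the other, and \<open>c2 = 1\<close> will do.\<close>

section \<open>Powers and Lebesgue bounds of nonnegative functions\<close>

text \<open>The hypothesis on \<open>u\<close> says only that it coincides with mild solutions that
  exist. Regularity therefore has to come from constructing, at each good time, a mild solution in
  the full sense of the definition, and the time sets, which may fail to be measurable, are compared
  by inclusion. Two choices make complex translates cheap. Since
  \<open>sqrt t - sqrt s \<le> sqrt (t - s)\<close>, a shift by \<open>sqrt t * \<eta>\<close> moves
  the kernel of age \<open>t - s\<close> by at most a multiple of its own width, which costs a
  constant. And all iterates, for all \<eta>, are compared with one increasing sequence of
  nonnegative functions on real space-time; an \<open>L_q1\<close> bound for its limit yields
  convergence, holomorphy and derivative bounds together. The smallness constant comes from scaling: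
  the bilinear term carries the factor \<open>t powr (1/2 - 3/(2 q1))\<close>, with a constant that
  is finite because \<open>q1 > 3\<close>, and for \<open>t\<close> of order
  \<open>r\<^sup>2\<close> this power cancels the size \<open>r powr (3/q1 - 1)\<close> of the
  datum. Each derivative costs 2 in the radius of the polydisc and the averaging costs 1, hence the
  radius \<open>2 n + 1\<close>.\<close>

text \<open>The value at infinity is set by hand because \<open>enn2real\<close> sends infinity to
  0.\<close>

definition epowr :: "ennreal \<Rightarrow> real \<Rightarrow> ennreal" where
  "epowr x q = (if x = \<infinity> then \<infinity> else ennreal (enn2real x powr q))"

lemma epowr_ennreal [simp]: "0 \<le> x \<Longrightarrow> epowr (ennreal x) q = ennreal (x powr q)"
  by (simp add: epowr_def)

lemma epowr_top [simp]: "epowr \<top> q = \<top>"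
  by (simp add: epowr_def)

lemma epowr_0 [simp]: "epowr 0 q = 0"
  by (simp add: epowr_def)

lemma measurable_epowr [measurable]:
  assumes [measurable]: "f \<in> borel_measurable M"
  shows "(\<lambda>x. epowr (f x) q) \<in> borel_measurable M"
  unfolding epowr_def by measurable

lemma epowr_mono:
  assumes "x \<le> y" "0 \<le> q"
  shows "epowr x q \<le> epowr y q"
proof (cases "y = \<infinity>")
  case False
  then have "x \<noteq> \<infinity>" using assms by (metis infinity_ennreal_def top.extremum_unique)
  then show ?thesis
    using False assms by (auto simp: epowr_def less_top intro!: ennreal_leI powr_mono2 enn2real_mono)
qed (simp add: epowr_def)

lemma epowr_mult:
  assumes "0 < q"
  shows "epowr (x * y) q = epowr x q * epowr y q"
proof (cases "x = 0 \<or> y = 0")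
  case False
  then show ?thesis
    by (cases x; cases y)
      (auto simp: epowr_def ennreal_mult_top ennreal_top_mult powr_mult ennreal_mult[symmetric])
qed auto

lemma epowr_eq_0_iff [simp]: "epowr x q = 0 \<longleftrightarrow> x = 0"
  by (cases x) (auto simp: epowr_def)

text \<open>If the right side is a finite \<open>C\<close>, each \<open>f n\<close> is at most the
  \<open>q\<close>-th root of \<open>C\<close>; this bound passes to the supremum and is raised to
  the power \<open>q\<close> again.\<close>

lemma epowr_SUP:
  assumes "incseq f" "0 < q"
  shows "epowr (SUP n. f n) q = (SUP n. epowr (f n) q)"
proof (rule antisym)
  show "(SUP n. epowr (f n) q) \<le> epowr (SUP n. f n) q"
    using assms by (intro SUP_least epowr_mono SUP_upper) auto
  have lim: "f \<longlonglongrightarrow> (SUP n. f n)" by (rule LIMSEQ_SUP[OF assms(1)])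
  have inc: "incseq (\<lambda>n. epowr (f n) q)"
    using assms by (auto simp: incseq_def intro!: epowr_mono)
  show "epowr (SUP n. f n) q \<le> (SUP n. epowr (f n) q)"
  proof (cases "(SUP n. epowr (f n) q) = \<top>")
    case True
    then show ?thesis by (metis top_greatest)
  next
    case False
    then obtain C where real: "(SUP n. epowr (f n) q) = ennreal C" "0 \<le> C" by (cases "(SUP n. epowr (f n) q)") auto
    have bd: "f n \<le> ennreal (C powr (1/q))" for n
    proof -
      have "epowr (f n) q \<le> ennreal C" using real by (metis SUP_upper UNIV_I)
      then show ?thesis
      proof (cases "f n")
        case (real x)
        with \<open>epowr (f n) q \<le> ennreal C\<close> have "x powr q \<le> C"
          using \<open>0 \<le> C\<close> by (simp)
        then have "(x powr q) powr (1/q) \<le> C powr (1/q)" using assms by (intro powr_mono2) auto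
        then show ?thesis using real assms by (simp add: powr_powr)
      qed (auto simp: epowr_def top_unique)
    qed
    then have "(SUP n. f n) \<le> ennreal (C powr (1/q))" by (intro SUP_least) auto
    from epowr_mono[OF this, of q] assms have "epowr (SUP n. f n) q \<le> ennreal ((C powr (1/q)) powr q)"
      by simp
    also have "\<dots> = ennreal C" using real assms by (simp add: powr_powr)
    finally show ?thesis using real by simp
  qed
qed

text \<open>Young's inequality, with equality at \<open>y = c\<close>. The free parameter
  \<open>c\<close> is fixed only after integrating.\<close>

lemma young_ineq_powr:
  fixes y c q :: real
  assumes "0 \<le> y" "0 < c" "1 \<le> q"
  shows "y \<le> c powr (1 - q) / q * y powr q + (1 - 1/q) * c"
proof (cases "y = 0")
  case False
  have "y = (c powr (1 - q) * y powr q) powr (1/q) * c powr (1 - 1/q)"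
    using assms False by (simp add: powr_mult powr_powr powr_add[symmetric] field_simps)
  also have "\<dots> \<le> 1/q * (c powr (1 - q) * y powr q) + (1 - 1/q) * c"
    using assms False by (intro Youngs_inequality_0) auto
  finally show ?thesis by simp
qed (use assms in auto)

lemma young_ineq_epowr:
  assumes "0 < c" "1 \<le> q"
  shows "y \<le> ennreal (c powr (1 - q) / q) * epowr y q + ennreal ((1 - 1/q) * c)"
proof (cases y)
  case (real r)
  then show ?thesis
    using young_ineq_powr[of r c q] assms
    by (simp add: ennreal_mult[symmetric] ennreal_plus[symmetric] del: ennreal_plus)
qed (use assms in \<open>auto simp: ennreal_mult_top\<close>)

text \<open>Jensen's inequality for a measure of mass at most 1. When the right side is finite and
  positive, \<open>c\<close> is its \<open>q\<close>-th root, and integrating Young's inequality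
  bounds the integral of \<open>f\<close> by \<open>c\<close> itself.\<close>

lemma epowr_nn_integral_le:
  assumes [measurable]: "f \<in> borel_measurable M" and mass: "emeasure M (space M) \<le> 1" and q: "1 \<le> q"
  shows "epowr (\<integral>\<^sup>+x. f x \<partial>M) q \<le> (\<integral>\<^sup>+x. epowr (f x) q \<partial>M)"
proof (cases "\<integral>\<^sup>+x. epowr (f x) q \<partial>M")
  case (real I)
  show ?thesis
  proof (cases "I = 0")
    case True
    then have "AE x in M. f x = 0" using real by (simp add: nn_integral_0_iff_AE)
    then have "(\<integral>\<^sup>+x. f x \<partial>M) = 0" by (simp add: nn_integral_0_iff_AE)
    then show ?thesis by simp
  next
    case False
    define c where "c = I powr (1/q)"
    have c: "c > 0" "c powr q = I" using False real q by (auto simp: c_def powr_powr)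
    have "(\<integral>\<^sup>+x. f x \<partial>M) \<le> (\<integral>\<^sup>+x. ennreal (c powr (1 - q) / q) * epowr (f x) q + ennreal ((1 - 1/q) * c) \<partial>M)"
      by (intro nn_integral_mono young_ineq_epowr c q)
    also have "\<dots> = ennreal (c powr (1 - q) / q) * ennreal I + ennreal ((1 - 1/q) * c) * emeasure M (space M)"
      using real by (simp add: nn_integral_add nn_integral_cmult)
    also have "\<dots> \<le> ennreal (c powr (1 - q) / q) * ennreal I + ennreal ((1 - 1/q) * c) * 1"
      by (intro add_mono mult_left_mono mass) auto
    also have "\<dots> = ennreal (c powr (1 - q) / q * I + (1 - 1/q) * c)"
      using real q c by (simp add: ennreal_mult[symmetric])
    also have "c powr (1 - q) / q * I + (1 - 1/q) * c = c"
      using c q by (simp add: c(2)[symmetric] powr_diff field_simps)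
    finally have "epowr (\<integral>\<^sup>+x. f x \<partial>M) q \<le> epowr (ennreal c) q"
      using q by (intro epowr_mono) auto
    then show ?thesis using c real by simp
  qed
qed simp

text \<open>For \<open>q = \<infinity>\<close> the bound holds at every point, not almost
  everywhere, so that it survives suprema, integrals and translations without any bookkeeping of
  null sets. For finite \<open>q\<close> it bounds the integral of the power and avoids taking a
  root.\<close>

definition Lq_bound :: "ennreal \<Rightarrow> ('a::euclidean_space \<Rightarrow> ennreal) \<Rightarrow> real \<Rightarrow> bool" where
  "Lq_bound q f b \<longleftrightarrow> (if q = \<infinity> then \<forall>x. f x \<le> ennreal b
     else (\<integral>\<^sup>+x. epowr (f x) (enn2real q) \<partial>lborel) \<le> ennreal (b powr enn2real q))"

lemma enn2real_ge_1: "1 \<le> q \<Longrightarrow> q \<noteq> \<infinity> \<Longrightarrow> 1 \<le> enn2real q"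
  using enn2real_mono[of 1 q] by (simp add: less_top)

lemma Lq_bound_mono:
  assumes "Lq_bound q g b" "\<And>x. f x \<le> g x" "b \<le> c" "0 \<le> b"
  shows "Lq_bound q f c"
proof (cases "q = \<infinity>")
  case True
  then show ?thesis using assms unfolding Lq_bound_def by simp (meson order_trans ennreal_leI)
next
  case False
  have "(\<integral>\<^sup>+x. epowr (f x) (enn2real q) \<partial>lborel) \<le> (\<integral>\<^sup>+x. epowr (g x) (enn2real q) \<partial>lborel)"
    using assms by (intro nn_integral_mono epowr_mono) auto
  also have "\<dots> \<le> ennreal (b powr enn2real q)" using assms False by (simp add: Lq_bound_def)
  also have "\<dots> \<le> ennreal (c powr enn2real q)" using assms by (intro ennreal_leI powr_mono2) auto
  finally show ?thesis using False by (simp add: Lq_bound_def)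
qed

lemma Lq_bound_SUP:
  assumes q: "1 \<le> q" and f: "\<And>n. Lq_bound q (f n) b" and inc: "\<And>x. incseq (\<lambda>n. f n x)"
    and [measurable]: "\<And>n. f n \<in> borel_measurable borel"
  shows "Lq_bound q (\<lambda>x. SUP n. f n x) b"
proof (cases "q = \<infinity>")
  case True
  then show ?thesis using f by (auto simp: Lq_bound_def intro: SUP_least)
next
  case False
  have q1: "1 \<le> enn2real q" using enn2real_ge_1 q False by blast
  have inc': "incseq (\<lambda>n. \<lambda>x. epowr (f n x) (enn2real q))"
    using inc q1 by (auto simp: incseq_def le_fun_def intro!: epowr_mono)
  have "(\<integral>\<^sup>+x. epowr (SUP n. f n x) (enn2real q) \<partial>lborel) = (\<integral>\<^sup>+x. (SUP n. epowr (f n x) (enn2real q)) \<partial>lborel)"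
    using inc q1 by (subst epowr_SUP) auto
  also have "\<dots> = (SUP n. \<integral>\<^sup>+x. epowr (f n x) (enn2real q) \<partial>lborel)"
    by (rule nn_integral_monotone_convergence_SUP[OF inc']) simp
  also have "\<dots> \<le> ennreal (b powr enn2real q)"
    using f False by (intro SUP_least) (auto simp: Lq_bound_def)
  finally show ?thesis using False by (simp add: Lq_bound_def)
qed

lemma Lq_bound_cmult:
  assumes "Lq_bound q f b" "0 \<le> c" "0 \<le> b" "1 \<le> q" and [measurable]: "f \<in> borel_measurable borel"
  shows "Lq_bound q (\<lambda>x. ennreal c * f x) (c * b)"
proof (cases "q = \<infinity>")
  case True
  then show ?thesis using assms by (auto simp: Lq_bound_def ennreal_mult intro!: mult_left_mono)
next
  case False
  then show ?thesis
    using assms enn2real_ge_1[of q]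
    by (simp add: Lq_bound_def epowr_mult nn_integral_cmult powr_mult ennreal_mult mult_left_mono)
qed

text \<open>Minkowski's integral inequality: averaging the normalised functions \<open>f s / b s\<close> against the
  weight \<open>b s / B\<close> reduces it to Jensen's inequality.\<close>

lemma Lq_bound_nn_integral:
  fixes f :: "'s \<Rightarrow> 'a::euclidean_space \<Rightarrow> ennreal" and b :: "'s \<Rightarrow> real"
  assumes q: "1 \<le> q" and M: "sigma_finite_measure M"
    and f[measurable]: "case_prod f \<in> borel_measurable (M \<Otimes>\<^sub>M borel)"
    and b[measurable]: "b \<in> borel_measurable M"
    and bnd: "\<And>s. s \<in> space M \<Longrightarrow> 0 \<le> b s \<and> Lq_bound q (f s) (b s) \<and> (b s = 0 \<longrightarrow> f s = (\<lambda>_. 0))"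
    and B: "(\<integral>\<^sup>+s. ennreal (b s) \<partial>M) \<le> ennreal B" "0 < B"
  shows "Lq_bound q (\<lambda>x. \<integral>\<^sup>+s. f s x \<partial>M) B"
proof (cases "q = \<infinity>")
  case True
  show ?thesis unfolding Lq_bound_def using True
  proof (simp, intro allI)
    fix x
    have "(\<integral>\<^sup>+s. f s x \<partial>M) \<le> (\<integral>\<^sup>+s. ennreal (b s) \<partial>M)"
      using bnd True by (intro nn_integral_mono) (auto simp: Lq_bound_def)
    also note B(1)
    finally show "(\<integral>\<^sup>+s. f s x \<partial>M) \<le> ennreal B" .
  qed
next
  case False
  define p where "p = enn2real q"
  have p: "1 \<le> p" using enn2real_ge_1 q False p_def by blast
  interpret M: sigma_finite_measure M by fact
  interpret P: pair_sigma_finite M "lborel :: 'a measure" ..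
  define N where "N = density M (\<lambda>s. ennreal (b s / B))"
  have mass: "emeasure N (space N) \<le> 1"
  proof -
    have "emeasure N (space N) = (\<integral>\<^sup>+s. ennreal (b s / B) \<partial>M)"
      by (simp add: N_def emeasure_density cong: nn_integral_cong)
    also have "\<dots> = (\<integral>\<^sup>+s. ennreal (1/B) * ennreal (b s) \<partial>M)"
      using B bnd by (intro nn_integral_cong) (simp add: ennreal_mult[symmetric])
    also have "\<dots> \<le> ennreal (1/B) * ennreal B"
      using B by (subst nn_integral_cmult) (auto intro!: mult_left_mono)
    also have "\<dots> = 1" using B by (simp add: ennreal_mult[symmetric])
    finally show ?thesis .
  qed
  have *: "epowr (\<integral>\<^sup>+s. f s x \<partial>M) p
      \<le> (\<integral>\<^sup>+s. ennreal (b s / B) * epowr (ennreal (B / b s)) p * epowr (f s x) p \<partial>M)" for x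
  proof -
    have "(\<integral>\<^sup>+s. f s x \<partial>M) = (\<integral>\<^sup>+s. ennreal (b s / B) * (ennreal (B / b s) * f s x) \<partial>M)"
    proof (rule nn_integral_cong)
      fix s assume s: "s \<in> space M"
      \<comment> \<open>Where \<open>b s = 0\<close> the quotient \<open>B / b s\<close> is 0, but
        there \<open>f s\<close> vanishes by hypothesis; elsewhere the two factors cancel.\<close>
      show "f s x = ennreal (b s / B) * (ennreal (B / b s) * f s x)"
      proof (cases "b s = 0")
        case False
        then show ?thesis using bnd[OF s] B by (simp add: mult.assoc[symmetric] ennreal_mult[symmetric])
      qed (use bnd[OF s] in simp)
    qed
    also have "\<dots> = (\<integral>\<^sup>+s. ennreal (B / b s) * f s x \<partial>N)"
      unfolding N_def by (subst nn_integral_density) auto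
    finally have "epowr (\<integral>\<^sup>+s. f s x \<partial>M) p = epowr (\<integral>\<^sup>+s. ennreal (B / b s) * f s x \<partial>N) p" by simp
    also have "\<dots> \<le> (\<integral>\<^sup>+s. epowr (ennreal (B / b s) * f s x) p \<partial>N)"
      by (rule epowr_nn_integral_le[OF _ mass p]) (simp add: N_def)
    also have "\<dots> = (\<integral>\<^sup>+s. ennreal (b s / B) * (epowr (ennreal (B / b s) * f s x) p) \<partial>M)"
      unfolding N_def by (subst nn_integral_density) auto
    finally show ?thesis using p by (simp add: epowr_mult mult.assoc)
  qed
  have "(\<integral>\<^sup>+x. epowr (\<integral>\<^sup>+s. f s x \<partial>M) p \<partial>lborel)
      \<le> (\<integral>\<^sup>+x. \<integral>\<^sup>+s. ennreal (b s / B) * epowr (ennreal (B / b s)) p * epowr (f s x) p \<partial>M \<partial>lborel)"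
    by (intro nn_integral_mono *)
  also have "\<dots> = (\<integral>\<^sup>+s. \<integral>\<^sup>+x. ennreal (b s / B) * epowr (ennreal (B / b s)) p * epowr (f s x) p \<partial>lborel \<partial>M)"
    by (intro P.Fubini') measurable
  also have "\<dots> = (\<integral>\<^sup>+s. ennreal (b s / B) * epowr (ennreal (B / b s)) p * (\<integral>\<^sup>+x. epowr (f s x) p \<partial>lborel) \<partial>M)"
    by (intro nn_integral_cong nn_integral_cmult) measurable
  also have "\<dots> \<le> (\<integral>\<^sup>+s. ennreal (B powr p) * ennreal (b s / B) \<partial>M)"
  proof (rule nn_integral_mono)
    fix s assume s: "s \<in> space M"
    have I: "(\<integral>\<^sup>+x. epowr (f s x) p \<partial>lborel) \<le> ennreal (b s powr p)"
      using bnd[OF s] False by (simp add: Lq_bound_def p_def)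
    show "ennreal (b s / B) * epowr (ennreal (B / b s)) p * (\<integral>\<^sup>+x. epowr (f s x) p \<partial>lborel)
        \<le> ennreal (B powr p) * ennreal (b s / B)"
    proof (cases "b s = 0")
      case False
      then have bs: "b s > 0" using bnd[OF s] by auto
      have "ennreal (b s / B) * epowr (ennreal (B / b s)) p * (\<integral>\<^sup>+x. epowr (f s x) p \<partial>lborel)
          \<le> ennreal (b s / B) * epowr (ennreal (B / b s)) p * ennreal (b s powr p)"
        by (intro mult_left_mono I) auto
      also have "\<dots> = ennreal (b s / B * ((B / b s) powr p) * (b s powr p))"
        using bs B by (simp add: ennreal_mult[symmetric])
      also have "b s / B * ((B / b s) powr p) * (b s powr p) = B powr p * (b s / B)"
        using bs B by (simp add: powr_divide)
      finally show ?thesis using bs B by (simp add: ennreal_mult[symmetric])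
    qed simp
  qed
  also have "\<dots> = ennreal (B powr p) * emeasure N (space N)"
    by (subst nn_integral_cmult) (auto simp: N_def emeasure_density cong: nn_integral_cong)
  also have "\<dots> \<le> ennreal (B powr p) * 1" by (intro mult_left_mono mass) auto
  finally show ?thesis using False by (simp add: Lq_bound_def p_def)
qed

text \<open>Minkowski's inequality for two functions is the integral form over a two-point space
  with counting measure.\<close>

lemma Lq_bound_add:
  fixes f g :: "'a::euclidean_space \<Rightarrow> ennreal"
  assumes q: "1 \<le> q" and f: "Lq_bound q f a" and g: "Lq_bound q g b" and ab: "0 < a" "0 < b"
    and [measurable]: "f \<in> borel_measurable borel" "g \<in> borel_measurable borel"
  shows "Lq_bound q (\<lambda>x. f x + g x) (a + b)"
proof -
  have "Lq_bound q (\<lambda>x. \<integral>\<^sup>+s. (if s then f x else g x) \<partial>count_space (UNIV::bool set)) (a + b)"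
  proof (rule Lq_bound_nn_integral[where b="\<lambda>s. if s then a else b"])
    show "sigma_finite_measure (count_space (UNIV::bool set))"
      by (rule sigma_finite_measure_count_space)
    have "{s. s} = {True}" "{s. \<not> s} = {False}" by auto
    then show "(\<lambda>(s, x). if s then f x else g x) \<in> borel_measurable (count_space UNIV \<Otimes>\<^sub>M borel)"
      by measurable
    show "(\<integral>\<^sup>+s. ennreal (if s then a else b) \<partial>count_space UNIV) \<le> ennreal (a + b)"
      using ab by (simp add: nn_integral_count_space_finite UNIV_bool add.commute)
  qed (use assms in auto)
  then show ?thesis by (simp add: nn_integral_count_space_finite UNIV_bool add.commute)
qed

section \<open>Gaussians\<close>

lemma nn_integral_lborel_shift:
  fixes f :: "'a::euclidean_space \<Rightarrow> ennreal"
  assumes [measurable]: "f \<in> borel_measurable borel"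
  shows "(\<integral>\<^sup>+x. f (x + c) \<partial>lborel) = (\<integral>\<^sup>+x. f x \<partial>lborel)"
proof -
  have "(\<integral>\<^sup>+x. f x \<partial>lborel) = (\<integral>\<^sup>+x. f x \<partial>distr lborel borel ((+) c))"
    by (simp add: lborel_distr_plus)
  also have "\<dots> = (\<integral>\<^sup>+x. f (x + c) \<partial>lborel)"
    by (subst nn_integral_distr) (auto simp: add.commute)
  finally show ?thesis ..
qed

lemma lborel_distr_reflect:
  fixes c :: "'a::euclidean_space"
  shows "distr lborel borel (\<lambda>x. c - x) = lborel"
  using lborel_affine[of "-1" c] by (simp add: density_1)

lemma nn_integral_lborel_reflect:
  fixes f :: "'a::euclidean_space \<Rightarrow> ennreal"
  assumes [measurable]: "f \<in> borel_measurable borel"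
  shows "(\<integral>\<^sup>+x. f (c - x) \<partial>lborel) = (\<integral>\<^sup>+x. f x \<partial>lborel)"
proof -
  have "(\<integral>\<^sup>+x. f x \<partial>lborel) = (\<integral>\<^sup>+x. f x \<partial>distr lborel borel (\<lambda>x. c - x))"
    by (simp add: lborel_distr_reflect)
  also have "\<dots> = (\<integral>\<^sup>+x. f (c - x) \<partial>lborel)"
    by (subst nn_integral_distr) auto
  finally show ?thesis ..
qed

lemma integral_lborel_shift:
  fixes f :: "'a::euclidean_space \<Rightarrow> 'b::{banach, second_countable_topology}"
  assumes [measurable]: "f \<in> borel_measurable borel"
  shows "(\<integral>x. f (x + c) \<partial>lborel) = (\<integral>x. f x \<partial>lborel)"
proof -
  have "(\<integral>x. f x \<partial>lborel) = (\<integral>x. f x \<partial>distr lborel borel ((+) c))"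
    by (simp add: lborel_distr_plus)
  also have "\<dots> = (\<integral>x. f (x + c) \<partial>lborel)"
    by (subst integral_distr) (auto simp: add.commute)
  finally show ?thesis ..
qed

lemma integrable_lborel_shift:
  fixes f :: "'a::euclidean_space \<Rightarrow> 'b::{banach, second_countable_topology}"
  assumes f: "integrable lborel f"
  shows "integrable lborel (\<lambda>x. f (x + c))"
proof -
  have [measurable]: "f \<in> borel_measurable borel" using borel_measurable_integrable[OF f] by simp
  have "integrable (distr lborel borel ((+) c)) f" by (simp add: lborel_distr_plus f)
  then show ?thesis
    by (subst (asm) integrable_distr_eq) (auto simp: add.commute)
qed

lemma Basis_vec3: "(Basis :: (real^3) set) = (\<lambda>i. axis i 1) ` UNIV"
  by (auto simp: Basis_vec_def)

lemma inj_axis1: "inj (\<lambda>i. axis i (1::real))"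
  by (auto simp: inj_def axis_eq_axis)

lemma prod_Basis_vec3: "(\<Prod>b\<in>(Basis :: (real^3) set). f b) = (\<Prod>i\<in>UNIV. f (axis i 1))"
  unfolding Basis_vec3 by (subst prod.reindex) (auto intro: inj_axis1 inj_on_subset)

lemma norm2_vec3: "(norm (z :: real^3))\<^sup>2 = (\<Sum>i\<in>UNIV. (z $ i)\<^sup>2)"
  by (simp add: norm_vec_def L2_set_def sum_nonneg)

lemma inner_vec3: "(x :: real^3) \<bullet> y = (\<Sum>i\<in>UNIV. x $ i * y $ i)"
  by (simp add: inner_vec_def)

lemma measurable_vec_nth3 [measurable (raw)]:
  assumes "f \<in> measurable M (borel :: (real^3) measure)"
  shows "(\<lambda>x. f x $ i) \<in> borel_measurable M"
proof -
  have "(\<lambda>x. f x \<bullet> axis i 1) \<in> borel_measurable M" using assms by measurable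
  then show ?thesis by (simp add: inner_axis)
qed

lemma nn_integral_prod_vec3:
  assumes [measurable]: "\<And>i. f i \<in> borel_measurable borel"
  shows "(\<integral>\<^sup>+x. (\<Prod>i\<in>UNIV. f i ((x :: real^3) $ i)) \<partial>lborel) = (\<Prod>i\<in>UNIV. (\<integral>\<^sup>+x. f i x \<partial>lborel))"
proof -
  define g where "g b = f (inv (\<lambda>i. axis i (1::real)) b)" for b :: "real^3"
  have g: "g (axis i 1) = f i" for i by (simp add: g_def inv_f_f[OF inj_axis1])
  have "(\<integral>\<^sup>+x. (\<Prod>b\<in>Basis. g b ((x :: real^3) \<bullet> b)) \<partial>lborel) = (\<Prod>b\<in>(Basis::(real^3) set). (\<integral>\<^sup>+x. g b x \<partial>lborel))"
    by (rule nn_integral_lborel_prod) (auto simp: g_def)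
  then show ?thesis by (simp add: prod_Basis_vec3 g inner_axis)
qed

text \<open>Lebesgue measure is the image of the product measure over \<open>Basis\<close> under
  \<open>?T\<close>, and the coordinates of \<open>?T h\<close> are the entries of \<open>h\<close>,
  so the statement for product measures transfers. \<open>g\<close> reindexes the factors by basis
  vectors.\<close>

lemma has_bochner_integral_prod_vec3:
  fixes f :: "3 \<Rightarrow> real \<Rightarrow> complex"
  assumes f: "\<And>i. has_bochner_integral lborel (f i) (I i)"
  shows "has_bochner_integral lborel (\<lambda>x::real^3. \<Prod>i\<in>UNIV. f i (x $ i)) (\<Prod>i\<in>UNIV. I i)"
proof -
  define g where "g b = f (inv (\<lambda>i. axis i (1::real)) b)" for b :: "real^3"
  have g: "g (axis i 1) = f i" for i by (simp add: g_def inv_f_f[OF inj_axis1])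
  have gi: "integrable lborel (g b)" for b using f by (auto simp: g_def has_bochner_integral_iff)
  have [measurable]: "g b \<in> borel_measurable borel" for b
    using borel_measurable_integrable[OF gi] by simp
  interpret product_sigma_finite "\<lambda>_::real^3. lborel :: real measure" ..
  let ?P = "\<Pi>\<^sub>M b\<in>(Basis :: (real^3) set). (lborel :: real measure)"
  let ?T = "\<lambda>h. \<Sum>b\<in>(Basis :: (real^3) set). h b *\<^sub>R b"
  have T: "?T \<in> ?P \<rightarrow>\<^sub>M borel" by measurable
  have c: "?T h \<bullet> b = h b" if "b \<in> Basis" for h b
    using that by (simp add: inner_sum_left inner_Basis if_distrib sum.delta cong: if_cong)
  have "has_bochner_integral ?P (\<lambda>h. \<Prod>b\<in>Basis. g b (h b)) (\<Prod>b\<in>Basis. integral\<^sup>L lborel (g b))"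
    unfolding has_bochner_integral_iff
    using product_integrable_prod[of Basis g] product_integral_prod[of Basis g] gi by auto
  then have "has_bochner_integral ?P (\<lambda>h. \<Prod>b\<in>Basis. g b (?T h \<bullet> b)) (\<Prod>b\<in>Basis. integral\<^sup>L lborel (g b))"
    by (subst has_bochner_integral_cong[OF refl _ refl, where g="\<lambda>h. \<Prod>b\<in>Basis. g b (h b)"])
      (auto intro!: prod.cong simp: c)
  then have "has_bochner_integral (distr ?P borel ?T) (\<lambda>x. \<Prod>b\<in>Basis. g b (x \<bullet> b)) (\<Prod>b\<in>Basis. integral\<^sup>L lborel (g b))"
    using T by (intro has_bochner_integral_distr) (auto simp: has_bochner_integral_iff integrable_distr_eq integral_distr)
  then show ?thesis
    using f by (simp add: lborel_eq[symmetric] prod_Basis_vec3 g inner_axis has_bochner_integral_iff)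
qed

text \<open>The heat kernel at time \<open>s\<close>, the same expression as in
  \<open>heat\<close>.\<close>

definition gauss :: "real \<Rightarrow> real^3 \<Rightarrow> real" where
  "gauss s z = (4 * pi * s) powr (- 3/2) * exp (- (norm z)\<^sup>2 / (4 * s))"

lemma measurable_gauss [measurable (raw)]:
  assumes [measurable]: "f \<in> borel_measurable M" "g \<in> borel_measurable M"
  shows "(\<lambda>x. gauss (f x) (g x)) \<in> borel_measurable M"
  unfolding gauss_def by measurable

lemma gauss_nonneg [simp]: "0 \<le> gauss s z"
  by (simp add: gauss_def)

lemma gauss_pos: "0 < s \<Longrightarrow> 0 < gauss s z"
  by (simp add: gauss_def)

lemma gauss_minus: "gauss s (x - y) = gauss s (y - x)"
  by (simp add: gauss_def norm_minus_commute)

lemma gauss_le: "0 < s \<Longrightarrow> gauss s z \<le> (4 * pi * s) powr (- 3/2)"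
  unfolding gauss_def by (intro mult_left_le) auto

lemma powr_three_halves:
  assumes "0 < x"
  shows "x powr (- (3/2)) = (1 / sqrt x) ^ 3"
proof -
  have "x powr (- (3/2)) = (x powr (- 1/2)) powr 3" using assms by (simp add: powr_powr)
  also have "\<dots> = (x powr (- 1/2)) ^ 3" by (simp add: powr_numeral)
  also have "x powr (- 1/2) = 1 / sqrt x" using assms by (simp add: powr_minus_divide powr_half_sqrt)
  finally show ?thesis .
qed

lemma card_UNIV_3: "card (UNIV :: 3 set) = 3"
  by simp

lemma prod_UNIV_3: "(\<Prod>i\<in>(UNIV :: 3 set). f i) = f 1 * f 2 * (f 3 :: 'a :: comm_monoid_mult)"
  unfolding UNIV_3 by (simp add: ac_simps)

text \<open>The heat kernel at time \<open>s\<close> has variance \<open>2 * s\<close> in each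
  coordinate.\<close>

lemma gauss_prod:
  assumes "0 < s"
  shows "gauss s z = (\<Prod>i\<in>UNIV. normal_density 0 (sqrt (2 * s)) (z $ i))"
proof -
  have "(\<Prod>i\<in>(UNIV::3 set). normal_density 0 (sqrt (2 * s)) (z $ i))
      = (\<Prod>i\<in>(UNIV::3 set). (1 / sqrt (4 * pi * s)) * exp (- (z $ i)\<^sup>2 / (4 * s)))"
    using assms by (intro prod.cong) (auto simp: normal_density_def)
  also have "\<dots> = (1 / sqrt (4 * pi * s)) ^ 3 * exp (\<Sum>i\<in>UNIV. - (z $ i)\<^sup>2 / (4 * s))"
    by (simp only: prod.distrib exp_sum finite prod_constant card_UNIV_3)
  also have "(\<Sum>i\<in>UNIV. - (z $ i)\<^sup>2 / (4 * s)) = - (norm z)\<^sup>2 / (4 * s)"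
    by (simp add: norm2_vec3 sum_negf sum_divide_distrib)
  finally show ?thesis using assms by (simp add: gauss_def powr_three_halves)
qed

lemma nn_integral_gauss:
  assumes "0 < s"
  shows "(\<integral>\<^sup>+z. ennreal (gauss s z) \<partial>lborel) = 1"
proof -
  have "(\<integral>\<^sup>+z. ennreal (gauss s z) \<partial>lborel)
      = (\<integral>\<^sup>+z. (\<Prod>i\<in>UNIV. ennreal (normal_density 0 (sqrt (2 * s)) ((z :: real^3) $ i))) \<partial>lborel)"
    using assms by (simp add: gauss_prod prod_ennreal)
  also have "\<dots> = 1"
    using assms by (subst nn_integral_prod_vec3) (auto simp: nn_integral_eq_integral)
  finally show ?thesis .
qed

lemma nn_integral_gauss_diff:
  assumes "0 < s"
  shows "(\<integral>\<^sup>+y. ennreal (gauss s (x - y)) \<partial>lborel) = 1"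
  using nn_integral_lborel_reflect[of "\<lambda>z. ennreal (gauss s z)" x] nn_integral_gauss[OF assms] by simp

lemma Lq_bound_shift:
  assumes "Lq_bound q f b" and [measurable]: "f \<in> borel_measurable borel"
  shows "Lq_bound q (\<lambda>x. f (x - c)) b"
  using assms(1) nn_integral_lborel_shift[of "\<lambda>x. epowr (f x) (enn2real q)" "- c"]
  by (auto simp: Lq_bound_def)

text \<open>The convolution is an average of translates of \<open>f\<close> with weights
  \<open>gauss s y\<close> of total mass 1, so Minkowski's integral inequality applies.\<close>

lemma Lq_bound_gauss:
  assumes q: "1 \<le> q" and f: "Lq_bound q f b" "0 < b" and s: "0 < s"
    and [measurable]: "f \<in> borel_measurable borel"
  shows "Lq_bound q (\<lambda>x. \<integral>\<^sup>+y. ennreal (gauss s (x - y)) * f y \<partial>lborel) b"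
proof -
  have "Lq_bound q (\<lambda>x. \<integral>\<^sup>+y. ennreal (gauss s y) * f (x - y) \<partial>lborel) b"
  proof (rule Lq_bound_nn_integral[where b="\<lambda>y. gauss s y * b"])
    show "(\<integral>\<^sup>+y. ennreal (gauss s y * b) \<partial>lborel) \<le> ennreal b"
      using f(2) by (simp add: ennreal_mult nn_integral_multc nn_integral_gauss[OF s])
    show "0 \<le> gauss s y * b \<and> Lq_bound q (\<lambda>x. ennreal (gauss s y) * f (x - y)) (gauss s y * b)
        \<and> (gauss s y * b = 0 \<longrightarrow> (\<lambda>x. ennreal (gauss s y) * f (x - y)) = (\<lambda>_. 0))" for y
      using gauss_pos[OF s, of y] f(2) q
      by (auto intro!: Lq_bound_cmult Lq_bound_shift f)
  qed (use q f in \<open>auto intro: lborel.sigma_finite_measure_axioms\<close>)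
  moreover have "(\<integral>\<^sup>+y. ennreal (gauss s (x - y)) * f y \<partial>lborel) = (\<integral>\<^sup>+y. ennreal (gauss s y) * f (x - y) \<partial>lborel)" for x
    using nn_integral_lborel_reflect[of "\<lambda>y. ennreal (gauss s (x - y)) * f y" x] by simp
  ultimately show ?thesis by simp
qed

text \<open>Smoothing from the exponent \<open>q/2\<close> to \<open>q\<close>, applied to the
  square. With \<open>p\<close> the real exponent and \<open>h\<close> the convolution, Jensen's
  inequality bounds \<open>h powr (p/2)\<close> by the convolution of \<open>f powr p\<close>. The
  latter is pointwise at most the maximum of the kernel times \<open>b powr p\<close>, and its
  integral is at most \<open>b powr p\<close>; the product of the two bounds controls the integral
  of \<open>h powr p\<close>.\<close>

lemma Lq_bound_gauss_square:
  assumes q: "2 \<le> q" and f: "Lq_bound q f b" "0 < b" and s: "0 < s"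
    and [measurable]: "f \<in> borel_measurable borel"
  shows "Lq_bound q (\<lambda>x. \<integral>\<^sup>+y. ennreal (gauss s (x - y)) * (f y)\<^sup>2 \<partial>lborel)
    ((4 * pi * s) powr (- (three_over q / 2)) * b\<^sup>2)"
proof (cases "q = \<infinity>")
  case True
  have "(\<integral>\<^sup>+y. ennreal (gauss s (x - y)) * (f y)\<^sup>2 \<partial>lborel) \<le> ennreal (b\<^sup>2)" for x
  proof -
    have "(\<integral>\<^sup>+y. ennreal (gauss s (x - y)) * (f y)\<^sup>2 \<partial>lborel) \<le> (\<integral>\<^sup>+y. ennreal (gauss s (x - y)) * (ennreal b)\<^sup>2 \<partial>lborel)"
      using f True by (intro nn_integral_mono mult_left_mono power_mono) (auto simp: Lq_bound_def)
    also have "\<dots> = ennreal (b\<^sup>2)"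
      using f(2) by (simp add: nn_integral_multc nn_integral_gauss_diff[OF s] ennreal_power)
    finally show ?thesis .
  qed
  then show ?thesis using True s by (simp add: Lq_bound_def three_over_def)
next
  case False
  define p where "p = enn2real q"
  have p: "2 \<le> p" using enn2real_mono[OF q] False by (simp add: less_top p_def)
  let ?h = "\<lambda>x. \<integral>\<^sup>+y. ennreal (gauss s (x - y)) * (f y)\<^sup>2 \<partial>lborel"
  let ?I = "\<integral>\<^sup>+y. epowr (f y) p \<partial>lborel"
  have I: "?I \<le> ennreal (b powr p)" using f False by (simp add: Lq_bound_def p_def)
  have sq: "epowr x p = (epowr x (p / 2))\<^sup>2" for x
  proof (cases x)
    case (real r)
    have "r powr p = r powr (p/2) * r powr (p/2)" by (simp only: powr_add[symmetric] field_sum_of_halves)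
    then show ?thesis using real by (simp add: power2_eq_square ennreal_mult)
  qed (auto simp: ennreal_top_mult power2_eq_square)
  have sq': "epowr (x\<^sup>2) (p / 2) = epowr x p" for x
    using p epowr_mult[of "p/2" x x] by (simp add: sq power2_eq_square)
  have jensen: "epowr (?h x) (p / 2) \<le> (\<integral>\<^sup>+y. ennreal (gauss s (x - y)) * epowr (f y) p \<partial>lborel)" for x
  proof -
    let ?N = "density lborel (\<lambda>y. ennreal (gauss s (x - y)))"
    have "epowr (\<integral>\<^sup>+y. (f y)\<^sup>2 \<partial>?N) (p / 2) \<le> (\<integral>\<^sup>+y. epowr ((f y)\<^sup>2) (p / 2) \<partial>?N)"
      using p by (intro epowr_nn_integral_le) (auto simp: emeasure_density nn_integral_gauss_diff[OF s])
    then show ?thesis by (simp add: nn_integral_density sq')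
  qed
  let ?c = "(4 * pi * s) powr (- 3/2)"
  have bnd: "(\<integral>\<^sup>+y. ennreal (gauss s (x - y)) * epowr (f y) p \<partial>lborel) \<le> ennreal ?c * ?I" for x
  proof -
    have "(\<integral>\<^sup>+y. ennreal (gauss s (x - y)) * epowr (f y) p \<partial>lborel) \<le> (\<integral>\<^sup>+y. ennreal ?c * epowr (f y) p \<partial>lborel)"
      by (intro nn_integral_mono mult_right_mono ennreal_leI gauss_le s) auto
    then show ?thesis by (simp add: nn_integral_cmult)
  qed
  have "(\<integral>\<^sup>+x. epowr (?h x) p \<partial>lborel)
      \<le> (\<integral>\<^sup>+x. (ennreal ?c * ?I) * (\<integral>\<^sup>+y. ennreal (gauss s (x - y)) * epowr (f y) p \<partial>lborel) \<partial>lborel)"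
  proof (rule nn_integral_mono)
    fix x
    \<comment> \<open>One factor is bounded uniformly in \<open>x\<close>, the other is kept for the
      integration.\<close>
    have "epowr (?h x) p = epowr (?h x) (p/2) * epowr (?h x) (p/2)"
      using sq[of "?h x"] by (simp add: power2_eq_square)
    also have "\<dots> \<le> (ennreal ?c * ?I) * (\<integral>\<^sup>+y. ennreal (gauss s (x - y)) * epowr (f y) p \<partial>lborel)"
      by (intro mult_mono jensen order_trans[OF jensen bnd]) auto
    finally show "epowr (?h x) p \<le> (ennreal ?c * ?I) * (\<integral>\<^sup>+y. ennreal (gauss s (x - y)) * epowr (f y) p \<partial>lborel)" .
  qed
  also have "\<dots> = (ennreal ?c * ?I) * (\<integral>\<^sup>+x. \<integral>\<^sup>+y. ennreal (gauss s (x - y)) * epowr (f y) p \<partial>lborel \<partial>lborel)"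
    by (intro nn_integral_cmult) measurable
  also have "(\<integral>\<^sup>+x. \<integral>\<^sup>+y. ennreal (gauss s (x - y)) * epowr (f y) p \<partial>lborel \<partial>lborel)
      = (\<integral>\<^sup>+y. \<integral>\<^sup>+x. ennreal (gauss s (x - y)) * epowr (f y) p \<partial>lborel \<partial>lborel)"
    by (rule lborel_pair.Fubini') measurable
  also have "\<dots> = ?I"
    by (subst gauss_minus) (simp add: nn_integral_multc nn_integral_gauss_diff[OF s])
  also have "ennreal ?c * ?I * ?I \<le> ennreal ?c * ennreal (b powr p) * ennreal (b powr p)"
    by (intro mult_mono I) auto
  also have "\<dots> = ennreal (((4 * pi * s) powr (- (three_over q / 2)) * b\<^sup>2) powr p)"
  proof -
    have "((4 * pi * s) powr (- (three_over q / 2)) * b\<^sup>2) powr p = ?c * b powr p * b powr p"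
      using p s f(2) False by (simp add: powr_mult powr_powr three_over_def p_def[symmetric] power2_eq_square)
    then show ?thesis by (simp add: ennreal_mult)
  qed
  finally show ?thesis using False by (simp add: Lq_bound_def p_def)
qed

text \<open>The characteristic function of the standard normal distribution, rescaled by
  \<open>c = sqrt (2 * s)\<close>.\<close>

lemma fourier_gauss_real:
  assumes "0 < s"
  shows "has_bochner_integral lborel (\<lambda>x. cis (t * x) * complex_of_real (exp (- s * x\<^sup>2)))
    (complex_of_real (sqrt (pi / s) * exp (- t\<^sup>2 / (4 * s))))"
proof -
  define c where "c = sqrt (2 * s)"
  have c: "c > 0" "c\<^sup>2 = 2 * s" using assms by (auto simp: c_def)
  let ?f = "\<lambda>x. complex_of_real (std_normal_density x) * iexp (t / c * x)"
  have int: "integrable lborel ?f"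
    by (rule Bochner_Integration.integrable_bound[where f="std_normal_density"]) (auto simp: norm_mult)
  have "char std_normal_distribution (t / c) = (\<integral>x. ?f x \<partial>lborel)"
    unfolding char_def by (subst integral_density) (auto simp: scaleR_conv_of_real)
  then have "has_bochner_integral lborel ?f (complex_of_real (exp (- ((t/c)\<^sup>2) / 2)))"
    using int by (simp add: has_bochner_integral_iff char_std_normal_distribution)
  then have "has_bochner_integral lborel (\<lambda>x. ?f (0 + c * x)) (complex_of_real (exp (- ((t/c)\<^sup>2) / 2)) /\<^sub>R \<bar>c\<bar>)"
    using c(1) lborel_has_bochner_integral_real_affine_iff[of c ?f "complex_of_real (exp (- ((t/c)\<^sup>2) / 2))" 0] by blast
  then have "has_bochner_integral lborel (\<lambda>x. ?f (c * x)) (complex_of_real (exp (- ((t/c)\<^sup>2) / 2)) /\<^sub>R c)"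
    using c(1) by (simp only: add_0 abs_of_pos)
  then have "has_bochner_integral lborel (\<lambda>x. complex_of_real (sqrt (2 * pi)) * ?f (c * x))
     (complex_of_real (sqrt (2 * pi)) * (complex_of_real (exp (- ((t/c)\<^sup>2) / 2)) /\<^sub>R c))"
    by (intro has_bochner_integral_mult_right)
  moreover have "complex_of_real (sqrt (2 * pi)) * ?f (c * x) = cis (t * x) * complex_of_real (exp (- s * x\<^sup>2))" for x
    using c by (simp add: std_normal_density_def power_mult_distrib cis_conv_exp mult_ac)
  moreover have "complex_of_real (sqrt (2 * pi)) * (complex_of_real (exp (- ((t/c)\<^sup>2) / 2)) /\<^sub>R c)
      = complex_of_real (sqrt (pi / s) * exp (- t\<^sup>2 / (4 * s)))"
  proof -
    have A: "sqrt (2 * pi) / c = sqrt (pi / s)"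
      unfolding c_def using assms by (simp add: real_sqrt_divide[symmetric])
    have B: "- ((t/c)\<^sup>2) / 2 = - t\<^sup>2 / (4 * s)" using c by (simp add: power_divide)
    have eq: "sqrt (2 * pi) * (inverse c * exp (- ((t/c)\<^sup>2) / 2)) = sqrt (pi / s) * exp (- t\<^sup>2 / (4 * s))"
      unfolding A[symmetric] B by (simp only: divide_inverse mult.assoc)
    show ?thesis unfolding scaleR_conv_of_real of_real_mult[symmetric] eq ..
  qed
  ultimately show ?thesis by simp
qed

lemma fourier_gauss:
  fixes z :: "real^3"
  assumes "0 < s"
  shows "has_bochner_integral lborel (\<lambda>\<xi>. cis (z \<bullet> \<xi>) * complex_of_real (exp (- s * (norm \<xi>)\<^sup>2)))
    (complex_of_real ((2 * pi)^3 * gauss s z))"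
proof -
  have "has_bochner_integral lborel (\<lambda>x::real^3. \<Prod>i\<in>UNIV. cis (z $ i * x $ i) * complex_of_real (exp (- s * (x $ i)\<^sup>2)))
      (\<Prod>i\<in>UNIV. complex_of_real (sqrt (pi / s) * exp (- (z $ i)\<^sup>2 / (4 * s))))"
    by (intro has_bochner_integral_prod_vec3 fourier_gauss_real assms)
  moreover have "(\<Prod>i\<in>UNIV. cis (z $ i * x $ i) * complex_of_real (exp (- s * (x $ i)\<^sup>2)))
      = cis (z \<bullet> x) * complex_of_real (exp (- s * (norm x)\<^sup>2))" for x :: "real^3"
  proof -
    have "cis (z \<bullet> x) = (\<Prod>i\<in>UNIV. cis (z $ i * x $ i))"
      by (simp only: inner_vec3 sum_3 prod_UNIV_3 cis_mult)
    moreover have "exp (- s * (norm x)\<^sup>2) = (\<Prod>i\<in>UNIV. exp (- s * (x $ i)\<^sup>2))"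
      by (simp only: norm2_vec3 sum_distrib_left exp_sum finite)
    ultimately show ?thesis by (simp only: prod.distrib of_real_prod)
  qed
  moreover have "(\<Prod>i\<in>UNIV. sqrt (pi / s) * exp (- (z $ i)\<^sup>2 / (4 * s))) = (2 * pi)^3 * gauss s z"
  proof -
    have "(2 * pi)^3 * (1 / sqrt (4 * pi * s))^3 = sqrt (pi / s) ^ 3"
    proof -
      have "2 * pi * (1 / sqrt (4 * pi * s)) = sqrt (pi / s)"
        using assms by (simp add: real_sqrt_mult real_sqrt_divide field_simps)
      then show ?thesis by (metis power_mult_distrib)
    qed
    moreover have "(\<Prod>i\<in>(UNIV::3 set). exp (- (z $ i)\<^sup>2 / (4 * s))) = exp (- (norm z)\<^sup>2 / (4 * s))"
      by (simp add: exp_sum[symmetric] norm2_vec3 sum_negf sum_divide_distrib)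
    ultimately show ?thesis using assms
      by (simp add: prod.distrib gauss_def powr_three_halves mult.assoc[symmetric])
  qed
  ultimately show ?thesis by (simp only: of_real_prod[symmetric])
qed

section \<open>Dominated integrals of holomorphic functions\<close>

text \<open>Cauchy's estimate on the circle of radius \<open>r/2\<close>, since \<open>f\<close> is
  controlled on the open ball only; this gives the factor 2.\<close>

lemma holomorphic_deriv_bound:
  assumes f: "f holomorphic_on ball z r" and b: "\<And>w. w \<in> ball z r \<Longrightarrow> norm (f w) \<le> b" and r: "0 < r"
  shows "norm (deriv f z) \<le> 2 * b / r"
proof -
  have "norm ((deriv ^^ 1) f z) \<le> fact 1 * b / (r/2) ^ 1"
  proof (rule Cauchy_inequality)
    show "f holomorphic_on ball z (r/2)" using f by (rule holomorphic_on_subset) (use r in auto)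
    show "continuous_on (cball z (r/2)) f"
      using holomorphic_on_imp_continuous_on[OF f] by (rule continuous_on_subset) (use r in auto)
    show "\<And>x. norm (z - x) = r/2 \<Longrightarrow> norm (f x) \<le> b" using r by (intro b) (auto simp: dist_norm)
  qed (use r in auto)
  then show ?thesis by (simp add: field_simps)
qed

text \<open>Cauchy's estimate makes \<open>f w y\<close> Lipschitz in \<open>w\<close> near
  \<open>z\<close> with constant \<open>2 * b y / r\<close>. This dominates the difference
  quotients, and dominated convergence differentiates under the integral.\<close>

lemma has_field_derivative_integral:
  fixes f :: "complex \<Rightarrow> 'y \<Rightarrow> complex"
  assumes S: "open S" and z: "z \<in> S"
    and meas[measurable]: "\<And>w. w \<in> S \<Longrightarrow> f w \<in> borel_measurable M"
    and hol: "AE y in M. (\<lambda>w. f w y) holomorphic_on S \<and> (\<forall>w\<in>S. norm (f w y) \<le> b y)"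
    and b: "integrable M b"
  shows "\<exists>g\<in>borel_measurable M. (AE y in M. ((\<lambda>w. f w y) has_field_derivative g y) (at z))
    \<and> ((\<lambda>w. \<integral>y. f w y \<partial>M) has_field_derivative (\<integral>y. g y \<partial>M)) (at z)"
proof -
  obtain r where r: "0 < r" "ball z (2*r) \<subseteq> S"
  proof -
    obtain e where "e > 0" "ball z e \<subseteq> S" using openE[OF S z] by blast
    then show ?thesis using that[of "e/2"] by auto
  qed
  have lip: "AE y in M. (\<forall>w\<in>ball z r. norm (f w y - f z y) \<le> 2 * b y / r * norm (w - z))
      \<and> (\<lambda>w. f w y) field_differentiable (at z)"
    using hol
  proof eventually_elim
    fix y assume h: "(\<lambda>w. f w y) holomorphic_on S \<and> (\<forall>w\<in>S. norm (f w y) \<le> b y)"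
    have "norm (f w y - f z y) \<le> 2 * b y / r * norm (w - z)" if w: "w \<in> ball z r" for w
    proof (rule field_differentiable_bound[where S="ball z r" and f'="deriv (\<lambda>w. f w y)"])
      fix v assume v: "v \<in> ball z r"
      have sub: "ball v r \<subseteq> S"
      proof
        fix u assume "u \<in> ball v r"
        then have "dist z u < 2 * r" using v dist_triangle[of z u v] by auto
        then show "u \<in> S" using r by auto
      qed
      have "v \<in> S" using sub r by auto
      then show "((\<lambda>w. f w y) has_field_derivative deriv (\<lambda>w. f w y) v) (at v within ball z r)"
        using h S by (meson DERIV_deriv_iff_field_differentiable has_field_derivative_at_within holomorphic_on_imp_differentiable_at)
      show "norm (deriv (\<lambda>w. f w y) v) \<le> 2 * b y / r"
        using h sub r by (intro holomorphic_deriv_bound) (auto intro: holomorphic_on_subset)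
    qed (use w r in auto)
    moreover have "(\<lambda>w. f w y) field_differentiable (at z)"
      using h S z by (auto intro: holomorphic_on_imp_differentiable_at)
    ultimately show "(\<forall>w\<in>ball z r. norm (f w y - f z y) \<le> 2 * b y / r * norm (w - z))
      \<and> (\<lambda>w. f w y) field_differentiable (at z)" by blast
  qed
  have int: "integrable M (f w)" if "w \<in> S" for w
  proof (rule Bochner_Integration.integrable_bound[OF b meas[OF that]])
    show "AE y in M. norm (f w y) \<le> norm (b y)"
      using hol by eventually_elim (use that in force)
  qed
  \<comment> \<open>One fixed sequence tending to \<open>z\<close>. The derivative \<open>g\<close>
    is defined as the limit along it, which makes its measurability in \<open>y\<close>
    evident.\<close>
  define Z where "Z i = z + complex_of_real (r / (real i + 2))" for i
  have Z: "Z i \<in> S" "Z i \<noteq> z" for i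
  proof -
    have "r / (real i + 2) < r" using r by (simp add: field_simps add_pos_nonneg)
    then show "Z i \<in> S" "Z i \<noteq> z" using r
      by (auto simp: Z_def dist_norm norm_divide simp flip: of_real_divide of_real_add intro!: subsetD[OF r(2)])
  qed
  have Zlim: "Z \<longlonglongrightarrow> z"
  proof -
    have "(\<lambda>i. r / (real i + 2)) \<longlonglongrightarrow> 0" by real_asymp
    then have "(\<lambda>i. complex_of_real (r / (real i + 2))) \<longlonglongrightarrow> complex_of_real 0" by (rule tendsto_of_real)
    from tendsto_add[OF tendsto_const this, of z] show ?thesis unfolding Z_def by (simp only: of_real_0 add_0_right)
  qed
  define g where "g y = lim (\<lambda>i. (f (Z i) y - f z y) / (Z i - z))" for y
  have [measurable]: "f (Z i) \<in> borel_measurable M" "f z \<in> borel_measurable M" for i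
    using Z z by auto
  have g_meas [measurable]: "g \<in> borel_measurable M"
    unfolding g_def by measurable
  have quot: "AE y in M. ((\<lambda>w. (f w y - f z y) / (w - z)) \<longlongrightarrow> g y) (at z)"
    using lip
  proof eventually_elim
    fix y assume "(\<forall>w\<in>ball z r. norm (f w y - f z y) \<le> 2 * b y / r * norm (w - z))
      \<and> (\<lambda>w. f w y) field_differentiable (at z)"
    then obtain d where d: "((\<lambda>w. (f w y - f z y) / (w - z)) \<longlongrightarrow> d) (at z)"
      by (auto simp: field_differentiable_def has_field_derivative_iff)
    then have "(\<lambda>i. (f (Z i) y - f z y) / (Z i - z)) \<longlonglongrightarrow> d"
      using Zlim Z(2) by (auto simp: tendsto_at_iff_sequentially o_def)
    then have "g y = d" by (simp add: g_def limI)
    with d show "((\<lambda>w. (f w y - f z y) / (w - z)) \<longlongrightarrow> g y) (at z)" by simp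
  qed
  \<comment> \<open>Dominated convergence is sequential, so the limit at \<open>z\<close> is tested
    on arbitrary sequences, after dropping an initial segment that may lie outside the ball.\<close>
  have lim: "((\<lambda>w. \<integral>y. (f w y - f z y) / (w - z) \<partial>M) \<longlongrightarrow> (\<integral>y. g y \<partial>M)) (at z)"
  proof (rule tendsto_at_iff_sequentially[THEN iffD2], intro allI impI)
    fix X assume X: "\<forall>i. X i \<in> UNIV - {z}" "X \<longlonglongrightarrow> z"
    have "eventually (\<lambda>i. X i \<in> ball z r) sequentially"
      using X(2) r by (intro topological_tendstoD[of X z]) auto
    then obtain N where N: "\<And>i. N \<le> i \<Longrightarrow> X i \<in> ball z r" unfolding eventually_sequentially by blast
    define Y where "Y i = X (i + N)" for i
    have Y: "Y i \<in> ball z r" "Y i \<noteq> z" for i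
      using N[of "i + N"] X(1) by (auto simp: Y_def)
    have YS: "Y i \<in> S" for i using Y(1)[of i] r by (auto intro!: subsetD[OF r(2)])
    have Ylim: "Y \<longlonglongrightarrow> z" unfolding Y_def using X(2) by (rule LIMSEQ_ignore_initial_segment)
    have [measurable]: "f (Y i) \<in> borel_measurable M" for i using YS by auto
    have "(\<lambda>i. \<integral>y. (f (Y i) y - f z y) / (Y i - z) \<partial>M) \<longlonglongrightarrow> (\<integral>y. g y \<partial>M)"
    proof (rule integral_dominated_convergence[where w="\<lambda>y. 2 * b y / r"])
      show "AE y in M. (\<lambda>i. (f (Y i) y - f z y) / (Y i - z)) \<longlonglongrightarrow> g y"
        using quot by eventually_elim (use Ylim Y(2) in \<open>auto simp: tendsto_at_iff_sequentially o_def\<close>)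
      show "integrable M (\<lambda>y. 2 * b y / r)" using b by auto
      show "AE y in M. norm ((f (Y i) y - f z y) / (Y i - z)) \<le> 2 * b y / r" for i
        using lip
      proof eventually_elim
        fix y assume "(\<forall>w\<in>ball z r. norm (f w y - f z y) \<le> 2 * b y / r * norm (w - z))
          \<and> (\<lambda>w. f w y) field_differentiable (at z)"
        then have "norm (f (Y i) y - f z y) \<le> 2 * b y / r * norm (Y i - z)" using Y by blast
        then show "norm ((f (Y i) y - f z y) / (Y i - z)) \<le> 2 * b y / r"
          using Y(2)[of i] by (simp add: norm_divide pos_divide_le_eq)
      qed
    qed measurable
    then show "((\<lambda>w. \<integral>y. (f w y - f z y) / (w - z) \<partial>M) \<circ> X) \<longlonglongrightarrow> (\<integral>y. g y \<partial>M)"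
      unfolding o_def Y_def by (rule LIMSEQ_offset)
  qed
  have "((\<lambda>w. ((\<integral>y. f w y \<partial>M) - (\<integral>y. f z y \<partial>M)) / (w - z)) \<longlongrightarrow> (\<integral>y. g y \<partial>M)) (at z)"
  proof (rule Lim_transform_eventually[OF lim])
    have "eventually (\<lambda>w. w \<in> S) (at z)" using S z by (simp add: eventually_at_in_open' )
    then show "eventually (\<lambda>w. (\<integral>y. (f w y - f z y) / (w - z) \<partial>M) = ((\<integral>y. f w y \<partial>M) - (\<integral>y. f z y \<partial>M)) / (w - z)) (at z)"
      by eventually_elim (use int z in simp)
  qed
  then have "((\<lambda>w. \<integral>y. f w y \<partial>M) has_field_derivative (\<integral>y. g y \<partial>M)) (at z)"
    by (simp add: has_field_derivative_iff)
  moreover have "AE y in M. ((\<lambda>w. f w y) has_field_derivative g y) (at z)"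
    using quot by (simp add: has_field_derivative_iff)
  ultimately show ?thesis using g_meas by blast
qed

lemma holomorphic_on_integral:
  fixes f :: "complex \<Rightarrow> 'y \<Rightarrow> complex"
  assumes "open S" "\<And>w. w \<in> S \<Longrightarrow> f w \<in> borel_measurable M"
    and "AE y in M. (\<lambda>w. f w y) holomorphic_on S \<and> (\<forall>w\<in>S. norm (f w y) \<le> b y)"
    and "integrable M b"
  shows "(\<lambda>w. \<integral>y. f w y \<partial>M) holomorphic_on S"
  unfolding holomorphic_on_open[OF assms(1)]
  using has_field_derivative_integral[OF assms(1) _ assms(2-4)] by blast

lemma has_field_derivative_integral_eq:
  fixes f :: "complex \<Rightarrow> 'y \<Rightarrow> complex"
  assumes "open S" "z \<in> S" "\<And>w. w \<in> S \<Longrightarrow> f w \<in> borel_measurable M"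
    and "AE y in M. (\<lambda>w. f w y) holomorphic_on S \<and> (\<forall>w\<in>S. norm (f w y) \<le> b y)"
    and "integrable M b"
    and g: "g \<in> borel_measurable M" "\<And>y. ((\<lambda>w. f w y) has_field_derivative g y) (at z)"
  shows "((\<lambda>w. \<integral>y. f w y \<partial>M) has_field_derivative (\<integral>y. g y \<partial>M)) (at z)"
proof -
  obtain g' where g': "g' \<in> borel_measurable M" "AE y in M. ((\<lambda>w. f w y) has_field_derivative g' y) (at z)"
    "((\<lambda>w. \<integral>y. f w y \<partial>M) has_field_derivative (\<integral>y. g' y \<partial>M)) (at z)"
    using has_field_derivative_integral[OF assms(1-5)] by blast
  have "(\<integral>y. g' y \<partial>M) = (\<integral>y. g y \<partial>M)"
    by (rule integral_cong_AE) (use g g' in \<open>auto elim!: eventually_mono intro: DERIV_unique\<close>)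
  then show ?thesis using g' by simp
qed

lemma norm_integral_le_nn: "ennreal (norm (\<integral>x. f x \<partial>N)) \<le> (\<integral>\<^sup>+x. ennreal (norm (f x)) \<partial>N)"
  for f :: "'z \<Rightarrow> complex"
  by (cases "integrable N f") (auto simp: integral_norm_bound_ennreal not_integrable_integral_eq)

section \<open>Picard iteration with a majorant\<close>

text \<open>The equation \<open>w = w0 - \<integral> K (w, w)\<close> in abstract form.
  \<open>p\<close> stands for a space-time point and \<open>h\<close> for a complex shift;
  \<open>V\<close> and \<open>k\<close> dominate the data uniformly for \<open>h\<close> in
  \<open>H\<close>. No norm and no smallness enters here: convergence is proved at each point where
  the limit of the majorants is finite, and smallness serves later to produce such points.\<close>

locale picard = sigma_finite_measure M for M :: "'p measure" +
  fixes w0 :: "'h \<Rightarrow> 'p \<Rightarrow> 'i::finite \<Rightarrow> complex"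
    and K :: "'h \<Rightarrow> 'p \<Rightarrow> 'p \<Rightarrow> 'i \<Rightarrow> 'i \<Rightarrow> 'i \<Rightarrow> complex"
    and V :: "'p \<Rightarrow> ennreal" and k :: "'p \<Rightarrow> 'p \<Rightarrow> ennreal" and H :: "'h set"
  assumes w0_meas [measurable]: "\<And>h i. (\<lambda>p. w0 h p i) \<in> borel_measurable M"
    and K_meas [measurable]: "\<And>h i j l. (\<lambda>(p, p'). K h p p' i j l) \<in> borel_measurable (M \<Otimes>\<^sub>M M)"
    and V_meas [measurable]: "V \<in> borel_measurable M"
    and k_meas [measurable]: "(\<lambda>(p, p'). k p p') \<in> borel_measurable (M \<Otimes>\<^sub>M M)"
    and w0_le: "\<And>h p i. h \<in> H \<Longrightarrow> ennreal (norm (w0 h p i)) \<le> V p"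
    and K_le: "\<And>h p p' i. h \<in> H \<Longrightarrow> ennreal (\<Sum>j\<in>UNIV. \<Sum>l\<in>UNIV. norm (K h p p' i j l)) \<le> k p p'"
begin

definition B :: "'h \<Rightarrow> ('p \<Rightarrow> 'i \<Rightarrow> complex) \<Rightarrow> 'p \<Rightarrow> 'p \<Rightarrow> 'i \<Rightarrow> complex" where
  "B h w p p' i = (\<Sum>j\<in>UNIV. \<Sum>l\<in>UNIV. K h p p' i j l * (w p' j * w p' l))"

primrec W :: "nat \<Rightarrow> 'h \<Rightarrow> 'p \<Rightarrow> 'i \<Rightarrow> complex" where
  "W 0 h p i = w0 h p i"
| "W (Suc m) h p i = w0 h p i - (\<integral>p'. B h (W m h) p p' i \<partial>M)"

text \<open>The majorant iteration: the minus sign becomes a plus, and the data are replaced by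
  \<open>V\<close> and \<open>k\<close>. It is increasing, so its limit always exists as an extended
  real.\<close>

primrec U :: "nat \<Rightarrow> 'p \<Rightarrow> ennreal" where
  "U 0 p = V p"
| "U (Suc m) p = V p + (\<integral>\<^sup>+p'. k p p' * (U m p')\<^sup>2 \<partial>M)"

lemma k_meas1 [measurable]: "p \<in> space M \<Longrightarrow> k p \<in> borel_measurable M"
  using measurable_Pair2[OF k_meas] by simp

lemma B_measurable:
  assumes [measurable]: "\<And>i. (\<lambda>p. w p i) \<in> borel_measurable M"
  shows "(\<lambda>(p, p'). B h w p p' i) \<in> borel_measurable (M \<Otimes>\<^sub>M M)"
  unfolding B_def by measurable

lemma W_measurable [measurable]: "(\<lambda>p. W m h p i) \<in> borel_measurable M"
proof (induction m arbitrary: i)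
  case (Suc m)
  note [measurable] = B_measurable[of "W m h", OF Suc]
  show ?case by simp
qed simp

lemma U_measurable [measurable]: "U m \<in> borel_measurable M"
proof (induction m)
  case (Suc m)
  note [measurable] = Suc
  show ?case by simp
qed simp

lemma B_measurable1:
  assumes "\<And>i. (\<lambda>p. w p i) \<in> borel_measurable M" "p \<in> space M"
  shows "(\<lambda>p'. B h w p p' i) \<in> borel_measurable M"
  using measurable_Pair2[OF B_measurable[OF assms(1)] assms(2)] by simp

lemma U_mono_Suc: "U m p \<le> U (Suc m) p"
proof (induction m arbitrary: p)
  case (Suc m)
  have "(\<integral>\<^sup>+p'. k p p' * (U m p')\<^sup>2 \<partial>M) \<le> (\<integral>\<^sup>+p'. k p p' * (U (Suc m) p')\<^sup>2 \<partial>M)"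
    by (intro nn_integral_mono mult_left_mono power_mono Suc) auto
  then show ?case by (simp add: add_left_mono)
qed simp

lemma incseq_U: "incseq (\<lambda>m. U m p)"
  using U_mono_Suc by (intro incseq_SucI) blast

definition Uinf :: "'p \<Rightarrow> ennreal" where "Uinf p = (SUP m. U m p)"

lemma Uinf_measurable [measurable]: "Uinf \<in> borel_measurable M"
  unfolding Uinf_def by measurable

lemma U_le_Uinf: "U m p \<le> Uinf p"
  unfolding Uinf_def by (rule SUP_upper) auto

text \<open>Monotone convergence; the identity includes infinite values.\<close>

lemma Uinf_eq:
  assumes "p \<in> space M"
  shows "Uinf p = V p + (\<integral>\<^sup>+p'. k p p' * (Uinf p')\<^sup>2 \<partial>M)"
proof -
  have inc: "incseq (\<lambda>m p'. k p p' * (U m p')\<^sup>2)"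
    by (auto simp: incseq_def le_fun_def intro!: mult_left_mono power_mono incseqD[OF incseq_U])
  have sq: "(Uinf p')\<^sup>2 = (SUP m. (U m p')\<^sup>2)" for p'
  proof -
    have "(\<lambda>m. U m p') \<longlonglongrightarrow> Uinf p'"
      unfolding Uinf_def by (rule LIMSEQ_SUP[OF incseq_U])
    then have "(\<lambda>m. U m p' * U m p') \<longlonglongrightarrow> Uinf p' * Uinf p'"
      by (intro tendsto_mult_ennreal) auto
    moreover have "incseq (\<lambda>m. U m p' * U m p')"
      by (auto simp: incseq_def intro!: mult_mono incseqD[OF incseq_U])
    ultimately show ?thesis using LIMSEQ_SUP LIMSEQ_unique by (metis (no_types, lifting) power2_eq_square SUP_cong)
  qed
  have "(\<integral>\<^sup>+p'. k p p' * (Uinf p')\<^sup>2 \<partial>M) = (\<integral>\<^sup>+p'. (SUP m. k p p' * (U m p')\<^sup>2) \<partial>M)"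
    by (simp add: sq SUP_mult_left_ennreal)
  also have "\<dots> = (SUP m. \<integral>\<^sup>+p'. k p p' * (U m p')\<^sup>2 \<partial>M)"
    using assms by (intro nn_integral_monotone_convergence_SUP[OF inc]) measurable
  finally have I: "(\<integral>\<^sup>+p'. k p p' * (Uinf p')\<^sup>2 \<partial>M) = (SUP m. \<integral>\<^sup>+p'. k p p' * (U m p')\<^sup>2 \<partial>M)" .
  have "Uinf p = (SUP m. U (Suc m) p)"
  proof (rule LIMSEQ_unique)
    show "(\<lambda>m. U (Suc m) p) \<longlonglongrightarrow> Uinf p"
      unfolding Uinf_def by (rule LIMSEQ_Suc[OF LIMSEQ_SUP[OF incseq_U]])
    show "(\<lambda>m. U (Suc m) p) \<longlonglongrightarrow> (SUP m. U (Suc m) p)"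
      by (rule LIMSEQ_SUP, rule incseq_SucI, rule U_mono_Suc)
  qed
  also have "\<dots> = V p + (\<integral>\<^sup>+p'. k p p' * (Uinf p')\<^sup>2 \<partial>M)"
    by (simp add: I ennreal_SUP_add_right)
  finally show ?thesis .
qed

text \<open>For infinite \<open>u\<close> the right side is infinite unless
  \<open>k p p' = 0\<close>, and in that case all entries of \<open>K\<close> vanish.\<close>

lemma B_le:
  assumes "h \<in> H" "\<And>j. ennreal (norm (w p' j)) \<le> u"
  shows "ennreal (norm (B h w p p' i)) \<le> k p p' * u\<^sup>2"
proof (cases "u = \<top>")
  case True
  show ?thesis
  proof (cases "k p p' = 0")
    case True
    then have "(\<Sum>j\<in>UNIV. \<Sum>l\<in>UNIV. norm (K h p p' i j l)) = 0"
      using K_le[OF assms(1), of p p' i] by (simp add: ennreal_eq_0_iff sum_nonneg antisym)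
    then have "K h p p' i j l = 0" for j l
      by (simp add: sum_nonneg_eq_0_iff sum_nonneg)
    then show ?thesis by (simp add: B_def)
  qed (simp add: \<open>u = \<top>\<close> power2_eq_square ennreal_mult_top)
next
  case False
  then obtain r where r: "u = ennreal r" "0 \<le> r" by (cases u) auto
  have w: "norm (w p' j) \<le> r" for j using assms(2)[of j] r by simp
  have "norm (B h w p p' i) \<le> (\<Sum>j\<in>UNIV. \<Sum>l\<in>UNIV. norm (K h p p' i j l) * (r * r))"
    unfolding B_def
    by (intro sum_norm_le) (auto simp: norm_mult intro!: mult_left_mono mult_mono w r)
  also have "\<dots> = (\<Sum>j\<in>UNIV. \<Sum>l\<in>UNIV. norm (K h p p' i j l)) * r\<^sup>2"
    by (simp add: sum_distrib_right power2_eq_square)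
  finally have "ennreal (norm (B h w p p' i)) \<le> ennreal (\<Sum>j\<in>UNIV. \<Sum>l\<in>UNIV. norm (K h p p' i j l)) * ennreal (r\<^sup>2)"
    using r by (simp add: ennreal_mult[symmetric] sum_nonneg ennreal_leI)
  also have "\<dots> \<le> k p p' * u\<^sup>2" using r by (auto intro!: mult_mono K_le assms simp: ennreal_power)
  finally show ?thesis .
qed

text \<open>Splitting the difference of products as \<open>(w_j - v_j) w_l + v_j (w_l - v_l)\<close>
  and bounding by \<open>r - r'\<close>, \<open>r\<close> and \<open>r'\<close> gives exactly
  \<open>r\<^sup>2 - r'\<^sup>2\<close>. The estimate is arranged as a sum because subtraction of
  extended reals is truncated.\<close>

lemma B_diff_le:
  assumes "h \<in> H" "\<And>j. ennreal (norm (w p' j)) \<le> u" "\<And>j. ennreal (norm (v p' j)) \<le> u'"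
    "\<And>j. ennreal (norm (w p' j - v p' j)) + u' \<le> u"
  shows "ennreal (norm (B h w p p' i - B h v p p' i)) + k p p' * u'\<^sup>2 \<le> k p p' * u\<^sup>2"
proof (cases "u = \<top>")
  case True
  show ?thesis
  proof (cases "k p p' = 0")
    case True
    then have "B h w p p' i = 0" "B h v p p' i = 0"
      using B_le[OF assms(1), of w p' u p i] B_le[OF assms(1), of v p' u' p i] assms(2,3) by (auto simp: ennreal_eq_0_iff)
    then show ?thesis using True by simp
  qed (simp add: \<open>u = \<top>\<close> power2_eq_square ennreal_mult_top)
next
  case False
  then obtain r where r: "u = ennreal r" "0 \<le> r" by (cases u) auto
  have "u' \<le> u" using assms(4)[of undefined] by (meson add_increasing order_trans zero_le order_refl)
  then obtain r' where r': "u' = ennreal r'" "0 \<le> r'" using r by (cases u') (auto simp: top_unique)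
  have w: "norm (w p' j) \<le> r" "norm (v p' j) \<le> r'" "norm (w p' j - v p' j) \<le> r - r'" for j
    using assms(2)[of j] assms(3)[of j] assms(4)[of j] r r' by (auto simp: ennreal_plus[symmetric] simp del: ennreal_plus)
  have d: "norm (w p' j * w p' l - v p' j * v p' l) \<le> r\<^sup>2 - r'\<^sup>2" for j l
  proof -
    have "norm (w p' j * w p' l - v p' j * v p' l) = norm ((w p' j - v p' j) * w p' l + v p' j * (w p' l - v p' l))"
      by (simp add: algebra_simps)
    also have "\<dots> \<le> (r - r') * r + r' * (r - r')"
      by (intro norm_triangle_mono) (auto simp: norm_mult intro!: mult_mono w r r' order_trans[OF norm_ge_zero w(3)])
    finally show ?thesis by (simp add: power2_eq_square algebra_simps)
  qed
  have rr: "0 \<le> r\<^sup>2 - r'\<^sup>2" using d[of undefined undefined] norm_ge_zero order_trans by blast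
  have "B h w p p' i - B h v p p' i = (\<Sum>j\<in>UNIV. \<Sum>l\<in>UNIV. K h p p' i j l * (w p' j * w p' l - v p' j * v p' l))"
    by (simp add: B_def sum_subtractf algebra_simps)
  also have "norm \<dots> \<le> (\<Sum>j\<in>UNIV. \<Sum>l\<in>UNIV. norm (K h p p' i j l) * (r\<^sup>2 - r'\<^sup>2))"
    by (intro sum_norm_le) (auto simp: norm_mult intro!: mult_left_mono d)
  also have "\<dots> = (\<Sum>j\<in>UNIV. \<Sum>l\<in>UNIV. norm (K h p p' i j l)) * (r\<^sup>2 - r'\<^sup>2)"
    by (simp add: sum_distrib_right)
  finally have "ennreal (norm (B h w p p' i - B h v p p' i))
      \<le> ennreal (\<Sum>j\<in>UNIV. \<Sum>l\<in>UNIV. norm (K h p p' i j l)) * ennreal (r\<^sup>2 - r'\<^sup>2)"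
    using rr by (simp add: ennreal_mult[symmetric] sum_nonneg ennreal_leI)
  also have "\<dots> \<le> k p p' * ennreal (r\<^sup>2 - r'\<^sup>2)" by (intro mult_right_mono K_le assms) auto
  finally have "ennreal (norm (B h w p p' i - B h v p p' i)) + k p p' * u'\<^sup>2
      \<le> k p p' * ennreal (r\<^sup>2 - r'\<^sup>2) + k p p' * ennreal (r'\<^sup>2)"
    using r' by (intro add_mono) (auto simp: ennreal_power)
  also have "\<dots> = k p p' * ennreal (r\<^sup>2 - r'\<^sup>2 + r'\<^sup>2)" using rr by (simp add: distrib_left[symmetric] ennreal_plus[symmetric] del: ennreal_plus)
  finally show ?thesis using r by (simp add: ennreal_power)
qed

lemma norm_W_le:
  assumes "h \<in> H"
  shows "ennreal (norm (W m h p i)) \<le> U m p"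
proof (induction m arbitrary: p i)
  case 0
  then show ?case using w0_le assms by simp
next
  case (Suc m)
  have "ennreal (norm (W (Suc m) h p i)) \<le> ennreal (norm (w0 h p i) + norm (\<integral>p'. B h (W m h) p p' i \<partial>M))"
    by (simp add: norm_triangle_ineq4 ennreal_leI del: ennreal_plus)
  also have "\<dots> \<le> V p + (\<integral>\<^sup>+p'. ennreal (norm (B h (W m h) p p' i)) \<partial>M)"
    by (simp add: add_mono w0_le assms norm_integral_le_nn)
  also have "\<dots> \<le> V p + (\<integral>\<^sup>+p'. k p p' * (U m p')\<^sup>2 \<partial>M)"
    by (intro add_left_mono nn_integral_mono B_le assms Suc)
  finally show ?case by simp
qed

lemma nn_integral_B_le:
  assumes "h \<in> H"
  shows "(\<integral>\<^sup>+p'. ennreal (norm (B h (W m h) p p' i)) \<partial>M) \<le> U (Suc m) p"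
proof -
  have "(\<integral>\<^sup>+p'. ennreal (norm (B h (W m h) p p' i)) \<partial>M) \<le> (\<integral>\<^sup>+p'. k p p' * (U m p')\<^sup>2 \<partial>M)"
    by (intro nn_integral_mono B_le assms norm_W_le)
  then show ?thesis by (simp add: add_increasing)
qed

lemma integrable_B:
  assumes "h \<in> H" "p \<in> space M" "U (Suc m) p < \<top>"
  shows "integrable M (\<lambda>p'. B h (W m h) p p' i)"
  using le_less_trans[OF nn_integral_B_le[OF assms(1)] assms(3)] assms(2)
  by (simp add: integrable_iff_bounded B_measurable1)

text \<open>The increments of the iterates are bounded by the increments of the majorants, again
  written additively. \<open>B_diff_le\<close> carries one increment to the next; where the later
  majorant is infinite there is nothing to show.\<close>

lemma norm_W_diff_le:
  assumes h: "h \<in> H" and p: "p \<in> space M"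
  shows "ennreal (norm (W (Suc m) h p i - W m h p i)) + U m p \<le> U (Suc m) p"
  using p
proof (induction m arbitrary: p i)
  case 0
  have "ennreal (norm (W (Suc 0) h p i - W 0 h p i)) \<le> (\<integral>\<^sup>+p'. ennreal (norm (B h (W 0 h) p p' i)) \<partial>M)"
    using norm_integral_le_nn by simp
  also have "\<dots> \<le> (\<integral>\<^sup>+p'. k p p' * (U 0 p')\<^sup>2 \<partial>M)"
    by (intro nn_integral_mono B_le h norm_W_le)
  finally show ?case by (simp add: add.commute add_left_mono)
next
  case (Suc m)
  note p = Suc.prems
  show ?case
  proof (cases "U (Suc (Suc m)) p = \<top>")
    case False
    then have fin1: "U (Suc (Suc m)) p < \<top>" by (simp add: less_top del: U.simps)
    note fin = fin1 le_less_trans[OF U_mono_Suc[of "Suc m" p] fin1]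
    note int = integrable_B[OF h p fin(1)] integrable_B[OF h p fin(2)]
    let ?d = "\<lambda>p'. B h (W (Suc m) h) p p' i - B h (W m h) p p' i"
    have [measurable]: "?d \<in> borel_measurable M"
      using int by (intro borel_measurable_diff borel_measurable_integrable)
    have "norm (W (Suc (Suc m)) h p i - W (Suc m) h p i) = norm (\<integral>p'. ?d p' \<partial>M)"
    proof -
      have "W (Suc (Suc m)) h p i - W (Suc m) h p i = - (\<integral>p'. ?d p' \<partial>M)"
        unfolding W.simps(2)[of "Suc m" h p i] W.simps(2)[of m h p i] Bochner_Integration.integral_diff[OF int] by simp
      then show ?thesis by (simp only: norm_minus_cancel)
    qed
    then have "ennreal (norm (W (Suc (Suc m)) h p i - W (Suc m) h p i)) \<le> (\<integral>\<^sup>+p'. ennreal (norm (?d p')) \<partial>M)"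
      using norm_integral_le_nn[of M ?d] by simp
    then have "ennreal (norm (W (Suc (Suc m)) h p i - W (Suc m) h p i)) + (\<integral>\<^sup>+p'. k p p' * (U m p')\<^sup>2 \<partial>M)
       \<le> (\<integral>\<^sup>+p'. ennreal (norm (?d p')) \<partial>M) + (\<integral>\<^sup>+p'. k p p' * (U m p')\<^sup>2 \<partial>M)"
      by (rule add_right_mono)
    also have "\<dots> = (\<integral>\<^sup>+p'. ennreal (norm (?d p')) + k p p' * (U m p')\<^sup>2 \<partial>M)"
      using p by (subst nn_integral_add) auto
    also have "\<dots> \<le> (\<integral>\<^sup>+p'. k p p' * (U (Suc m) p')\<^sup>2 \<partial>M)"
      by (intro nn_integral_mono B_diff_le h norm_W_le Suc.IH) auto
    finally have "V p + (ennreal (norm (W (Suc (Suc m)) h p i - W (Suc m) h p i)) + (\<integral>\<^sup>+p'. k p p' * (U m p')\<^sup>2 \<partial>M))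
      \<le> U (Suc (Suc m)) p" by (simp add: add_left_mono)
    then show ?thesis by (simp only: U.simps(2)[of m] ac_simps)
  qed (simp del: U.simps W.simps)
qed

lemma norm_W_diff_add_le:
  assumes h: "h \<in> H" and p: "p \<in> space M"
  shows "ennreal (norm (W (m + n) h p i - W m h p i)) + U m p \<le> U (m + n) p"
proof (induction n)
  case (Suc n)
  have "ennreal (norm (W (m + Suc n) h p i - W m h p i))
      \<le> ennreal (norm (W (Suc (m + n)) h p i - W (m + n) h p i)) + ennreal (norm (W (m + n) h p i - W m h p i))"
    by (subst ennreal_plus[symmetric]) (auto simp del: ennreal_plus W.simps intro!: ennreal_leI norm_diff_triangle_le)
  then have "ennreal (norm (W (m + Suc n) h p i - W m h p i)) + U m p
     \<le> ennreal (norm (W (Suc (m + n)) h p i - W (m + n) h p i)) + (ennreal (norm (W (m + n) h p i - W m h p i)) + U m p)"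
    by (metis add.assoc add_right_mono)
  also have "\<dots> \<le> ennreal (norm (W (Suc (m + n)) h p i - W (m + n) h p i)) + U (m + n) p"
    by (rule add_left_mono[OF Suc])
  also have "\<dots> \<le> U (Suc (m + n)) p" by (rule norm_W_diff_le[OF h p])
  finally show ?case by simp
qed simp

text \<open>Meaningful where \<open>Uinf p\<close> is finite. Elsewhere the value of
  \<open>lim\<close> may be arbitrary, but measurability is retained.\<close>

definition Winf :: "'h \<Rightarrow> 'p \<Rightarrow> 'i \<Rightarrow> complex" where
  "Winf h p i = lim (\<lambda>m. W m h p i)"

lemma Winf_measurable [measurable]: "(\<lambda>p. Winf h p i) \<in> borel_measurable M"
  unfolding Winf_def by measurable

lemma enn2real_U: "Uinf p < \<top> \<Longrightarrow> U m p = ennreal (enn2real (U m p))"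
  using U_le_Uinf[of m p] by (metis ennreal_enn2real le_less_trans)

lemma W_diff_real:
  assumes h: "h \<in> H" and p: "p \<in> space M" and fin: "Uinf p < \<top>" and mn: "m \<le> n"
  shows "norm (W n h p i - W m h p i) \<le> enn2real (U n p) - enn2real (U m p)"
proof -
  have "ennreal (norm (W n h p i - W m h p i)) + U m p \<le> U n p"
    using norm_W_diff_add_le[OF h p, of m "n - m" i] mn by simp
  then have "ennreal (norm (W n h p i - W m h p i) + enn2real (U m p)) \<le> ennreal (enn2real (U n p))"
    by (subst (asm) (1 2) enn2real_U[OF fin]) simp
  then show ?thesis by (subst (asm) ennreal_le_iff) auto
qed

text \<open>The real sequence of majorants converges, hence is Cauchy, and it controls the
  differences of the iterates. The third claim is an error bound free of \<open>h\<close>, which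
  later gives convergence uniform in the shift.\<close>

lemma W_tendsto:
  assumes h: "h \<in> H" and p: "p \<in> space M" and fin: "Uinf p < \<top>"
  shows "(\<lambda>m. W m h p i) \<longlonglongrightarrow> Winf h p i"
    and "(\<lambda>m. enn2real (U m p)) \<longlonglongrightarrow> enn2real (Uinf p)"
    and "norm (Winf h p i - W m h p i) \<le> enn2real (Uinf p) - enn2real (U m p)"
proof -
  show lim: "(\<lambda>m. enn2real (U m p)) \<longlonglongrightarrow> enn2real (Uinf p)"
    using LIMSEQ_SUP[OF incseq_U[of p]] fin unfolding Uinf_def
    by (intro tendsto_enn2real) auto
  have "Cauchy (\<lambda>m. W m h p i)"
  proof (rule metric_CauchyI)
    fix e :: real assume "0 < e"
    then obtain N where N: "\<And>m n. N \<le> m \<Longrightarrow> N \<le> n \<Longrightarrow> dist (enn2real (U m p)) (enn2real (U n p)) < e"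
      using LIMSEQ_imp_Cauchy[OF lim] by (meson metric_CauchyD)
    have *: "dist (W n h p i) (W m h p i) < e" if "N \<le> m" "m \<le> n" for m n
      using W_diff_real[OF h p fin that(2), of i] N[of n m] that by (auto simp: dist_norm)
    have "dist (W m h p i) (W n h p i) < e" if "N \<le> m" "N \<le> n" for m n
      using *[of m n] *[of n m] that by (cases "m \<le> n") (auto simp: dist_commute)
    then show "\<exists>N. \<forall>m\<ge>N. \<forall>n\<ge>N. dist (W m h p i) (W n h p i) < e" by blast
  qed
  then show W: "(\<lambda>m. W m h p i) \<longlonglongrightarrow> Winf h p i"
    unfolding Winf_def by (simp add: Cauchy_convergent_iff convergent_LIMSEQ_iff)
  show "norm (Winf h p i - W m h p i) \<le> enn2real (Uinf p) - enn2real (U m p)"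
  proof (rule tendsto_le[OF sequentially_bot])
    show "(\<lambda>n. enn2real (U n p) - enn2real (U m p)) \<longlonglongrightarrow> enn2real (Uinf p) - enn2real (U m p)"
      by (intro tendsto_intros lim)
    show "(\<lambda>n. norm (W n h p i - W m h p i)) \<longlonglongrightarrow> norm (Winf h p i - W m h p i)"
      by (intro tendsto_intros W)
    show "\<forall>\<^sub>F n in sequentially. norm (W n h p i - W m h p i) \<le> enn2real (U n p) - enn2real (U m p)"
      using eventually_ge_at_top[of m] by eventually_elim (rule W_diff_real[OF h p fin])
  qed
qed

lemma norm_Winf_le:
  assumes h: "h \<in> H" and p: "p \<in> space M"
  shows "ennreal (norm (Winf h p i)) \<le> Uinf p"
proof (cases "Uinf p = \<top>")
  case False
  then have fin: "Uinf p < \<top>" by (simp add: less_top)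
  have "(\<lambda>m. ennreal (norm (W m h p i))) \<longlonglongrightarrow> ennreal (norm (Winf h p i))"
    by (intro tendsto_ennrealI tendsto_norm W_tendsto h p fin)
  then show ?thesis
    by (rule LIMSEQ_le_const2) (use norm_W_le[OF h] U_le_Uinf in \<open>blast intro: order_trans\<close>)
qed simp

lemma AE_kernel_finite:
  assumes p: "p \<in> space M" and fin: "Uinf p < \<top>"
  shows "AE p' in M. k p p' * (Uinf p')\<^sup>2 < \<top>"
proof -
  have "(\<integral>\<^sup>+p'. k p p' * (Uinf p')\<^sup>2 \<partial>M) < \<top>"
    using Uinf_eq[OF p] fin by (simp add: less_top)
  then have "AE p' in M. k p p' * (Uinf p')\<^sup>2 \<noteq> \<infinity>"
    using p by (intro nn_integral_PInf_AE) auto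
  then show ?thesis by eventually_elim (simp add: less_top)
qed

lemma B_zero:
  assumes "h \<in> H" "k p p' = 0"
  shows "B h w p p' i = 0"
proof -
  have "(\<Sum>j\<in>UNIV. \<Sum>l\<in>UNIV. norm (K h p p' i j l)) = 0"
    using K_le[OF assms(1), of p p' i] assms(2) by (simp add: ennreal_eq_0_iff sum_nonneg antisym)
  then have "K h p p' i j l = 0" for j l by (simp add: sum_nonneg_eq_0_iff sum_nonneg)
  then show ?thesis by (simp add: B_def)
qed

lemma kernel_finite_cases:
  assumes "k p p' * (Uinf p')\<^sup>2 < \<top>"
  shows "k p p' = 0 \<or> Uinf p' < \<top>"
proof (rule ccontr)
  assume "\<not> ?thesis"
  then have "k p p' \<noteq> 0" "Uinf p' = \<top>" by (auto simp: less_top[symmetric])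
  then show False using assms by (simp add: power2_eq_square ennreal_mult_top)
qed

definition bnd :: "'p \<Rightarrow> 'p \<Rightarrow> real" where
  "bnd p p' = enn2real (k p p' * (Uinf p')\<^sup>2)"

lemma integrable_bnd:
  assumes p: "p \<in> space M" and fin: "Uinf p < \<top>"
  shows "integrable M (bnd p)"
proof -
  have "(\<integral>\<^sup>+p'. ennreal (bnd p p') \<partial>M) = (\<integral>\<^sup>+p'. k p p' * (Uinf p')\<^sup>2 \<partial>M)"
    using AE_kernel_finite[OF p fin] by (intro nn_integral_cong_AE) (auto elim!: eventually_mono simp: bnd_def)
  also have "\<dots> < \<top>" using Uinf_eq[OF p] fin by (simp add: less_top)
  finally show ?thesis
    using p by (auto simp: integrable_iff_bounded bnd_def[abs_def])
qed

lemma norm_B_le_bnd: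
  assumes h: "h \<in> H" and "k p p' * (Uinf p')\<^sup>2 < \<top>" and w: "\<And>j. ennreal (norm (w p' j)) \<le> Uinf p'"
  shows "norm (B h w p p' i) \<le> bnd p p'"
proof -
  have "ennreal (norm (B h w p p' i)) \<le> ennreal (bnd p p')"
    using B_le[OF h, of w p' "Uinf p'" p i] assms by (simp add: bnd_def)
  then show ?thesis by (subst (asm) ennreal_le_iff) (auto simp: bnd_def)
qed

text \<open>Dominated convergence with \<open>bnd\<close>, as all iterates lie below
  \<open>Uinf\<close>. For almost every \<open>p'\<close> either the kernel vanishes or
  \<open>Uinf p'\<close> is finite and the iterates converge there.\<close>

lemma Winf_eq:
  assumes h: "h \<in> H" and p: "p \<in> space M" and fin: "Uinf p < \<top>"
  shows "integrable M (\<lambda>p'. B h (Winf h) p p' i)"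
    and "Winf h p i = w0 h p i - (\<integral>p'. B h (Winf h) p p' i \<partial>M)"
proof -
  have m1: "(\<lambda>p'. B h (Winf h) p p' i) \<in> borel_measurable M" by (rule B_measurable1) (auto simp: p)
  have m2: "(\<lambda>p'. B h (W m h) p p' i) \<in> borel_measurable M" for m by (rule B_measurable1) (auto simp: p)
  have lim: "AE p' in M. (\<lambda>m. B h (W m h) p p' i) \<longlonglongrightarrow> B h (Winf h) p p' i"
    using AE_kernel_finite[OF p fin] AE_space
  proof eventually_elim
    fix p' assume f: "k p p' * (Uinf p')\<^sup>2 < \<top>" and p': "p' \<in> space M"
    show "(\<lambda>m. B h (W m h) p p' i) \<longlonglongrightarrow> B h (Winf h) p p' i"
      using kernel_finite_cases[OF f]
    proof
      assume "Uinf p' < \<top>"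
      then show ?thesis unfolding B_def by (intro tendsto_intros W_tendsto h p')
    qed (simp add: B_zero[OF h])
  qed
  have bd: "AE p' in M. norm (B h (W m h) p p' i) \<le> bnd p p'" for m
    using AE_kernel_finite[OF p fin]
    by eventually_elim (intro norm_B_le_bnd h order_trans[OF norm_W_le[OF h] U_le_Uinf])
  note dc = integrable_dominated_convergence[OF m1 m2 integrable_bnd[OF p fin] lim bd]
    integral_dominated_convergence[OF m1 m2 integrable_bnd[OF p fin] lim bd]
  show "integrable M (\<lambda>p'. B h (Winf h) p p' i)" by (rule dc)
  have "(\<lambda>m. W (Suc m) h p i) \<longlonglongrightarrow> w0 h p i - (\<integral>p'. B h (Winf h) p p' i \<partial>M)"
    by (simp, intro tendsto_intros dc)
  moreover have "(\<lambda>m. W (Suc m) h p i) \<longlonglongrightarrow> Winf h p i"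
    by (rule LIMSEQ_Suc[OF W_tendsto(1)[OF h p fin]])
  ultimately show "Winf h p i = w0 h p i - (\<integral>p'. B h (Winf h) p p' i \<partial>M)"
    by (rule LIMSEQ_unique[rotated])
qed

text \<open>\<open>c\<close> embeds an open set of complex numbers into the parameters. Holomorphy
  passes through the integral because \<open>bnd p\<close> is integrable and independent of the
  parameter.\<close>

lemma W_holomorphic:
  assumes S: "open S" and c: "\<And>z. z \<in> S \<Longrightarrow> c z \<in> H"
    and w0: "\<And>p i. p \<in> space M \<Longrightarrow> Uinf p < \<top> \<Longrightarrow> (\<lambda>z. w0 (c z) p i) holomorphic_on S"
    and K: "\<And>p p' i j l. (\<lambda>z. K (c z) p p' i j l) holomorphic_on S"
    and p: "p \<in> space M" and fin: "Uinf p < \<top>"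
  shows "(\<lambda>z. W m (c z) p i) holomorphic_on S"
  using p fin
proof (induction m arbitrary: p i)
  case 0
  then show ?case using w0 by simp
next
  case (Suc m)
  have "(\<lambda>z. \<integral>p'. B (c z) (W m (c z)) p p' i \<partial>M) holomorphic_on S"
  proof (rule holomorphic_on_integral[OF S _ _ integrable_bnd[OF Suc.prems]])
    show "(\<lambda>p'. B (c z) (W m (c z)) p p' i) \<in> borel_measurable M" for z
      by (rule B_measurable1) (auto simp: Suc.prems)
    show "AE p' in M. (\<lambda>z. B (c z) (W m (c z)) p p' i) holomorphic_on S
        \<and> (\<forall>z\<in>S. norm (B (c z) (W m (c z)) p p' i) \<le> bnd p p')"
      using AE_kernel_finite[OF Suc.prems] AE_space
    proof eventually_elim
      fix p' assume f: "k p p' * (Uinf p')\<^sup>2 < \<top>" and p': "p' \<in> space M"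
      have "(\<lambda>z. B (c z) (W m (c z)) p p' i) holomorphic_on S"
        using kernel_finite_cases[OF f]
      proof
        assume "Uinf p' < \<top>"
        then show ?thesis unfolding B_def by (intro holomorphic_intros K Suc.IH p')
      next
        assume "k p p' = 0"
        then show ?thesis by (intro holomorphic_transform[OF holomorphic_on_const[of 0]]) (simp add: B_zero c)
      qed
      then show "(\<lambda>z. B (c z) (W m (c z)) p p' i) holomorphic_on S
        \<and> (\<forall>z\<in>S. norm (B (c z) (W m (c z)) p p' i) \<le> bnd p p')"
        by (auto intro!: norm_B_le_bnd c f order_trans[OF norm_W_le U_le_Uinf])
    qed
  qed
  then show ?case using w0[OF Suc.prems] by (simp add: holomorphic_on_diff)
qed

text \<open>The error bound \<open>Uinf p - U m p\<close> does not depend on the parameter, so the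
  iterates converge uniformly on \<open>S\<close>.\<close>

lemma Winf_holomorphic:
  assumes S: "open S" and c: "\<And>z. z \<in> S \<Longrightarrow> c z \<in> H"
    and w0: "\<And>p i. p \<in> space M \<Longrightarrow> Uinf p < \<top> \<Longrightarrow> (\<lambda>z. w0 (c z) p i) holomorphic_on S"
    and K: "\<And>p p' i j l. (\<lambda>z. K (c z) p p' i j l) holomorphic_on S"
    and p: "p \<in> space M" and fin: "Uinf p < \<top>"
  shows "(\<lambda>z. Winf (c z) p i) holomorphic_on S"
proof (cases "S = {}")
  case False
  then obtain z0 where z0: "z0 \<in> S" by blast
  have ul: "uniform_limit S (\<lambda>m z. W m (c z) p i) (\<lambda>z. Winf (c z) p i) sequentially"
  proof (rule uniform_limitI)
    fix e :: real assume "0 < e"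
    have "\<forall>\<^sub>F m in sequentially. dist (enn2real (U m p)) (enn2real (Uinf p)) < e"
      using W_tendsto(2)[OF c[OF z0] p fin] \<open>0 < e\<close> by (rule tendstoD)
    then show "\<forall>\<^sub>F m in sequentially. \<forall>z\<in>S. dist (W m (c z) p i) (Winf (c z) p i) < e"
    proof eventually_elim
      case (elim m)
      show ?case
      proof
        fix z assume "z \<in> S"
        then show "dist (W m (c z) p i) (Winf (c z) p i) < e"
          using W_tendsto(3)[OF c p fin, of z i m] elim by (simp add: dist_norm norm_minus_commute)
      qed
    qed
  qed
  show ?thesis
  proof (rule holomorphic_uniform_sequence[OF S, where f="\<lambda>m z. W m (c z) p i"])
    show "(\<lambda>z. W m (c z) p i) holomorphic_on S" for m by (rule W_holomorphic[OF assms])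
    fix x assume "x \<in> S"
    then obtain d where "d > 0" "cball x d \<subseteq> S" using S open_contains_cball by blast
    then show "\<exists>d>0. cball x d \<subseteq> S \<and> uniform_limit (cball x d) (\<lambda>m z. W m (c z) p i) (\<lambda>z. Winf (c z) p i) sequentially"
      using uniform_limit_on_subset[OF ul] by blast
  qed
qed (simp add: holomorphic_on_def)

end

section \<open>The kernel of the bilinear term\<close>

text \<open>The sum of squares without conjugation makes this the entire extension of the heat
  kernel.\<close>

definition cgauss :: "real \<Rightarrow> (3 \<Rightarrow> complex) \<Rightarrow> complex" where
  "cgauss s \<zeta> = complex_of_real ((4 * pi * s) powr (- 3/2)) * exp (- (\<Sum>i\<in>UNIV. (\<zeta> i)\<^sup>2) / (4 * complex_of_real s))"

abbreviation kron :: "3 \<Rightarrow> 3 \<Rightarrow> complex" where "kron a b \<equiv> (if a = b then 1 else 0)"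

text \<open>The third partial derivatives of \<open>cgauss\<close>, as confirmed by
  \<open>DERIV_gauss_d2\<close>.\<close>

definition gauss_d3 :: "real \<Rightarrow> (3 \<Rightarrow> complex) \<Rightarrow> 3 \<Rightarrow> 3 \<Rightarrow> 3 \<Rightarrow> complex" where
  "gauss_d3 s \<zeta> a b c = (- (\<zeta> a * \<zeta> b * \<zeta> c) / (8 * complex_of_real s ^ 3)
     + (kron a b * \<zeta> c + kron a c * \<zeta> b + kron b c * \<zeta> a) / (4 * complex_of_real s ^ 2)) * cgauss s \<zeta>"

text \<open>The operator \<open>\<partial>\<^sub>i \<partial>\<^sub>j \<partial>\<^sub>k -
  \<delta>\<^sub>i\<^sub>j \<Delta> \<partial>\<^sub>k\<close> applied to the heat kernel. On the
  Fourier side it multiplies by \<open>\<bar>\<xi>\<bar>\<^sup>2\<close> times the Leray symbol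
  times \<open>\<i> \<xi>\<^sub>k\<close>.\<close>

definition oseen_d :: "real \<Rightarrow> (3 \<Rightarrow> complex) \<Rightarrow> 3 \<Rightarrow> 3 \<Rightarrow> 3 \<Rightarrow> complex" where
  "oseen_d s \<zeta> i j k = gauss_d3 s \<zeta> i j k - kron i j * (\<Sum>l\<in>UNIV. gauss_d3 s \<zeta> l l k)"

text \<open>As \<open>P\<^sub>i\<^sub>j(\<xi>) exp (- t \<bar>\<xi>\<bar>\<^sup>2)\<close> is the integral over \<open>s > t\<close> of
  \<open>(\<delta>\<^sub>i\<^sub>j \<bar>\<xi>\<bar>\<^sup>2 - \<xi>\<^sub>i \<xi>\<^sub>j) exp (- s \<bar>\<xi>\<bar>\<^sup>2)\<close>, the kernel is an integral of third derivatives of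
  Gaussians. This gives its complex extension, and reduces all bounds to Gaussian ones.\<close>

definition oseen_kernel :: "real \<Rightarrow> (3 \<Rightarrow> complex) \<Rightarrow> 3 \<Rightarrow> 3 \<Rightarrow> 3 \<Rightarrow> complex" where
  "oseen_kernel t \<zeta> i j k = (\<integral>s. indicator {t<..} s *\<^sub>R oseen_d s \<zeta> i j k \<partial>lborel)"

definition cvec :: "real^3 \<Rightarrow> 3 \<Rightarrow> complex" where
  "cvec z = (\<lambda>i. complex_of_real (z $ i))"

lemma cgauss_cvec: "cgauss s (cvec z) = complex_of_real (gauss s z)"
  by (simp add: cgauss_def gauss_def cvec_def norm2_vec3 exp_of_real[symmetric])

lemma gauss_scale4: "0 < s \<Longrightarrow> gauss (4 * s) z = (4 * pi * s) powr (- 3/2) / 8 * exp (- (norm z)\<^sup>2 / (16 * s))"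
proof -
  assume s: "0 < s"
  have "sqrt (4 * pi * (4 * s)) = 2 * sqrt (4 * pi * s)" by (simp add: real_sqrt_mult)
  then show ?thesis using s by (simp add: gauss_def powr_three_halves power_divide)
qed

section \<open>Gaussian bounds at complex points close to real ones\<close>

definition near :: "real \<Rightarrow> (3 \<Rightarrow> complex) \<Rightarrow> real^3 \<Rightarrow> bool" where
  "near d \<zeta> z \<longleftrightarrow> (\<forall>l. norm (\<zeta> l - cvec z l) \<le> d)"

lemma Re_square_ge:
  assumes "norm (w - complex_of_real x) \<le> d"
  shows "x\<^sup>2 / 2 - d\<^sup>2 \<le> Re (w\<^sup>2)"
proof -
  define a b where "a = Re w - x" and "b = Im w"
  have "(norm (w - complex_of_real x))\<^sup>2 = a\<^sup>2 + b\<^sup>2" by (simp add: cmod_power2 a_def b_def)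
  moreover have "(norm (w - complex_of_real x))\<^sup>2 \<le> d\<^sup>2" using assms by (intro power_mono) auto
  moreover have "Re (w\<^sup>2) = (x + a)\<^sup>2 - b\<^sup>2" by (simp add: a_def b_def power2_eq_square)
  \<comment> \<open>A completed square: half of \<open>x\<^sup>2\<close> survives and the loss is
    only \<open>a\<^sup>2\<close>.\<close>
  moreover have "(x + a)\<^sup>2 = x\<^sup>2/2 - a\<^sup>2 + (x + 2 * a)\<^sup>2 / 2" by (simp add: power2_eq_square field_simps)
  ultimately show ?thesis by (smt (verit) zero_le_power2 divide_nonneg_nonneg)
qed

text \<open>A shift of size \<open>L * sqrt s\<close> costs half of the decay, \<open>4 * s\<close>
  becoming \<open>8 * s\<close> in the exponent, and a factor \<open>exp (L\<^sup>2 / 4)\<close> for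
  each coordinate.\<close>

lemma norm_cgauss_le:
  assumes s: "0 < s" and near: "near (L * sqrt s) \<zeta> z"
  shows "norm (cgauss s \<zeta>) \<le> (4 * pi * s) powr (- 3/2) * exp (3 * L\<^sup>2 / 4) * exp (- (norm z)\<^sup>2 / (8 * s))"
proof -
  have "(\<Sum>i\<in>(UNIV::3 set). (z $ i)\<^sup>2 / 2 - (L * sqrt s)\<^sup>2) \<le> (\<Sum>i\<in>UNIV. Re ((\<zeta> i)\<^sup>2))"
    by (intro sum_mono Re_square_ge) (use near in \<open>auto simp: near_def cvec_def\<close>)
  then have *: "(norm z)\<^sup>2 / 2 - 3 * (L\<^sup>2 * s) \<le> (\<Sum>i\<in>UNIV. Re ((\<zeta> i)\<^sup>2))"
    using s by (simp add: norm2_vec3 sum_subtractf sum_divide_distrib power_mult_distrib)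
  have "norm (exp (- (\<Sum>i\<in>UNIV. (\<zeta> i)\<^sup>2) / (4 * complex_of_real s))) = exp (- (\<Sum>i\<in>UNIV. Re ((\<zeta> i)\<^sup>2)) / (4 * s))"
  proof -
    have "Re (- (\<Sum>i\<in>UNIV. (\<zeta> i)\<^sup>2) / (4 * complex_of_real s)) = - (\<Sum>i\<in>UNIV. Re ((\<zeta> i)\<^sup>2)) / (4 * s)"
      using Re_divide_of_real[of "- (\<Sum>i\<in>UNIV. (\<zeta> i)\<^sup>2)" "4 * s"] by (simp add: Re_sum)
    then show ?thesis by simp
  qed
  also have "\<dots> \<le> exp (3 * L\<^sup>2 / 4 - (norm z)\<^sup>2 / (8 * s))"
    using * s by (simp add: field_simps)
  also have "\<dots> = exp (3 * L\<^sup>2 / 4) * exp (- (norm z)\<^sup>2 / (8 * s))" by (simp add: exp_add[symmetric])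
  finally show ?thesis by (simp add: cgauss_def norm_mult mult.assoc mult_left_mono)
qed

text \<open>The decay is weakened once more, to \<open>16 * s\<close>, so that this bound and the
  one for third derivatives, where the extra room absorbs polynomials, use the same kernel
  \<open>gauss (4 * s)\<close>. The 8 is the ratio of the normalisations.\<close>

lemma norm_cgauss_le_gauss:
  assumes s: "0 < s" and near: "near (L * sqrt s) \<zeta> z"
  shows "norm (cgauss s \<zeta>) \<le> 8 * exp (3 * L\<^sup>2 / 4) * gauss (4 * s) z"
proof -
  have "exp (- (norm z)\<^sup>2 / (8 * s)) \<le> exp (- (norm z)\<^sup>2 / (16 * s))"
    using s by (simp add: field_simps)
  from order_trans[OF norm_cgauss_le[OF assms] mult_left_mono[OF this, of "(4 * pi * s) powr (- 3/2) * exp (3 * L\<^sup>2 / 4)"]]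
  show ?thesis unfolding gauss_scale4[OF s] by (simp add: mult_ac)
qed

lemma pow_le_fact_exp: "0 \<le> (y::real) \<Longrightarrow> y ^ m \<le> fact m * exp y"
proof -
  assume y: "0 \<le> y"
  have "(\<Sum>n\<in>{m}. y ^ n /\<^sub>R fact n) \<le> (\<Sum>n. y ^ n /\<^sub>R fact n)"
    using y by (intro sum_le_suminf summable_exp_generic) auto
  then have "y ^ m / fact m \<le> exp y" by (simp add: exp_def divide_inverse mult.commute)
  then show ?thesis by (simp add: field_simps)
qed

text \<open>In the variable \<open>y = norm z / sqrt s\<close> the polynomial factors have degree at
  most 3 in \<open>y + L\<close>, and \<open>y \<le> 4 + y\<^sup>2 / 16\<close> lets
  \<open>exp (y\<^sup>2 / 16)\<close> absorb them. The factor \<open>s powr (- 3/2)\<close> is the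
  scaling of three derivatives.\<close>

lemma norm_gauss_d3_le:
  assumes s: "0 < s" and L: "0 \<le> L" and near: "near (L * sqrt s) \<zeta> z"
  shows "norm (gauss_d3 s \<zeta> a b c) \<le> 16 * exp (3 * L\<^sup>2 / 4 + L + 4) * s powr (- 3/2) * gauss (4 * s) z"
proof -
  define y where "y = norm z / sqrt s"
  define r where "r = sqrt s"
  have r: "r > 0" "s = r\<^sup>2" using s by (auto simp: r_def)
  have s3: "s ^ 3 = r ^ 3 * r ^ 3" and s2: "s ^ 2 = r ^ 3 * r"
    using r(2) by (simp_all add: power2_eq_square power3_eq_cube)
  have y0: "0 \<le> y" using s by (simp add: y_def)
  have zl: "norm (\<zeta> l) \<le> (y + L) * r" for l
  proof -
    have "norm (\<zeta> l) \<le> norm (cvec z l) + norm (\<zeta> l - cvec z l)" by (metis norm_triangle_sub)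
    also have "\<dots> \<le> norm z + L * r"
      using near component_le_norm_cart[of z l] by (intro add_mono) (auto simp: near_def cvec_def r_def)
    also have "norm z + L * r = (y + L) * r" using s by (simp add: y_def r_def distrib_right)
    finally show ?thesis .
  qed
  have A: "norm (- (\<zeta> a * \<zeta> b * \<zeta> c) / (8 * complex_of_real s ^ 3)) \<le> (y + L)^3 / 8 * (1 / r^3)"
  proof -
    have "norm (\<zeta> a * \<zeta> b * \<zeta> c) \<le> ((y + L) * r) * ((y + L) * r) * ((y + L) * r)"
      unfolding norm_mult using y0 L r by (intro mult_mono zl) auto
    then have "norm (\<zeta> a * \<zeta> b * \<zeta> c) / (8 * s ^ 3) \<le> ((y + L) * r)^3 / (8 * s^3)"
      using s by (intro divide_right_mono) (auto simp: power3_eq_cube)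
    also have "((y + L) * r)^3 / (8 * s^3) = (y + L)^3 / 8 * (1 / r^3)"
    proof -
      have q: "A * c / (8 * (c * c)) = A / 8 * (1 / c)" if "c \<noteq> 0" for A c :: real
        using that by simp
      show ?thesis unfolding s3 power_mult_distrib by (rule q) (use r(1) in simp)
    qed
    finally show ?thesis using s by (simp add: norm_divide norm_power norm_mult)
  qed
  have B: "norm ((kron a b * \<zeta> c + kron a c * \<zeta> b + kron b c * \<zeta> a) / (4 * complex_of_real s ^ 2)) \<le> 3 * (y + L) / 4 * (1 / r^3)"
  proof -
    have k: "norm (kron l m * \<zeta> n) \<le> (y + L) * r" for l m n
      using zl[of n] y0 L r by auto
    have "norm (kron a b * \<zeta> c + kron a c * \<zeta> b + kron b c * \<zeta> a) \<le> (y + L) * r + (y + L) * r + (y + L) * r"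
      by (intro norm_triangle_mono k)
    then have "norm (kron a b * \<zeta> c + kron a c * \<zeta> b + kron b c * \<zeta> a) / (4 * s^2) \<le> 3 * ((y + L) * r) / (4 * s^2)"
      using s by (intro divide_right_mono) (linarith | simp)+
    also have "3 * ((y + L) * r) / (4 * s^2) = 3 * (y + L) / 4 * (1 / r^3)"
      using r(1) by (simp add: s2)
    finally show ?thesis using s by (simp add: norm_divide norm_power norm_mult)
  qed
  have E: "(y + L)^3 / 8 + 3 * (y + L) / 4 \<le> 2 * (exp (L + 4) * exp (y\<^sup>2 / 16))"
  proof -
    have e: "(y + L)^3 \<le> 6 * exp (y + L)" "y + L \<le> exp (y + L)"
      using pow_le_fact_exp[of "y + L" 3] pow_le_fact_exp[of "y + L" 1] y0 L by (auto simp: fact_numeral)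
    have gen: "u ^ 3 / 8 + 3 * u / 4 \<le> 2 * e" if "u ^ 3 \<le> 6 * e" "u \<le> e" "0 < e" for u e :: real
      using that by linarith
    have "(y + L)^3 / 8 + 3 * (y + L) / 4 \<le> 2 * exp (y + L)"
      by (rule gen[OF e exp_gt_zero])
    moreover have "y + L \<le> (L + 4) + y\<^sup>2 / 16"
      using zero_le_power2[of "y - 8"] by (simp add: power2_eq_square algebra_simps)
    then have "exp (y + L) \<le> exp (L + 4) * exp (y\<^sup>2 / 16)" by (simp add: exp_add[symmetric])
    ultimately show ?thesis by linarith
  qed
  have "norm (gauss_d3 s \<zeta> a b c) \<le> ((y + L)^3 / 8 * (1 / r^3) + 3 * (y + L) / 4 * (1 / r^3)) *
      ((4 * pi * s) powr (- 3/2) * exp (3 * L\<^sup>2 / 4) * exp (- (norm z)\<^sup>2 / (8 * s)))"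
    unfolding gauss_d3_def norm_mult
    by (intro mult_mono norm_cgauss_le[OF s near] order_trans[OF norm_triangle_ineq] add_mono A B)
      (use y0 L r in auto)
  also have "\<dots> = ((y + L)^3 / 8 + 3 * (y + L) / 4) * ((1 / r^3) *
      ((4 * pi * s) powr (- 3/2) * exp (3 * L\<^sup>2 / 4) * exp (- (norm z)\<^sup>2 / (8 * s))))"
    by (simp only: distrib_right mult.assoc)
  also have "\<dots> \<le> (2 * (exp (L + 4) * exp (y\<^sup>2 / 16))) * ((1 / r^3) *
      ((4 * pi * s) powr (- 3/2) * exp (3 * L\<^sup>2 / 4) * exp (- (norm z)\<^sup>2 / (8 * s))))"
    using r by (intro mult_right_mono E) auto
  also have "\<dots> = 2 * (1 / r^3) * (4 * pi * s) powr (- 3/2) * (exp (3 * L\<^sup>2 / 4) * exp (L + 4)) * (exp (y\<^sup>2 / 16) * exp (- (norm z)\<^sup>2 / (8 * s)))"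
    by (simp only: mult_ac)
  also have "exp (y\<^sup>2 / 16) * exp (- (norm z)\<^sup>2 / (8 * s)) = exp (- (norm z)\<^sup>2 / (16 * s))"
    using s by (simp add: exp_add[symmetric] y_def power_divide field_simps)
  also have "exp (3 * L\<^sup>2 / 4) * exp (L + 4) = exp (3 * L\<^sup>2 / 4 + L + 4)" by (simp add: exp_add[symmetric] add.assoc)
  also have "1 / r^3 = s powr (- 3/2)" using s by (simp add: powr_three_halves r_def power_divide)
  finally show ?thesis unfolding gauss_scale4[OF s] by (simp add: mult_ac)
qed

text \<open>One third derivative and a trace of three more: four terms with constant 16
  each.\<close>

lemma norm_oseen_d_le:
  assumes s: "0 < s" and L: "0 \<le> L" and near: "near (L * sqrt s) \<zeta> z"
  shows "norm (oseen_d s \<zeta> i j k) \<le> 64 * exp (3 * L\<^sup>2 / 4 + L + 4) * s powr (- 3/2) * gauss (4 * s) z"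
proof -
  let ?C = "16 * exp (3 * L\<^sup>2 / 4 + L + 4) * s powr (- 3/2) * gauss (4 * s) z"
  have "norm (\<Sum>l\<in>UNIV. gauss_d3 s \<zeta> l l k) \<le> (\<Sum>l\<in>(UNIV::3 set). ?C)"
    by (intro sum_norm_le norm_gauss_d3_le assms)
  then have "norm (kron i j * (\<Sum>l\<in>UNIV. gauss_d3 s \<zeta> l l k)) \<le> 3 * ?C" by (auto simp: norm_mult)
  then have "norm (oseen_d s \<zeta> i j k) \<le> ?C + 3 * ?C"
    unfolding oseen_d_def by (intro order_trans[OF norm_triangle_ineq4] add_mono norm_gauss_d3_le assms)
  then show ?thesis by (simp add: mult_ac)
qed

lemma measurable_cgauss [measurable]:
  assumes [measurable]: "f \<in> borel_measurable M" "\<And>i. (\<lambda>x. g x i) \<in> borel_measurable M"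
  shows "(\<lambda>x. cgauss (f x) (g x)) \<in> borel_measurable M"
  unfolding cgauss_def by measurable

lemma measurable_oseen_d [measurable]:
  assumes [measurable]: "f \<in> borel_measurable M" "\<And>i. (\<lambda>x. g x i) \<in> borel_measurable M"
  shows "(\<lambda>x. oseen_d (f x) (g x) i j k) \<in> borel_measurable M"
  unfolding oseen_d_def gauss_d3_def by measurable

lemma measurable_oseen_kernel:
  assumes [measurable]: "f \<in> borel_measurable M" "\<And>i. (\<lambda>x. g x i) \<in> borel_measurable M"
  shows "(\<lambda>x. oseen_kernel (f x) (g x) i j k) \<in> borel_measurable M"
proof -
  have [measurable]: "(\<lambda>x. indicator {f (fst x)<..} (snd x) :: real) \<in> borel_measurable (M \<Otimes>\<^sub>M lborel)"
  proof -
    have "(\<lambda>x. indicator {f (fst x)<..} (snd x) :: real) = (\<lambda>x. if f (fst x) < snd x then 1 else 0)"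
      by (auto simp: fun_eq_iff)
    also have "\<dots> \<in> borel_measurable (M \<Otimes>\<^sub>M lborel)" by measurable
    finally show ?thesis .
  qed
  show ?thesis
    unfolding oseen_kernel_def
    by (rule lborel.borel_measurable_lebesgue_integral) (unfold case_prod_beta, measurable)
qed

lemma cgauss_holomorphic:
  assumes "\<And>i. (\<lambda>w. g w i) holomorphic_on S"
  shows "(\<lambda>w. cgauss s (g w)) holomorphic_on S"
  unfolding cgauss_def by (cases "s = 0") (auto intro!: holomorphic_intros assms)

lemma oseen_d_holomorphic:
  assumes "\<And>i. (\<lambda>w. g w i) holomorphic_on S" "s \<noteq> 0"
  shows "(\<lambda>w. oseen_d s (g w) i j k) holomorphic_on S"
  unfolding oseen_d_def gauss_d3_def using assms(2) by (intro holomorphic_intros cgauss_holomorphic assms(1)) auto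

definition kernel_const :: "real \<Rightarrow> real" where
  "kernel_const L = 64 * exp (3 * L\<^sup>2 / 4 + L + 4)"

lemma kernel_const_pos: "0 < kernel_const L"
  by (simp add: kernel_const_def)

text \<open>The integral over \<open>s\<close> is left open on purpose: each \<open>s\<close>
  contributes a heat kernel, to which the smoothing estimates for Gaussians apply.\<close>

definition kernel_majorant :: "real \<Rightarrow> real \<Rightarrow> real^3 \<Rightarrow> real \<Rightarrow> real" where
  "kernel_majorant L t z s = indicator {t<..} s * (kernel_const L * s powr (- 3/2) * gauss (4 * s) z)"

lemma kernel_majorant_nonneg: "0 \<le> kernel_majorant L t z s"
  by (simp add: kernel_majorant_def kernel_const_def)

text \<open>The Gaussian is at most a multiple of \<open>s powr (- 3/2)\<close>, so the integrand is
  below a multiple of \<open>s powr (-3)\<close>, integrable away from 0.\<close>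

lemma integrable_kernel_majorant:
  assumes t: "0 < t"
  shows "integrable lborel (kernel_majorant L t z)"
proof (rule Bochner_Integration.integrable_bound)
  have "((\<lambda>s::real. s powr (-3)) has_integral -(t powr (-3 + 1)) / (-3 + 1)) {t..}"
    using t by (intro has_integral_powr_to_inf) auto
  then have "(\<lambda>s::real. s powr (-3)) absolutely_integrable_on {t..}"
    by (intro nonnegative_absolutely_integrable_1) auto
  then have "integrable lebesgue (\<lambda>s. indicator {t..} s *\<^sub>R s powr (-3))" by (simp add: set_integrable_def)
  then have "integrable lborel (\<lambda>s. indicator {t..} s *\<^sub>R s powr (-3) :: real)"
    by (subst (asm) integrable_completion) auto
  then show "integrable lborel (\<lambda>s. kernel_const L * (16 * pi) powr (- 3/2) * (indicator {t..} s *\<^sub>R s powr (-3)) :: real)"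
    by (intro integrable_mult_right)
  show "kernel_majorant L t z \<in> borel_measurable lborel"
    unfolding kernel_majorant_def[abs_def] by measurable
  show "AE s in lborel. norm (kernel_majorant L t z s)
      \<le> norm (kernel_const L * (16 * pi) powr (- 3/2) * (indicator {t..} s *\<^sub>R s powr (-3)))"
  proof (rule AE_I2)
    fix s :: real
    show "norm (kernel_majorant L t z s) \<le> norm (kernel_const L * (16 * pi) powr (- 3/2) * (indicator {t..} s *\<^sub>R s powr (-3)))"
    proof (cases "t < s")
      case True
      then have s: "s > 0" using t by simp
      have "s powr (- 3/2) * gauss (4 * s) z \<le> s powr (- 3/2) * (4 * pi * (4 * s)) powr (- 3/2)"
        using s by (intro mult_left_mono gauss_le) auto
      also have "\<dots> = (16 * pi) powr (- 3/2) * (s powr (-3/2) * s powr (-3/2))"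
        using s by (simp add: powr_mult)
      also have "s powr (-3/2) * s powr (-3/2) = s powr (-3)"
        by (simp only: powr_add[symmetric]) simp
      finally have "kernel_const L * (s powr (- 3/2) * gauss (4 * s) z) \<le> kernel_const L * ((16 * pi) powr (- 3/2) * s powr (-3))"
        using kernel_const_pos[of L] by (intro mult_left_mono) auto
      then show ?thesis using True kernel_const_pos[of L]
        by (simp add: kernel_majorant_def abs_mult mult.assoc)
    qed (simp add: kernel_majorant_def)
  qed
qed

lemma norm_oseen_integrand_le:
  assumes t: "0 < t" and L: "0 \<le> L" and near: "near (L * sqrt t) \<zeta> z"
  shows "norm (indicator {t<..} s *\<^sub>R oseen_d s \<zeta> i j k) \<le> kernel_majorant L t z s"
proof (cases "t < s")
  case True
  \<comment> \<open>For \<open>s > t\<close> the allowed distance from the real point only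
    grows.\<close>
  have "near (L * sqrt s) \<zeta> z"
    unfolding near_def
  proof
    fix l
    have "norm (\<zeta> l - cvec z l) \<le> L * sqrt t" using near by (simp add: near_def)
    also have "\<dots> \<le> L * sqrt s" using True L by (intro mult_left_mono) auto
    finally show "norm (\<zeta> l - cvec z l) \<le> L * sqrt s" .
  qed
  then show ?thesis using norm_oseen_d_le[of s L \<zeta> z i j k] True t L by (simp add: kernel_majorant_def kernel_const_def)
qed (simp add: kernel_majorant_def)

lemma norm_oseen_kernel_le:
  assumes "0 < t" "0 \<le> L" "near (L * sqrt t) \<zeta> z"
  shows "ennreal (norm (oseen_kernel t \<zeta> i j k)) \<le> (\<integral>\<^sup>+s. ennreal (kernel_majorant L t z s) \<partial>lborel)"
  unfolding oseen_kernel_def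
  by (rule order_trans[OF norm_integral_le_nn], intro nn_integral_mono ennreal_leI norm_oseen_integrand_le assms)

lemma oseen_kernel_holomorphic:
  assumes S: "open S" and t: "0 < t" and L: "0 \<le> L" and g: "\<And>i. (\<lambda>w. g w i) holomorphic_on S"
    and near: "\<And>w. w \<in> S \<Longrightarrow> near (L * sqrt t) (g w) z"
  shows "(\<lambda>w. oseen_kernel t (g w) i j k) holomorphic_on S"
  unfolding oseen_kernel_def
proof (rule holomorphic_on_integral[OF S _ _ integrable_kernel_majorant[OF t, of L z]])
  show "(\<lambda>s. indicator {t<..} s *\<^sub>R oseen_d s (g w) i j k) \<in> borel_measurable lborel" for w by measurable
  show "AE s in lborel. (\<lambda>w. indicator {t<..} s *\<^sub>R oseen_d s (g w) i j k) holomorphic_on S \<and>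
      (\<forall>w\<in>S. norm (indicator {t<..} s *\<^sub>R oseen_d s (g w) i j k) \<le> kernel_majorant L t z s)"
  proof (intro AE_I2 conjI ballI norm_oseen_integrand_le[OF t L near])
    fix s
    show "(\<lambda>w. indicator {t<..} s *\<^sub>R oseen_d s (g w) i j k) holomorphic_on S"
    proof (cases "t < s")
      case True
      then show ?thesis using t by (auto intro!: oseen_d_holomorphic g)
    qed simp
  qed
qed

section \<open>The kernel as a Fourier integral\<close>

text \<open>The factor \<open>exp (norm \<xi>)\<close> makes room for complex shifts of modulus
  below 1 in \<open>fourier_deriv\<close>. Half of the Gaussian absorbs it together with the power,
  by \<open>2 * x \<le> 2 / s + s / 2 * x\<^sup>2\<close>.\<close>

lemma integrable_gauss_poly:
  assumes s: "0 < s"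
  shows "integrable lborel (\<lambda>\<xi>::real^3. exp (norm \<xi>) * norm \<xi> ^ m * exp (- s * (norm \<xi>)\<^sup>2))"
proof (rule Bochner_Integration.integrable_bound)
  have "integrable lborel (\<lambda>\<xi>::real^3. norm (cis (0 \<bullet> \<xi>) * complex_of_real (exp (- (s/2) * (norm \<xi>)\<^sup>2))))"
    using fourier_gauss[of "s/2" 0] s by (intro integrable_norm) (simp add: has_bochner_integral_iff)
  then show "integrable lborel (\<lambda>\<xi>::real^3. (fact m * exp (2 / s)) * exp (- (s/2) * (norm \<xi>)\<^sup>2))"
    by (intro integrable_mult_right) (simp add: norm_mult)
  show "AE \<xi> in lborel. norm (exp (norm \<xi>) * norm \<xi> ^ m * exp (- s * (norm \<xi>)\<^sup>2))
     \<le> norm ((fact m * exp (2 / s)) * exp (- (s/2) * (norm (\<xi>::real^3))\<^sup>2))"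
  proof (rule AE_I2)
    fix \<xi> :: "real^3"
    define x where "x = norm \<xi>"
    have x: "0 \<le> x" by (simp add: x_def)
    have "exp x * x ^ m * exp (- s * x\<^sup>2) \<le> exp x * (fact m * exp x) * exp (- s * x\<^sup>2)"
      by (intro mult_right_mono mult_left_mono pow_le_fact_exp x) auto
    also have "\<dots> = fact m * exp (2 * x - s * x\<^sup>2)" by (simp add: exp_add[symmetric] exp_diff exp_minus field_simps)
    also have "2 * x \<le> 2 / s + s / 2 * x\<^sup>2"
    proof -
      have "0 \<le> (s * x - 2)\<^sup>2 / (2 * s)" using s by simp
      also have "\<dots> = s / 2 * x\<^sup>2 - 2 * x + 2 / s" using s by (simp add: power2_eq_square field_simps)
      finally show ?thesis by simp
    qed
    then have "fact m * exp (2 * x - s * x\<^sup>2) \<le> fact m * exp (2 / s + (- (s/2) * x\<^sup>2))"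
      by (intro mult_left_mono) (auto simp: field_simps)
    finally show "norm (exp (norm \<xi>) * norm \<xi> ^ m * exp (- s * (norm \<xi>)\<^sup>2))
     \<le> norm ((fact m * exp (2 / s)) * exp (- (s/2) * (norm \<xi>)\<^sup>2))"
      unfolding x_def[symmetric] exp_add mult.assoc[symmetric] by (simp add: abs_mult x del: exp_diff)
  qed
qed measurable

section \<open>Derivatives of the Gaussian along one complex coordinate\<close>

definition gauss_d1 :: "real \<Rightarrow> (3 \<Rightarrow> complex) \<Rightarrow> 3 \<Rightarrow> complex" where
  "gauss_d1 s \<zeta> a = - \<zeta> a / (2 * complex_of_real s) * cgauss s \<zeta>"

definition gauss_d2 :: "real \<Rightarrow> (3 \<Rightarrow> complex) \<Rightarrow> 3 \<Rightarrow> 3 \<Rightarrow> complex" where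
  "gauss_d2 s \<zeta> a b = (\<zeta> a * \<zeta> b / (4 * complex_of_real s ^ 2) - kron a b / (2 * complex_of_real s)) * cgauss s \<zeta>"

definition bump :: "(3 \<Rightarrow> complex) \<Rightarrow> 3 \<Rightarrow> complex \<Rightarrow> 3 \<Rightarrow> complex" where
  "bump \<zeta> a w = (\<lambda>b. \<zeta> b + kron a b * w)"

lemma bump_0 [simp]: "bump \<zeta> a 0 = \<zeta>"
  by (simp add: bump_def)

lemma DERIV_bump [derivative_intros]: "((\<lambda>w. bump \<zeta> a w b) has_field_derivative kron a b) (at w)"
  unfolding bump_def by (auto intro!: derivative_eq_intros)

lemma DERIV_cgauss:
  assumes "s \<noteq> 0"
  shows "((\<lambda>w. cgauss s (bump \<zeta> a w)) has_field_derivative gauss_d1 s \<zeta> a) (at 0)"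
proof -
  have k: "(\<Sum>i\<in>UNIV. of_nat 2 * (kron a i * bump \<zeta> a 0 i ^ (2 - Suc 0))) = 2 * \<zeta> a"
    by (simp add: if_distrib[of "\<lambda>x. x * _"] if_distrib[of "\<lambda>x. 2 * x"] sum.delta cong: if_cong)
  have "((\<lambda>w. (\<Sum>i\<in>UNIV. (bump \<zeta> a w i)\<^sup>2)) has_field_derivative 2 * \<zeta> a) (at 0)"
    by (rule DERIV_cong[OF DERIV_sum[OF DERIV_power[OF DERIV_bump]] k])
  then have "((\<lambda>w. exp (- (\<Sum>i\<in>UNIV. (bump \<zeta> a w i)\<^sup>2) / (4 * complex_of_real s))) has_field_derivative
      exp (- (\<Sum>i\<in>UNIV. (\<zeta> i)\<^sup>2) / (4 * complex_of_real s)) * (- (2 * \<zeta> a) / (4 * complex_of_real s))) (at 0)"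
    by (rule DERIV_cong[OF DERIV_fun_exp[OF DERIV_cdivide[OF DERIV_minus]]]) simp
  then show ?thesis unfolding cgauss_def gauss_d1_def
    by (rule DERIV_cong[OF DERIV_cmult]) simp
qed

lemma DERIV_gauss_d1:
  assumes "s \<noteq> 0"
  shows "((\<lambda>w. gauss_d1 s (bump \<zeta> a w) b) has_field_derivative gauss_d2 s \<zeta> a b) (at 0)"
proof -
  have "((\<lambda>w. - bump \<zeta> a w b / (2 * complex_of_real s) * cgauss s (bump \<zeta> a w)) has_field_derivative
     (- kron a b / (2 * complex_of_real s)) * cgauss s (bump \<zeta> a 0) + gauss_d1 s \<zeta> a * (- bump \<zeta> a 0 b / (2 * complex_of_real s))) (at 0)"
    by (intro DERIV_mult DERIV_cgauss assms DERIV_cdivide DERIV_minus DERIV_bump)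
  then show ?thesis unfolding gauss_d1_def gauss_d2_def
    by (rule DERIV_cong) (simp add: assms field_simps power2_eq_square)
qed

lemma DERIV_gauss_d2:
  assumes "s \<noteq> 0"
  shows "((\<lambda>w. gauss_d2 s (bump \<zeta> a w) b c) has_field_derivative gauss_d3 s \<zeta> a b c) (at 0)"
proof -
  have "((\<lambda>w. (bump \<zeta> a w b * bump \<zeta> a w c / (4 * complex_of_real s ^ 2) - kron b c / (2 * complex_of_real s)) * cgauss s (bump \<zeta> a w)) has_field_derivative
     ((kron a b * bump \<zeta> a 0 c + kron a c * bump \<zeta> a 0 b) / (4 * complex_of_real s ^ 2) - 0) * cgauss s (bump \<zeta> a 0)
       + gauss_d1 s \<zeta> a * (bump \<zeta> a 0 b * bump \<zeta> a 0 c / (4 * complex_of_real s ^ 2) - kron b c / (2 * complex_of_real s))) (at 0)"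
    by (intro DERIV_mult DERIV_cgauss assms DERIV_cdivide DERIV_diff DERIV_const DERIV_bump)
  then show ?thesis unfolding gauss_d1_def gauss_d2_def gauss_d3_def
    by (rule DERIV_cong) (simp add: assms field_simps power2_eq_square power3_eq_cube)
qed

text \<open>Difference quotients along \<open>1 / (n + 1)\<close> already determine both
  derivatives. This serves where an identity is known at real arguments only, while the derivatives
  are complex.\<close>

lemma DERIV_unique_on_reals:
  assumes F: "(F has_field_derivative D) (at (0::complex))" and G: "(G has_field_derivative E) (at 0)"
    and eq: "\<And>x. F (complex_of_real x) = G (complex_of_real x)"
  shows "D = E"
proof -
  let ?X = "\<lambda>n. complex_of_real (inverse (real (Suc n)))"
  have X: "?X \<longlonglongrightarrow> 0" "\<And>n. ?X n \<noteq> 0"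
    using tendsto_of_real[OF LIMSEQ_inverse_real_of_nat, where 'a=complex] by (simp_all only: of_real_0 of_real_eq_0_iff) simp
  have 1: "(\<lambda>n. (F (?X n) - F 0) / ?X n) \<longlonglongrightarrow> D"
    using F X unfolding has_field_derivative_iff tendsto_at_iff_sequentially o_def by auto
  have 2: "(\<lambda>n. (G (?X n) - G 0) / ?X n) \<longlonglongrightarrow> E"
    using G X unfolding has_field_derivative_iff tendsto_at_iff_sequentially o_def by auto
  show ?thesis
    using 1 2 eq eq[of 0] by (simp only: of_real_0) (rule LIMSEQ_unique)
qed

lemma cis_conv_exp_inner: "cis (z \<bullet> \<xi>) = exp (\<i> * complex_of_real (z \<bullet> \<xi>))"
  by (simp add: cis_conv_exp)

text \<open>Shifting \<open>z\<close> by \<open>w\<close> in direction \<open>a\<close> multiplies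
  the integrand by \<open>exp (\<i> w \<xi>_a)\<close>, and differentiating under the integral at
  \<open>w = 0\<close> brings down \<open>\<i> \<xi>_a\<close>. The known values at real points
  identify the derivative with that of \<open>G\<close>.\<close>

lemma fourier_deriv:
  fixes p :: "real^3 \<Rightarrow> complex" and G :: "(3 \<Rightarrow> complex) \<Rightarrow> complex"
  assumes s: "0 < s" and p[measurable]: "p \<in> borel_measurable borel" and pb: "\<And>\<xi>. norm (p \<xi>) \<le> norm \<xi> ^ m"
    and G: "\<And>z. (\<integral>\<xi>. cis (z \<bullet> \<xi>) * (p \<xi> * complex_of_real (exp (- s * (norm \<xi>)\<^sup>2))) \<partial>lborel) = G (cvec z)"
    and dG: "((\<lambda>w. G (bump (cvec z) a w)) has_field_derivative D) (at 0)"
  shows "(\<integral>\<xi>. cis (z \<bullet> \<xi>) * ((\<i> * complex_of_real (\<xi> $ a)) * p \<xi> * complex_of_real (exp (- s * (norm \<xi>)\<^sup>2))) \<partial>lborel) = D"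
proof -
  let ?f = "\<lambda>w \<xi>. exp (\<i> * (complex_of_real (z \<bullet> \<xi>) + w * complex_of_real (\<xi> $ a))) * (p \<xi> * complex_of_real (exp (- s * (norm \<xi>)\<^sup>2)))"
  have "((\<lambda>w. \<integral>\<xi>. ?f w \<xi> \<partial>lborel) has_field_derivative
      (\<integral>\<xi>. cis (z \<bullet> \<xi>) * ((\<i> * complex_of_real (\<xi> $ a)) * p \<xi> * complex_of_real (exp (- s * (norm \<xi>)\<^sup>2))) \<partial>lborel)) (at 0)"
  proof (rule has_field_derivative_integral_eq[where S="ball 0 1"])
    show "integrable lborel (\<lambda>\<xi>::real^3. exp (norm \<xi>) * norm \<xi> ^ m * exp (- s * (norm \<xi>)\<^sup>2))"
      by (rule integrable_gauss_poly[OF s])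
    show "AE \<xi> in lborel. (\<lambda>w. ?f w \<xi>) holomorphic_on ball 0 1
       \<and> (\<forall>w\<in>ball 0 1. norm (?f w \<xi>) \<le> exp (norm \<xi>) * norm \<xi> ^ m * exp (- s * (norm \<xi>)\<^sup>2))"
    proof (intro AE_I2 conjI ballI)
      fix \<xi> :: "real^3"
      show "(\<lambda>w. ?f w \<xi>) holomorphic_on ball 0 1" by (intro holomorphic_intros)
      fix w :: complex assume w: "w \<in> ball 0 1"
      have "- Im w * \<xi> $ a \<le> norm \<xi>"
      proof -
        have "\<bar>- Im w * \<xi> $ a\<bar> \<le> 1 * norm \<xi>"
          unfolding abs_mult abs_minus_cancel
          using w abs_Im_le_cmod[of w] component_le_norm_cart[of \<xi> a] by (intro mult_mono) auto
        then show ?thesis by simp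
      qed
      then have "norm (exp (\<i> * (complex_of_real (z \<bullet> \<xi>) + w * complex_of_real (\<xi> $ a)))) \<le> exp (norm \<xi>)"
        by simp
      then show "norm (?f w \<xi>) \<le> exp (norm \<xi>) * norm \<xi> ^ m * exp (- s * (norm \<xi>)\<^sup>2)"
        unfolding norm_mult mult.assoc by (intro mult_mono pb) auto
    qed
    show "((\<lambda>w. ?f w \<xi>) has_field_derivative cis (z \<bullet> \<xi>) * ((\<i> * complex_of_real (\<xi> $ a)) * p \<xi> * complex_of_real (exp (- s * (norm \<xi>)\<^sup>2)))) (at 0)" for \<xi>
      by (rule derivative_eq_intros refl | simp)+ (simp add: cis_conv_exp_inner)
  qed (auto simp: cis_conv_exp_inner)
  then show ?thesis using dG
  proof (rule DERIV_unique_on_reals)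
    fix x :: real
    have 1: "(z + x *\<^sub>R axis a 1) \<bullet> \<xi> = z \<bullet> \<xi> + x * \<xi> $ a" for \<xi>
      by (simp add: inner_add_left inner_axis' )
    have 2: "cvec (z + x *\<^sub>R axis a 1) = bump (cvec z) a (complex_of_real x)"
      by (auto simp: cvec_def bump_def axis_def fun_eq_iff)
    show "(\<integral>\<xi>. ?f (complex_of_real x) \<xi> \<partial>lborel) = G (bump (cvec z) a (complex_of_real x))"
      using G[of "z + x *\<^sub>R axis a 1"] unfolding 2 1 cis_conv_exp of_real_add of_real_mult .
  qed
qed

lemma fourier_gauss_d3:
  assumes s: "0 < s"
  shows "(\<integral>\<xi>. cis (z \<bullet> \<xi>) * ((\<i> * complex_of_real (\<xi> $ a)) * ((\<i> * complex_of_real (\<xi> $ b)) * (\<i> * complex_of_real (\<xi> $ c)))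
      * complex_of_real (exp (- s * (norm \<xi>)\<^sup>2))) \<partial>lborel) = (2 * pi)^3 * gauss_d3 s (cvec z) a b c"
proof -
  have s0: "s \<noteq> 0" using s by simp
  have c1: "\<bar>\<xi> $ l\<bar> \<le> norm \<xi>" for \<xi> :: "real^3" and l by (rule component_le_norm_cart)
  have 0: "(\<integral>\<xi>. cis (z \<bullet> \<xi>) * (1 * complex_of_real (exp (- s * (norm \<xi>)\<^sup>2))) \<partial>lborel) = (2 * pi)^3 * cgauss s (cvec z)" for z
    using fourier_gauss[OF s, of z] by (simp add: has_bochner_integral_iff cgauss_cvec)
  have 1: "(\<integral>\<xi>. cis (z \<bullet> \<xi>) * ((\<i> * complex_of_real (\<xi> $ c)) * 1 * complex_of_real (exp (- s * (norm \<xi>)\<^sup>2))) \<partial>lborel)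
      = (2 * pi)^3 * gauss_d1 s (cvec z) c" for z
    by (rule fourier_deriv[OF s _ _ 0, where m=0]) (auto intro!: DERIV_cmult DERIV_cgauss s0)
  have 2: "(\<integral>\<xi>. cis (z \<bullet> \<xi>) * ((\<i> * complex_of_real (\<xi> $ b)) * ((\<i> * complex_of_real (\<xi> $ c)) * 1) * complex_of_real (exp (- s * (norm \<xi>)\<^sup>2))) \<partial>lborel)
      = (2 * pi)^3 * gauss_d2 s (cvec z) b c" for z
    by (rule fourier_deriv[OF s _ _ 1, where m=1]) (auto intro!: DERIV_cmult DERIV_gauss_d1 s0 simp: norm_mult c1)
  have "(\<integral>\<xi>. cis (z \<bullet> \<xi>) * ((\<i> * complex_of_real (\<xi> $ a)) * ((\<i> * complex_of_real (\<xi> $ b)) * ((\<i> * complex_of_real (\<xi> $ c)) * 1)) * complex_of_real (exp (- s * (norm \<xi>)\<^sup>2))) \<partial>lborel)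
      = (2 * pi)^3 * gauss_d3 s (cvec z) a b c" for z
    by (rule fourier_deriv[OF s _ _ 2, where m=2])
      (auto intro!: DERIV_cmult DERIV_gauss_d2 s0 mult_mono c1 simp: norm_mult power2_eq_square)
  then show ?thesis by simp
qed

lemma integral_exp_decay:
  assumes a: "0 < (a::real)"
  shows "has_bochner_integral lborel (\<lambda>s. indicator {t<..} s * exp (- s * a)) (exp (- t * a) / a)"
proof -
  have "((\<lambda>s. exp (- a * s)) has_integral exp (- a * t) / a) {t..}"
    by (rule has_integral_exp_minus_to_infinity[OF a])
  then have "((\<lambda>s. indicator {t..} s * exp (- s * a)) has_integral exp (- a * t) / a) UNIV"
    by (subst (asm) has_integral_restrict_UNIV[symmetric])
       (simp add: indicator_def of_bool_def mult.commute if_distrib if_distribR cong: if_cong)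
  then have "(\<integral>\<^sup>+s. ennreal (indicator {t..} s * exp (- s * a)) \<partial>lborel) = ennreal (exp (- a * t) / a)"
    by (intro nn_integral_has_integral_lborel) auto
  then have "has_bochner_integral lborel (\<lambda>s. indicator {t..} s * exp (- s * a)) (exp (- a * t) / a)"
    using a by (intro has_bochner_integral_nn_integral) auto
  moreover have "AE s in lborel. indicator {t..} s * exp (- s * a) = indicator {t<..} s * exp (- s * a)"
    using AE_lborel_singleton[of t] by eventually_elim (auto split: split_indicator)
  ultimately show ?thesis
    by (subst has_bochner_integral_cong_AE[where g="\<lambda>s. indicator {t..} s * exp (- s * a)"])
      (auto simp: mult.commute)
qed

lemma heat_leray_div_kernel_eq:
  assumes t: "0 < t"
  shows "complex_of_real (heat_leray_div_kernel t z i j k) = oseen_kernel t (cvec z) i j k"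
proof -
  let ?I = "\<lambda>\<xi> a. \<i> * complex_of_real ((\<xi>::real^3) $ a)"
  \<comment> \<open>The cubic polynomial symbol of \<open>oseen_d\<close>; away from the origin it
    is \<open>\<bar>\<xi>\<bar>\<^sup>2\<close> times the Leray symbol times
    \<open>\<i> \<xi>\<^sub>k\<close>.\<close>
  define P where "P \<xi> = ?I \<xi> i * (?I \<xi> j * ?I \<xi> k) - kron i j * (\<Sum>l\<in>UNIV. ?I \<xi> l * (?I \<xi> l * ?I \<xi> k))" for \<xi>
  define F where "F s \<xi> = indicator {t<..} s *\<^sub>R (cis (z \<bullet> \<xi>) * (P \<xi> * complex_of_real (exp (- s * (norm \<xi>)\<^sup>2))))" for s \<xi>
  have [measurable]: "P \<in> borel_measurable borel" unfolding P_def by measurable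
  have [measurable]: "(\<lambda>\<xi>. cis (z \<bullet> \<xi>)) \<in> borel_measurable borel" unfolding cis_conv_exp by measurable
  have Feq: "F s \<xi> = complex_of_real (if t < s then 1 else 0) * (cis (z \<bullet> \<xi>) * (P \<xi> * complex_of_real (exp (- s * (norm \<xi>)\<^sup>2))))" for s \<xi>
    by (simp add: F_def)
  have Fm[measurable]: "case_prod F \<in> borel_measurable (lborel \<Otimes>\<^sub>M lborel)"
    unfolding Feq case_prod_beta by measurable
  have I1: "norm (?I \<xi> a) \<le> norm \<xi>" for \<xi> a
    by (simp add: norm_mult component_le_norm_cart)
  have Pb: "norm (P \<xi>) \<le> 4 * norm \<xi> ^ 3" for \<xi>
  proof -
    have c: "norm (?I \<xi> a * (?I \<xi> b * ?I \<xi> c)) \<le> norm \<xi> ^ 3" for a b c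
      unfolding norm_mult[of "?I \<xi> a"] norm_mult[of "?I \<xi> b"] power3_eq_cube mult.assoc[of "norm \<xi>"]
      by (intro mult_mono I1) auto
    have "norm (\<Sum>l\<in>UNIV. ?I \<xi> l * (?I \<xi> l * ?I \<xi> k)) \<le> (\<Sum>l\<in>(UNIV::3 set). norm \<xi> ^ 3)"
      by (intro sum_norm_le c)
    then have "norm (kron i j * (\<Sum>l\<in>UNIV. ?I \<xi> l * (?I \<xi> l * ?I \<xi> k))) \<le> 3 * norm \<xi> ^ 3"
      by (auto simp: norm_mult)
    then show ?thesis unfolding P_def using c[of i j k] by (intro order_trans[OF norm_triangle_ineq4]) linarith
  qed
  \<comment> \<open>Cubic growth of \<open>P\<close> against the
    \<open>1 / \<bar>\<xi>\<bar>\<^sup>2\<close> from the integral in \<open>s\<close> leaves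
    \<open>\<bar>\<xi>\<bar>\<close> times a Gaussian. This is the absolute convergence required by
    Fubini's theorem.\<close>
  have int_nn: "(\<integral>\<^sup>+s. ennreal (norm (F s \<xi>)) \<partial>lborel) \<le> ennreal (4 * (exp (norm \<xi>) * norm \<xi> ^ 1 * exp (- t * (norm \<xi>)\<^sup>2)))" if "\<xi> \<noteq> 0" for \<xi>
  proof -
    have x: "0 < (norm \<xi>)\<^sup>2" using that by simp
    have "(\<integral>\<^sup>+s. ennreal (norm (F s \<xi>)) \<partial>lborel) \<le> (\<integral>\<^sup>+s. ennreal (4 * norm \<xi> ^ 3) * ennreal (indicator {t<..} s * exp (- s * (norm \<xi>)\<^sup>2)) \<partial>lborel)"
    proof (rule nn_integral_mono)
      fix s
      have "norm (F s \<xi>) \<le> 4 * norm \<xi> ^ 3 * (indicator {t<..} s * exp (- s * (norm \<xi>)\<^sup>2))"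
        using Pb[of \<xi>] by (simp add: F_def norm_mult indicator_def)
      then show "ennreal (norm (F s \<xi>)) \<le> ennreal (4 * norm \<xi> ^ 3) * ennreal (indicator {t<..} s * exp (- s * (norm \<xi>)\<^sup>2))"
        by (simp add: ennreal_mult[symmetric] ennreal_leI)
    qed
    also have "\<dots> = ennreal (4 * norm \<xi> ^ 3) * ennreal (exp (- t * (norm \<xi>)\<^sup>2) / (norm \<xi>)\<^sup>2)"
      using integral_exp_decay[OF x, of t]
      by (subst nn_integral_cmult) (auto simp: has_bochner_integral_iff nn_integral_eq_integral)
    also have "\<dots> = ennreal (4 * (norm \<xi> * exp (- t * (norm \<xi>)\<^sup>2)))"
      using that by (simp add: ennreal_mult[symmetric] power3_eq_cube power2_eq_square)
    also have "\<dots> \<le> ennreal (4 * (exp (norm \<xi>) * norm \<xi> ^ 1 * exp (- t * (norm \<xi>)\<^sup>2)))"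
    proof (intro ennreal_leI mult_left_mono)
      show "norm \<xi> * exp (- t * (norm \<xi>)\<^sup>2) \<le> exp (norm \<xi>) * norm \<xi> ^ 1 * exp (- t * (norm \<xi>)\<^sup>2)"
        by (intro mult_right_mono) (auto simp: mult_le_cancel_right1)
    qed simp
    finally show ?thesis .
  qed
  have Fint: "integrable (lborel \<Otimes>\<^sub>M lborel) (case_prod F)"
  proof -
    have "(\<integral>\<^sup>+x. ennreal (norm (case_prod F x)) \<partial>(lborel \<Otimes>\<^sub>M lborel)) = (\<integral>\<^sup>+\<xi>. \<integral>\<^sup>+s. ennreal (norm (F s \<xi>)) \<partial>lborel \<partial>lborel)"
      by (subst lborel_pair.nn_integral_snd[symmetric]) (auto simp: case_prod_beta)
    also have "\<dots> \<le> (\<integral>\<^sup>+(\<xi>::real^3). ennreal (4 * (exp (norm \<xi>) * norm \<xi> ^ 1 * exp (- t * (norm \<xi>)\<^sup>2))) \<partial>lborel)"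
    proof (rule nn_integral_mono_AE)
      show "AE \<xi> in lborel. (\<integral>\<^sup>+s. ennreal (norm (F s \<xi>)) \<partial>lborel) \<le> ennreal (4 * (exp (norm \<xi>) * norm \<xi> ^ 1 * exp (- t * (norm \<xi>)\<^sup>2)))"
        using AE_lborel_singleton[of "0::real^3"] by eventually_elim (rule int_nn)
    qed
    also have "\<dots> < \<infinity>"
      using integrable_mult_right[OF integrable_gauss_poly[OF t, of 1], of 4]
      by (subst nn_integral_eq_integral) auto
    finally show ?thesis by (auto simp: integrable_iff_bounded)
  qed
  have inner1: "(\<integral>\<xi>. F s \<xi> \<partial>lborel) = (2 * pi)^3 * (indicator {t<..} s *\<^sub>R oseen_d s (cvec z) i j k)" for s
  proof (cases "t < s")
    case True
    then have s: "0 < s" using t by simp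
    let ?G = "\<lambda>a b c \<xi>. cis (z \<bullet> \<xi>) * ((?I \<xi> a) * (?I \<xi> b * ?I \<xi> c) * complex_of_real (exp (- s * (norm \<xi>)\<^sup>2)))"
    have G: "has_bochner_integral lborel (?G a b c) ((2 * pi)^3 * gauss_d3 s (cvec z) a b c)" for a b c
      unfolding has_bochner_integral_iff
    proof
      show "integrable lborel (?G a b c)"
      proof (rule Bochner_Integration.integrable_bound[OF integrable_gauss_poly[OF s, of 3]])
        show "AE \<xi> in lborel. norm (?G a b c \<xi>) \<le> norm (exp (norm \<xi>) * norm \<xi> ^ 3 * exp (- s * (norm \<xi>)\<^sup>2))"
        proof (rule AE_I2)
          fix \<xi> :: "real^3"
          have "norm (?I \<xi> a * (?I \<xi> b * ?I \<xi> c)) \<le> 1 * (norm \<xi> * (norm \<xi> * norm \<xi>))"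
            unfolding norm_mult[of "?I \<xi> a"] norm_mult[of "?I \<xi> b"] mult_1
            by (intro mult_mono I1) auto
          also have "\<dots> \<le> exp (norm \<xi>) * norm \<xi> ^ 3" unfolding power3_eq_cube mult.assoc by (intro mult_right_mono) auto
          finally show "norm (?G a b c \<xi>) \<le> norm (exp (norm \<xi>) * norm \<xi> ^ 3 * exp (- s * (norm \<xi>)\<^sup>2))"
            by (simp add: norm_mult mult.assoc mult_right_mono)
        qed
      qed measurable
      show "integral\<^sup>L lborel (?G a b c) = (2 * pi)^3 * gauss_d3 s (cvec z) a b c"
        using fourier_gauss_d3[OF s, of z a b c] by simp
    qed
    have "has_bochner_integral lborel (\<lambda>\<xi>. ?G i j k \<xi> - kron i j * (\<Sum>l\<in>UNIV. ?G l l k \<xi>))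
       ((2 * pi)^3 * gauss_d3 s (cvec z) i j k - kron i j * (\<Sum>l\<in>UNIV. (2 * pi)^3 * gauss_d3 s (cvec z) l l k))"
      by (intro has_bochner_integral_diff has_bochner_integral_mult_right has_bochner_integral_sum G)
    moreover have "F s = (\<lambda>\<xi>. ?G i j k \<xi> - kron i j * (\<Sum>l\<in>UNIV. ?G l l k \<xi>))"
      using True by (auto simp: fun_eq_iff F_def P_def sum_distrib_left sum_distrib_right algebra_simps)
    ultimately have "(\<integral>\<xi>. F s \<xi> \<partial>lborel) = (2 * pi)^3 * gauss_d3 s (cvec z) i j k
        - kron i j * (\<Sum>l\<in>UNIV. (2 * pi)^3 * gauss_d3 s (cvec z) l l k)"
      by (simp only: has_bochner_integral_integral_eq)
    also have "\<dots> = (2 * pi)^3 * oseen_d s (cvec z) i j k"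
      unfolding oseen_d_def sum_distrib_left[symmetric] right_diff_distrib by (simp only: mult.left_commute)
    finally show ?thesis using True by simp
  qed (simp add: F_def)
  have inner2: "(\<integral>s. F s \<xi> \<partial>lborel) = cis (z \<bullet> \<xi>) * complex_of_real (exp (- t * (norm \<xi>)\<^sup>2))
              * complex_of_real (leray_symbol \<xi> $ i $ j) * (\<i> * complex_of_real (\<xi> $ k))" if "\<xi> \<noteq> 0" for \<xi>
  proof -
    have x: "0 < (norm \<xi>)\<^sup>2" using that by simp
    have P: "P \<xi> = complex_of_real (norm \<xi> ^ 2) * complex_of_real (leray_symbol \<xi> $ i $ j) * (\<i> * complex_of_real (\<xi> $ k))"
    proof -
      have A: "(\<Sum>l\<in>UNIV. ?I \<xi> l * (?I \<xi> l * ?I \<xi> k)) = - complex_of_real (norm \<xi> ^ 2) * ?I \<xi> k"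
        unfolding norm2_vec3 of_real_sum sum_negf[symmetric] sum_distrib_right
        by (intro sum.cong) (auto simp: power2_eq_square algebra_simps)
      have "norm \<xi> ^ 2 * (leray_symbol \<xi> $ i $ j) = (if i = j then norm \<xi> ^ 2 else 0) - \<xi> $ i * \<xi> $ j"
        using x by (simp add: leray_symbol_def right_diff_distrib)
      then have B: "complex_of_real (norm \<xi> ^ 2) * complex_of_real (leray_symbol \<xi> $ i $ j) = kron i j * complex_of_real (norm \<xi> ^ 2) - complex_of_real (\<xi> $ i) * complex_of_real (\<xi> $ j)"
        by (simp only: of_real_mult[symmetric] of_real_diff[symmetric]) simp
      show ?thesis unfolding P_def A B by (simp add: algebra_simps)
    qed
    have "has_bochner_integral lborel (\<lambda>s. (cis (z \<bullet> \<xi>) * P \<xi>) * complex_of_real (indicator {t<..} s * exp (- s * (norm \<xi>)\<^sup>2)))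
       ((cis (z \<bullet> \<xi>) * P \<xi>) * complex_of_real (exp (- t * (norm \<xi>)\<^sup>2) / (norm \<xi>)\<^sup>2))"
      by (intro has_bochner_integral_mult_right has_bochner_integral_of_real integral_exp_decay x)
    moreover have "(cis (z \<bullet> \<xi>) * P \<xi>) * complex_of_real (indicator {t<..} s * exp (- s * (norm \<xi>)\<^sup>2)) = F s \<xi>" for s
      by (simp add: F_def indicator_def)
    ultimately have "(\<integral>s. F s \<xi> \<partial>lborel) = (cis (z \<bullet> \<xi>) * P \<xi>) * complex_of_real (exp (- t * (norm \<xi>)\<^sup>2) / (norm \<xi>)\<^sup>2)"
      by (simp only: has_bochner_integral_integral_eq)
    then show ?thesis using that by (simp add: P field_simps)
  qed
  let ?S = "\<lambda>\<xi>. cis (z \<bullet> \<xi>) * complex_of_real (exp (- t * (norm \<xi>)\<^sup>2))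
              * complex_of_real (leray_symbol \<xi> $ i $ j) * (\<i> * complex_of_real (\<xi> $ k))"
  have [measurable]: "(\<lambda>\<xi>. leray_symbol \<xi> $ i $ j) \<in> borel_measurable borel"
    unfolding leray_symbol_def by (simp, measurable)
  have Sm: "?S \<in> borel_measurable lborel" by measurable
  have "(LINT \<xi>|lebesgue. ?S \<xi>) = (\<integral>\<xi>. ?S \<xi> \<partial>lborel)"
    by (rule integral_completion[OF Sm])
  also have "\<dots> = (\<integral>\<xi>. \<integral>s. F s \<xi> \<partial>lborel \<partial>lborel)"
  proof (rule integral_cong_AE)
    show "AE \<xi> in lborel. ?S \<xi> = (\<integral>s. F s \<xi> \<partial>lborel)"
      \<comment> \<open>At the origin the Leray symbol contains a division by zero; this is a null
        set.\<close>
      using AE_lborel_singleton[of "0::real^3"] by eventually_elim (simp add: inner2)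
  qed (use Sm in measurable)
  also have "\<dots> = (\<integral>s. \<integral>\<xi>. F s \<xi> \<partial>lborel \<partial>lborel)"
    by (rule lborel_pair.Fubini_integral[OF Fint])
  also have "\<dots> = (2 * pi)^3 * oseen_kernel t (cvec z) i j k"
    unfolding inner1 oseen_kernel_def by (rule integral_mult_right_zero)
  finally have eq: "(LINT \<xi>|lebesgue. ?S \<xi>) / (2 * pi)^3 = oseen_kernel t (cvec z) i j k" by simp
  \<comment> \<open>The definition of \<open>heat_leray_div_kernel\<close> takes a real part, so it
    remains to see that nothing is lost by it.\<close>
  have "Im (oseen_kernel t (cvec z) i j k) = 0"
  proof -
    have "oseen_d s (cvec z) i j k \<in> \<real>" for s
      unfolding oseen_d_def gauss_d3_def cgauss_cvec by (auto simp: cvec_def)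
    then have "oseen_d s (cvec z) i j k = complex_of_real (Re (oseen_d s (cvec z) i j k))" for s
      by (simp add: complex_is_Real_iff complex_eq_iff)
    then have "oseen_kernel t (cvec z) i j k = (\<integral>s. complex_of_real (indicator {t<..} s * Re (oseen_d s (cvec z) i j k)) \<partial>lborel)"
      unfolding oseen_kernel_def by (metis (no_types, lifting) scaleR_conv_of_real of_real_mult)
    then show ?thesis by (simp add: integral_complex_of_real del: of_real_mult)
  qed
  then have "complex_of_real (Re (oseen_kernel t (cvec z) i j k)) = oseen_kernel t (cvec z) i j k"
    by (simp add: complex_eq_iff)
  then show ?thesis unfolding heat_leray_div_kernel_def by (simp only: eq)
qed

section \<open>The Navier-Stokes iteration\<close>

text \<open>The inner integral is a multiple of \<open>(t - s) powr (- 1/2 - \<kappa>)\<close>,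
  which is integrable up to \<open>s = t\<close> because \<open>\<kappa> < 1/2\<close>. For
  \<open>\<kappa> = three_over q / 2\<close> this is the condition \<open>q > 3\<close>.\<close>

lemma time_integral:
  assumes \<kappa>: "0 \<le> \<kappa>" "\<kappa> < 1/2" and t: "0 < t"
  shows "(\<integral>\<^sup>+s. \<integral>\<^sup>+r. ennreal (indicator {0<..<t} s * (indicator {t - s<..} r * r powr (- 3/2 - \<kappa>))) \<partial>lborel \<partial>lborel)
    = ennreal (t powr (1/2 - \<kappa>) / ((1/2 + \<kappa>) * (1/2 - \<kappa>)))"
proof -
  have inner: "(\<integral>\<^sup>+r. ennreal (indicator {a<..} r * r powr (- 3/2 - \<kappa>)) \<partial>lborel) = ennreal (a powr (- 1/2 - \<kappa>) / (1/2 + \<kappa>))"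
    if a: "0 < a" for a
  proof -
    have "((\<lambda>r. r powr (- 3/2 - \<kappa>)) has_integral -(a powr (- 3/2 - \<kappa> + 1)) / (- 3/2 - \<kappa> + 1)) {a..}"
      using \<kappa> a by (intro has_integral_powr_to_inf) auto
    also have "-(a powr (- 3/2 - \<kappa> + 1)) / (- 3/2 - \<kappa> + 1) = a powr (- 1/2 - \<kappa>) / (1/2 + \<kappa>)"
      using \<kappa> by (simp add: field_simps)
    finally have "((\<lambda>r. if r \<in> {a..} then r powr (- 3/2 - \<kappa>) else 0) has_integral a powr (- 1/2 - \<kappa>) / (1/2 + \<kappa>)) UNIV"
      by (subst has_integral_restrict_UNIV)
    then have "(\<integral>\<^sup>+r. ennreal (if r \<in> {a..} then r powr (- 3/2 - \<kappa>) else 0) \<partial>lborel) = ennreal (a powr (- 1/2 - \<kappa>) / (1/2 + \<kappa>))"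
      by (intro nn_integral_has_integral_lborel) auto
    moreover have "(\<integral>\<^sup>+r. ennreal (indicator {a<..} r * r powr (- 3/2 - \<kappa>)) \<partial>lborel) = (\<integral>\<^sup>+r. ennreal (if r \<in> {a..} then r powr (- 3/2 - \<kappa>) else 0) \<partial>lborel)"
    proof (rule nn_integral_cong_AE)
      show "AE r in lborel. ennreal (indicator {a<..} r * r powr (- 3/2 - \<kappa>)) = ennreal (if r \<in> {a..} then r powr (- 3/2 - \<kappa>) else 0)"
        using AE_lborel_singleton[of a] by eventually_elim (auto simp: indicator_def)
    qed
    ultimately show ?thesis by simp
  qed
  have "(\<integral>\<^sup>+r. ennreal (indicator {0<..<t} s * (indicator {t - s<..} r * r powr (- 3/2 - \<kappa>))) \<partial>lborel)
      = ennreal (1 / (1/2 + \<kappa>)) * ennreal (indicator {0<..<t} s * (t - s) powr (- 1/2 - \<kappa>))" for s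
  proof (cases "s \<in> {0<..<t}")
    case True
    then show ?thesis using inner[of "t - s"] \<kappa> by (simp add: ennreal_mult[symmetric])
  qed simp
  then have "(\<integral>\<^sup>+s. \<integral>\<^sup>+r. ennreal (indicator {0<..<t} s * (indicator {t - s<..} r * r powr (- 3/2 - \<kappa>))) \<partial>lborel \<partial>lborel)
    = ennreal (1 / (1/2 + \<kappa>)) * (\<integral>\<^sup>+s. ennreal (indicator {0<..<t} s * (t - s) powr (- 1/2 - \<kappa>)) \<partial>lborel)"
    by (simp add: nn_integral_cmult)
  also have "(\<integral>\<^sup>+s. ennreal (indicator {0<..<t} s * (t - s) powr (- 1/2 - \<kappa>)) \<partial>lborel)
      = (\<integral>\<^sup>+s. ennreal (indicator {0<..<t} (t - s) * (t - (t - s)) powr (- 1/2 - \<kappa>)) \<partial>lborel)"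
    by (rule nn_integral_lborel_reflect[symmetric]) measurable
  also have "\<dots> = (\<integral>\<^sup>+s. ennreal (if s \<in> {0..t} then s powr (- 1/2 - \<kappa>) else 0) \<partial>lborel)"
  proof (rule nn_integral_cong_AE)
    show "AE s in lborel. ennreal (indicator {0<..<t} (t - s) * (t - (t - s)) powr (- 1/2 - \<kappa>)) = ennreal (if s \<in> {0..t} then s powr (- 1/2 - \<kappa>) else 0)"
      using AE_lborel_singleton[of 0] AE_lborel_singleton[of t] by eventually_elim (auto simp: indicator_def)
  qed
  also have "\<dots> = ennreal (t powr (1/2 - \<kappa>) / (1/2 - \<kappa>))"
  proof (rule nn_integral_has_integral_lborel)
    have "((\<lambda>s. s powr (- 1/2 - \<kappa>)) has_integral (t powr (- 1/2 - \<kappa> + 1) / (- 1/2 - \<kappa> + 1))) {0..t}"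
      using \<kappa> t by (intro has_integral_powr_from_0) auto
    then show "((\<lambda>s. if s \<in> {0..t} then s powr (- 1/2 - \<kappa>) else 0) has_integral t powr (1/2 - \<kappa>) / (1/2 - \<kappa>)) UNIV"
      by (subst has_integral_restrict_UNIV) simp
  qed auto
  finally show ?thesis using \<kappa> by (simp add: ennreal_mult[symmetric])
qed

text \<open>Each time slice is only translated. The case of interest is the time dependent
  translation by \<open>sqrt s\<close> times a fixed vector.\<close>

lemma distr_shear:
  fixes c :: "real \<Rightarrow> 'a::euclidean_space"
  assumes [measurable]: "c \<in> borel_measurable borel"
  shows "distr (lborel \<Otimes>\<^sub>M lborel) (lborel \<Otimes>\<^sub>M lborel) (\<lambda>(s, y). (s, y + c s)) = lborel \<Otimes>\<^sub>M lborel"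
proof (rule measure_eqI)
  fix A assume "A \<in> sets (distr (lborel \<Otimes>\<^sub>M lborel) (lborel \<Otimes>\<^sub>M lborel) (\<lambda>(s, y). (s, y + c s)))"
  then have [measurable]: "A \<in> sets (lborel \<Otimes>\<^sub>M lborel)" by simp
  have [measurable]: "(\<lambda>(s, y). (s, y + c s)) \<in> lborel \<Otimes>\<^sub>M lborel \<rightarrow>\<^sub>M lborel \<Otimes>\<^sub>M lborel"
    unfolding case_prod_beta by measurable
  have "emeasure (distr (lborel \<Otimes>\<^sub>M lborel) (lborel \<Otimes>\<^sub>M lborel) (\<lambda>(s, y). (s, y + c s))) A
      = (\<integral>\<^sup>+p. indicator A p \<partial>distr (lborel \<Otimes>\<^sub>M lborel) (lborel \<Otimes>\<^sub>M lborel) (\<lambda>(s, y). (s, y + c s)))"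
    using \<open>A \<in> sets (lborel \<Otimes>\<^sub>M lborel)\<close> by (subst nn_integral_indicator) simp_all
  also have "\<dots> = (\<integral>\<^sup>+p. indicator A ((\<lambda>(s, y). (s, y + c s)) p) \<partial>(lborel \<Otimes>\<^sub>M lborel))"
    by (rule nn_integral_distr) measurable
  also have "\<dots> = (\<integral>\<^sup>+s. \<integral>\<^sup>+y. indicator A (s, y + c s) \<partial>lborel \<partial>lborel)"
    by (subst lborel.nn_integral_fst[symmetric]) (auto simp: case_prod_beta)
  also have "\<dots> = (\<integral>\<^sup>+s. \<integral>\<^sup>+y. indicator A (s, y) \<partial>lborel \<partial>lborel)"
    by (intro nn_integral_cong nn_integral_lborel_shift) measurable
  also have "\<dots> = emeasure (lborel \<Otimes>\<^sub>M lborel) A"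
    using \<open>A \<in> sets (lborel \<Otimes>\<^sub>M lborel)\<close> by (subst lborel.nn_integral_fst) simp_all
  finally show "emeasure (distr (lborel \<Otimes>\<^sub>M lborel) (lborel \<Otimes>\<^sub>M lborel) (\<lambda>(s, y). (s, y + c s))) A = emeasure (lborel \<Otimes>\<^sub>M lborel) A" .
qed simp

lemma integral_shear:
  fixes c :: "real \<Rightarrow> 'a::euclidean_space" and f :: "real \<times> 'a \<Rightarrow> complex"
  assumes [measurable]: "c \<in> borel_measurable borel" "f \<in> borel_measurable (lborel \<Otimes>\<^sub>M lborel)"
  shows "(\<integral>p. f (fst p, snd p + c (fst p)) \<partial>(lborel \<Otimes>\<^sub>M lborel)) = (\<integral>p. f p \<partial>(lborel \<Otimes>\<^sub>M lborel))"
proof -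
  have [measurable]: "(\<lambda>(s, y). (s, y + c s)) \<in> lborel \<Otimes>\<^sub>M lborel \<rightarrow>\<^sub>M lborel \<Otimes>\<^sub>M lborel"
    unfolding case_prod_beta by measurable
  have "(\<integral>p. f p \<partial>(lborel \<Otimes>\<^sub>M lborel)) = (\<integral>p. f p \<partial>distr (lborel \<Otimes>\<^sub>M lborel) (lborel \<Otimes>\<^sub>M lborel) (\<lambda>(s, y). (s, y + c s)))"
    by (simp add: distr_shear)
  also have "\<dots> = (\<integral>p. f (fst p, snd p + c (fst p)) \<partial>(lborel \<Otimes>\<^sub>M lborel))"
    by (subst integral_distr) (auto simp: case_prod_beta)
  finally show ?thesis ..
qed

lemma three_less_ennreal:
  assumes "3 < (q::ennreal)"
  shows "2 \<le> q" "1 \<le> q"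
proof -
  have "(2::ennreal) \<le> 3" "(1::ennreal) \<le> 3" by simp_all
  then show "2 \<le> q" "1 \<le> q" using assms by (meson order_trans less_imp_le)+
qed

text \<open>The reason for scaling the shift at time \<open>t\<close> by \<open>sqrt t\<close>:
  relative to time \<open>s\<close>, the kernel of age \<open>t - s\<close> is moved by at most a
  multiple of its width.\<close>

lemma sqrt_diff_le: "0 \<le> s \<Longrightarrow> s \<le> t \<Longrightarrow> sqrt t - sqrt s \<le> sqrt (t - s)"
  using sqrt_add_le_add_sqrt[of "t - s" s] by simp

text \<open>\<open>a\<close> is a Borel representative of the initial value and \<open>L\<close> the
  radius of the polydisc of complex shifts. Time is counted from the initial time.\<close>

locale ns_data =
  fixes a :: "real^3 \<Rightarrow> real^3" and L :: real
  assumes a_meas [measurable]: "a \<in> borel_measurable borel" and L_nonneg: "0 \<le> L"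
begin

text \<open>The value of \<open>W m \<eta> (t, x)\<close> is that of the \<open>m\<close>-th Picard iterate at the complex point
  \<open>x + sqrt t * \<eta>\<close>. The real part of the variable of integration is moved along by
  \<open>sqrt s * \<eta>\<close>, so that only the kernels are evaluated at complex points.\<close>

definition w0 :: "(3 \<Rightarrow> complex) \<Rightarrow> real \<times> (real^3) \<Rightarrow> 3 \<Rightarrow> complex" where
  "w0 \<eta> p i = (if 0 < fst p then \<integral>y. cgauss (fst p) (\<lambda>l. complex_of_real ((snd p - y) $ l) + complex_of_real (sqrt (fst p)) * \<eta> l)
      * complex_of_real (a y $ i) \<partial>lborel else 0)"

definition K :: "(3 \<Rightarrow> complex) \<Rightarrow> real \<times> (real^3) \<Rightarrow> real \<times> (real^3) \<Rightarrow> 3 \<Rightarrow> 3 \<Rightarrow> 3 \<Rightarrow> complex" where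
  "K \<eta> p p' i j l = (if 0 < fst p' \<and> fst p' < fst p then
     oseen_kernel (fst p - fst p') (\<lambda>m. complex_of_real ((snd p - snd p') $ m) + complex_of_real (sqrt (fst p) - sqrt (fst p')) * \<eta> m) i j l
     else 0)"

definition V :: "real \<times> (real^3) \<Rightarrow> ennreal" where
  "V p = (if 0 < fst p then \<integral>\<^sup>+y. ennreal (8 * exp (3 * L\<^sup>2 / 4)) * (ennreal (gauss (4 * fst p) (snd p - y)) * ennreal (norm (a y))) \<partial>lborel else 0)"

text \<open>The 9 counts the pairs \<open>(j, l)\<close>, all entries of the kernel having the same
  majorant.\<close>

definition k :: "real \<times> (real^3) \<Rightarrow> real \<times> (real^3) \<Rightarrow> ennreal" where
  "k p p' = (if 0 < fst p' \<and> fst p' < fst p then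
     9 * (\<integral>\<^sup>+r. ennreal (kernel_majorant L (fst p - fst p') (snd p - snd p') r) \<partial>lborel) else 0)"

definition H :: "(3 \<Rightarrow> complex) set" where
  "H = {\<eta>. \<forall>l. norm (\<eta> l) \<le> L}"

lemma near_shift:
  assumes "\<eta> \<in> H" "0 \<le> c" "c \<le> d"
  shows "near (L * d) (\<lambda>l. complex_of_real (z $ l) + complex_of_real c * \<eta> l) z"
  unfolding near_def
proof
  fix l
  have "c * norm (\<eta> l) \<le> d * L" using assms by (intro mult_mono) (auto simp: H_def)
  then show "norm (complex_of_real (z $ l) + complex_of_real c * \<eta> l - cvec z l) \<le> L * d"
    using assms by (simp add: cvec_def norm_mult mult.commute)
qed

lemma near_shift_kernel:
  assumes "\<eta> \<in> H" "0 < s" "s < t"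
  shows "near (L * sqrt (t - s)) (\<lambda>l. complex_of_real (z $ l) + complex_of_real (sqrt t - sqrt s) * \<eta> l) z"
  using assms sqrt_diff_le[of s t] by (intro near_shift) auto

lemma measurable_kernel_majorant [measurable]:
  assumes [measurable]: "f \<in> borel_measurable M" "g \<in> borel_measurable M" "h \<in> borel_measurable M"
  shows "(\<lambda>x. kernel_majorant L (f x) (g x) (h x)) \<in> borel_measurable M"
proof -
  have "(\<lambda>x. kernel_majorant L (f x) (g x) (h x)) = (\<lambda>x. (if f x < h x then 1 else 0) * (kernel_const L * h x powr (- 3/2) * gauss (4 * h x) (g x)))"
    by (auto simp: kernel_majorant_def fun_eq_iff)
  also have "\<dots> \<in> borel_measurable M" by measurable
  finally show ?thesis .
qed

lemma w0_measurable: "(\<lambda>p. w0 \<eta> p i) \<in> borel_measurable (lborel \<Otimes>\<^sub>M lborel)"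
  unfolding w0_def by measurable

lemma K_measurable: "(\<lambda>(p, p'). K \<eta> p p' i j l) \<in> borel_measurable ((lborel \<Otimes>\<^sub>M lborel) \<Otimes>\<^sub>M (lborel \<Otimes>\<^sub>M lborel))"
proof -
  have [measurable]: "(\<lambda>x. oseen_kernel (fst (fst x) - fst (snd x)) (\<lambda>m. complex_of_real ((snd (fst x) - snd (snd x)) $ m)
      + complex_of_real (sqrt (fst (fst x)) - sqrt (fst (snd x))) * \<eta> m) i j l)
    \<in> borel_measurable ((lborel \<Otimes>\<^sub>M lborel) \<Otimes>\<^sub>M (lborel \<Otimes>\<^sub>M lborel))"
    by (rule measurable_oseen_kernel) measurable
  show ?thesis unfolding K_def case_prod_beta by measurable
qed

lemma V_measurable: "V \<in> borel_measurable (lborel \<Otimes>\<^sub>M lborel)"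
  unfolding V_def[abs_def] by measurable

lemma k_measurable: "(\<lambda>(p, p'). k p p') \<in> borel_measurable ((lborel \<Otimes>\<^sub>M lborel) \<Otimes>\<^sub>M (lborel \<Otimes>\<^sub>M lborel))"
  unfolding k_def case_prod_beta by measurable

lemma w0_integrand_le:
  assumes "\<eta> \<in> H" "0 < t"
  shows "norm (cgauss t (\<lambda>l. complex_of_real ((x - y) $ l) + complex_of_real (sqrt t) * \<eta> l) * complex_of_real (a y $ i))
    \<le> 8 * exp (3 * L\<^sup>2 / 4) * (gauss (4 * t) (x - y) * norm (a y))"
proof -
  have "norm (cgauss t (\<lambda>l. complex_of_real ((x - y) $ l) + complex_of_real (sqrt t) * \<eta> l)) \<le> 8 * exp (3 * L\<^sup>2 / 4) * gauss (4 * t) (x - y)"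
    by (rule norm_cgauss_le_gauss[OF assms(2) near_shift]) (use assms in auto)
  then show ?thesis unfolding norm_mult mult.assoc[symmetric]
    by (intro mult_mono) (auto simp: component_le_norm_cart)
qed

sublocale picard "lborel \<Otimes>\<^sub>M lborel" w0 K V k H
proof (intro picard.intro picard_axioms.intro)
  show "sigma_finite_measure (lborel \<Otimes>\<^sub>M lborel :: (real \<times> (real^3)) measure)"
    by (rule lborel_pair.sigma_finite_measure_axioms)
  show "ennreal (norm (w0 h p i)) \<le> V p" if h: "h \<in> H" for h p i
  proof (cases "0 < fst p")
    case True
    show ?thesis unfolding w0_def V_def if_P[OF True]
    proof (intro order_trans[OF norm_integral_le_nn] nn_integral_mono)
      fix y
      show "ennreal (norm (cgauss (fst p) (\<lambda>l. complex_of_real ((snd p - y) $ l) + complex_of_real (sqrt (fst p)) * h l) * complex_of_real (a y $ i)))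
        \<le> ennreal (8 * exp (3 * L\<^sup>2 / 4)) * (ennreal (gauss (4 * fst p) (snd p - y)) * ennreal (norm (a y)))"
        using ennreal_leI[OF w0_integrand_le[OF h True, of "snd p" y i]] by (simp only: ennreal_mult mult_nonneg_nonneg gauss_nonneg norm_ge_zero ennreal_mult'' zero_le_numeral exp_ge_zero)
    qed
  qed (simp add: w0_def)
  show "ennreal (\<Sum>j\<in>UNIV. \<Sum>l\<in>UNIV. norm (K h p p' i j l)) \<le> k p p'" if h: "h \<in> H" for h p p' i
  proof (cases "0 < fst p' \<and> fst p' < fst p")
    case True
    let ?I = "\<integral>\<^sup>+r. ennreal (kernel_majorant L (fst p - fst p') (snd p - snd p') r) \<partial>lborel"
    have "ennreal (norm (K h p p' i j l)) \<le> ?I" for j l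
      unfolding K_def if_P[OF True]
      by (rule norm_oseen_kernel_le[OF _ L_nonneg near_shift_kernel[OF h]]) (use True in auto)
    then have "(\<Sum>j\<in>UNIV. \<Sum>l\<in>UNIV. ennreal (norm (K h p p' i j l))) \<le> (\<Sum>j\<in>(UNIV::3 set). \<Sum>l\<in>(UNIV::3 set). ?I)"
      by (intro sum_mono)
    also have "\<dots> = k p p'" using True by (simp add: k_def mult.assoc[symmetric])
    finally show ?thesis by (simp add: sum_nonneg)
  next
    case False
    show ?thesis unfolding K_def if_not_P[OF False] by simp
  qed
qed (rule w0_measurable K_measurable V_measurable k_measurable)+

lemma V_le_Uinf: "V p \<le> Uinf p"
  using U_le_Uinf[of 0 p] by simp

text \<open>Holomorphy in one coordinate at a time is enough, because derivatives will be taken one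
  by one.\<close>

lemma Winf_holomorphic_coordinate:
  assumes \<eta>: "\<eta> \<in> H" and fin: "Uinf p < \<top>"
  shows "(\<lambda>z. Winf (\<eta>(c := z)) p i) holomorphic_on ball 0 L"
proof (rule Winf_holomorphic)
  have H: "\<eta>(c := z) \<in> H" if "z \<in> ball 0 L" for z
    using that \<eta> by (auto simp: H_def)
  then show "\<And>z. z \<in> ball 0 L \<Longrightarrow> \<eta>(c := z) \<in> H" .
  have upd: "(\<lambda>z. complex_of_real u + complex_of_real v * (\<eta>(c := z)) l) holomorphic_on ball 0 L" for u v l
    by (cases "l = c") (auto intro!: holomorphic_intros)
  show "(\<lambda>z. w0 (\<eta>(c := z)) p i) holomorphic_on ball 0 L" if fin: "Uinf p < \<top>" for p i
  proof (cases "0 < fst p")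
    case True
    let ?b = "\<lambda>y. 8 * exp (3 * L\<^sup>2 / 4) * (gauss (4 * fst p) (snd p - y) * norm (a y))"
    have "(\<integral>\<^sup>+y. ennreal (?b y) \<partial>lborel) < \<top>"
      using le_less_trans[OF V_le_Uinf fin] True by (simp add: V_def ennreal_mult)
    then have b: "integrable lborel ?b"
      by (intro integrableI_nonneg) auto
    have "(\<lambda>z. \<integral>y. cgauss (fst p) (\<lambda>l. complex_of_real ((snd p - y) $ l) + complex_of_real (sqrt (fst p)) * (\<eta>(c := z)) l)
      * complex_of_real (a y $ i) \<partial>lborel) holomorphic_on ball 0 L"
    proof (rule holomorphic_on_integral[OF open_ball _ _ b])
      show "AE y in lborel. (\<lambda>z. cgauss (fst p) (\<lambda>l. complex_of_real ((snd p - y) $ l) + complex_of_real (sqrt (fst p)) * (\<eta>(c := z)) l)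
        * complex_of_real (a y $ i)) holomorphic_on ball 0 L \<and> (\<forall>z\<in>ball 0 L. norm (cgauss (fst p) (\<lambda>l. complex_of_real ((snd p - y) $ l) + complex_of_real (sqrt (fst p)) * (\<eta>(c := z)) l)
        * complex_of_real (a y $ i)) \<le> ?b y)"
        by (intro AE_I2 conjI ballI w0_integrand_le H True holomorphic_on_mult cgauss_holomorphic upd holomorphic_on_const)
    qed measurable
    then show ?thesis using True by (simp add: w0_def)
  qed (simp add: w0_def)
  show "(\<lambda>z. K (\<eta>(c := z)) p p' i j l) holomorphic_on ball 0 L" for p p' i j l
  proof (cases "0 < fst p' \<and> fst p' < fst p")
    case True
    have "(\<lambda>z. oseen_kernel (fst p - fst p') (\<lambda>m. complex_of_real ((snd p - snd p') $ m) + complex_of_real (sqrt (fst p) - sqrt (fst p')) * (\<eta>(c := z)) m) i j l) holomorphic_on ball 0 L"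
      by (rule oseen_kernel_holomorphic[OF open_ball _ L_nonneg upd near_shift_kernel[OF H]]) (use True in auto)
    then show ?thesis unfolding K_def if_P[OF True] .
  next
    case False
    show ?thesis unfolding K_def if_not_P[OF False] by simp
  qed
qed (use fin in \<open>auto simp: space_pair_measure\<close>)

section \<open>Real shifts act as translations in space\<close>

lemma w0_translate:
  fixes e :: "real^3"
  shows "w0 (\<lambda>l. \<omega> l + complex_of_real (e $ l)) (t, x) i = w0 \<omega> (t, x + sqrt t *\<^sub>R e) i"
proof -
  have "complex_of_real ((x - y) $ l) + complex_of_real (sqrt t) * (\<omega> l + complex_of_real (e $ l))
      = complex_of_real ((x + sqrt t *\<^sub>R e - y) $ l) + complex_of_real (sqrt t) * \<omega> l" for y l
    by (simp add: algebra_simps)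
  then show ?thesis by (simp only: w0_def fst_conv snd_conv)
qed

text \<open>A real part \<open>e\<close> of the shift moves \<open>x\<close> by
  \<open>sqrt t *\<^sub>R e\<close> and, inside the integral, the point at time \<open>s\<close> by
  \<open>sqrt s *\<^sub>R e\<close>; the latter disappears by the shear invariance of Lebesgue
  measure. The identity holds for the iterates whether or not the integrals converge.\<close>

lemma W_translate:
  fixes e :: "real^3"
  shows "W m (\<lambda>l. \<omega> l + complex_of_real (e $ l)) (t, x) i = W m \<omega> (t, x + sqrt t *\<^sub>R e) i"
proof (induction m arbitrary: t x i)
  case 0
  show ?case by (simp only: W.simps w0_translate)
next
  case (Suc m)
  let ?\<eta> = "\<lambda>l. \<omega> l + complex_of_real (e $ l)"
  have K: "K ?\<eta> (t, x) p' i j l = K \<omega> (t, x + sqrt t *\<^sub>R e) (fst p', snd p' + sqrt (fst p') *\<^sub>R e) i j l" for p' j l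
  proof -
    have "complex_of_real ((x - snd p') $ m) + complex_of_real (sqrt t - sqrt (fst p')) * (\<omega> m + complex_of_real (e $ m))
      = complex_of_real ((x + sqrt t *\<^sub>R e - (snd p' + sqrt (fst p') *\<^sub>R e)) $ m) + complex_of_real (sqrt t - sqrt (fst p')) * \<omega> m" for m
      by (simp add: algebra_simps)
    then show ?thesis by (simp only: K_def fst_conv snd_conv)
  qed
  have "(\<integral>p'. B ?\<eta> (W m ?\<eta>) (t, x) p' i \<partial>(lborel \<Otimes>\<^sub>M lborel))
      = (\<integral>p'. B \<omega> (W m \<omega>) (t, x + sqrt t *\<^sub>R e) (fst p', snd p' + sqrt (fst p') *\<^sub>R e) i \<partial>(lborel \<Otimes>\<^sub>M lborel))"
  proof (rule Bochner_Integration.integral_cong[OF refl])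
    fix p' :: "real \<times> (real^3)"
    show "B ?\<eta> (W m ?\<eta>) (t, x) p' i = B \<omega> (W m \<omega>) (t, x + sqrt t *\<^sub>R e) (fst p', snd p' + sqrt (fst p') *\<^sub>R e) i"
      unfolding B_def K using Suc[of "fst p'" "snd p'"] by simp
  qed
  also have "\<dots> = (\<integral>p'. B \<omega> (W m \<omega>) (t, x + sqrt t *\<^sub>R e) p' i \<partial>(lborel \<Otimes>\<^sub>M lborel))"
    by (rule integral_shear) (auto intro!: B_measurable1 simp: space_pair_measure)
  finally show ?case by (simp only: W.simps w0_translate)
qed

lemma Winf_translate:
  fixes e :: "real^3"
  shows "Winf (\<lambda>l. \<omega> l + complex_of_real (e $ l)) (t, x) i = Winf \<omega> (t, x + sqrt t *\<^sub>R e) i"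
  unfolding Winf_def W_translate ..

section \<open>Lebesgue bounds for the majorant\<close>

lemma V_bound:
  assumes q: "1 \<le> q" and a: "Lq_bound q (\<lambda>x. ennreal (norm (a x))) A" "0 < A" and t: "0 < t"
  shows "Lq_bound q (\<lambda>x. V (t, x)) (8 * exp (3 * L\<^sup>2 / 4) * A)"
proof -
  have "Lq_bound q (\<lambda>x. ennreal (8 * exp (3 * L\<^sup>2 / 4)) * (\<integral>\<^sup>+y. ennreal (gauss (4 * t) (x - y)) * ennreal (norm (a y)) \<partial>lborel)) (8 * exp (3 * L\<^sup>2 / 4) * A)"
    by (intro Lq_bound_cmult Lq_bound_gauss) (use q a t in auto)
  then show ?thesis using t by (simp add: V_def nn_integral_cmult)
qed

text \<open>The constant of the bilinear estimate: 9 and \<open>kernel_const\<close> stem from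
  \<open>k\<close>, \<open>16 * pi\<close> from Gaussians at four times the parameter, and the
  denominator from \<open>time_integral\<close>.\<close>

definition dconst :: "ennreal \<Rightarrow> real" where
  "dconst q = 9 * kernel_const L * (16 * pi) powr (- (three_over q / 2)) / ((1/2 + three_over q / 2) * (1/2 - three_over q / 2))"

text \<open>Written out, the left side is an integral, over the time \<open>s\<close> and the kernel
  parameter \<open>r\<close>, of Gaussians at time \<open>4 * r\<close> convolved with the square of
  \<open>u\<close>. \<open>Lq_bound_gauss_square\<close> bounds each convolution; Minkowski's
  inequality over the pairs \<open>(s, r)\<close> sums these bounds and leaves
  \<open>time_integral\<close>.\<close>

lemma bilinear_bound:
  assumes q: "3 < q" and U: "\<And>s. 0 < s \<Longrightarrow> s < t \<Longrightarrow> Lq_bound q (\<lambda>x. u (s, x)) b" and b: "0 < b" and t: "0 < t"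
    and [measurable]: "u \<in> borel_measurable (lborel \<Otimes>\<^sub>M lborel)"
    and \<kappa>: "\<kappa> = three_over q / 2" "0 \<le> \<kappa>" "\<kappa> < 1/2"
  shows "Lq_bound q (\<lambda>x. \<integral>\<^sup>+p'. k (t, x) p' * (u p')\<^sup>2 \<partial>(lborel \<Otimes>\<^sub>M lborel)) (dconst q * t powr (1/2 - \<kappa>) * b\<^sup>2)"
proof -
  note q2 = three_less_ennreal[OF q]
  \<comment> \<open>The weight of the pair \<open>p = (s, r)\<close>, zero unless
    \<open>0 < s < t\<close> and \<open>r > t - s\<close>.\<close>
  define c where "c p = indicator {0<..<t} (fst p) * (9 * kernel_const L * (indicator {t - fst p<..} (snd p) * snd p powr (- 3/2)))" for p :: "real \<times> real"
  have c0: "0 \<le> c p" for p using kernel_const_pos[of L] by (simp add: c_def)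
  have ceq: "c p = (if 0 < fst p \<and> fst p < t \<and> t - fst p < snd p then 9 * kernel_const L * snd p powr (- 3/2) else 0)" for p
    by (auto simp: c_def indicator_def)
  have [measurable]: "c \<in> borel_measurable (lborel \<Otimes>\<^sub>M lborel)"
    unfolding ceq[abs_def] by measurable
  define f where "f p x = ennreal (c p) * (\<integral>\<^sup>+y. ennreal (gauss (4 * snd p) (x - y)) * (u (fst p, y))\<^sup>2 \<partial>lborel)" for p x
  define bb where "bb p = c p * ((4 * pi * (4 * snd p)) powr (- \<kappa>) * b\<^sup>2)" for p
  have sp: "0 < snd p" "0 < fst p" "fst p < t" if "c p \<noteq> 0" for p
    using that by (auto simp: ceq split: if_splits)
  have "Lq_bound q (\<lambda>x. \<integral>\<^sup>+p. f p x \<partial>(lborel \<Otimes>\<^sub>M lborel)) (dconst q * t powr (1/2 - \<kappa>) * b\<^sup>2)"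
  proof (rule Lq_bound_nn_integral[OF q2(2) lborel_pair.sigma_finite_measure_axioms])
    show "case_prod f \<in> borel_measurable ((lborel \<Otimes>\<^sub>M lborel) \<Otimes>\<^sub>M borel)"
      unfolding f_def case_prod_beta by measurable
    show "bb \<in> borel_measurable (lborel \<Otimes>\<^sub>M lborel)" unfolding bb_def[abs_def] by measurable
    show "0 \<le> bb p \<and> Lq_bound q (f p) (bb p) \<and> (bb p = 0 \<longrightarrow> f p = (\<lambda>_. 0))" for p
    proof (cases "c p = 0")
      case True
      then show ?thesis using q2 by (auto simp: bb_def f_def fun_eq_iff Lq_bound_def)
    next
      case False
      have "Lq_bound q (f p) (bb p)"
        unfolding f_def bb_def \<kappa>(1)
        by (intro Lq_bound_cmult Lq_bound_gauss_square U) (use sp[OF False] c0 b q2 in auto)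
      moreover have "bb p > 0" using False c0[of p] b sp[OF False] by (simp add: bb_def)
      ultimately show ?thesis by simp
    qed
    let ?D = "9 * kernel_const L * (16 * pi) powr (- \<kappa>) * b\<^sup>2"
    have "ennreal (bb p) = ennreal ?D * ennreal (indicator {0<..<t} (fst p) * (indicator {t - fst p<..} (snd p) * snd p powr (- 3/2 - \<kappa>)))" for p
    proof (cases "0 < fst p \<and> fst p < t \<and> t - fst p < snd p")
      case False
      have "c p = 0" unfolding ceq if_not_P[OF False] ..
      moreover have "indicator {0<..<t} (fst p) * (indicator {t - fst p<..} (snd p) * snd p powr (- 3/2 - \<kappa>)) = 0"
        using False by (auto simp: indicator_def)
      ultimately show ?thesis unfolding bb_def by (simp only: mult_zero_left mult_zero_right ennreal_0)
    next
      case True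
      then have s: "0 < snd p" by auto
      have "(4 * pi * (4 * snd p)) powr (- \<kappa>) = (16 * pi) powr (- \<kappa>) * snd p powr (- \<kappa>)"
        using s by (simp add: powr_mult[symmetric] mult_ac)
      moreover have "snd p powr (- 3/2 - \<kappa>) = snd p powr (- 3/2) * snd p powr (- \<kappa>)"
        by (simp add: powr_add[symmetric])
      ultimately show ?thesis using kernel_const_pos[of L] b
        by (subst ennreal_mult[symmetric]) (auto simp: bb_def c_def mult_ac)
    qed
    then have "(\<integral>\<^sup>+p. ennreal (bb p) \<partial>(lborel \<Otimes>\<^sub>M lborel))
      = ennreal ?D * (\<integral>\<^sup>+p. ennreal (indicator {0<..<t} (fst p) * (indicator {t - fst p<..} (snd p) * snd p powr (- 3/2 - \<kappa>))) \<partial>(lborel \<Otimes>\<^sub>M lborel))"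
    proof (simp only:, intro nn_integral_cmult)
      have "(\<lambda>p::real\<times>real. ennreal (indicator {0<..<t} (fst p) * (indicator {t - fst p<..} (snd p) * snd p powr (- 3/2 - \<kappa>))))
        = (\<lambda>p. ennreal (if 0 < fst p \<and> fst p < t \<and> t - fst p < snd p then snd p powr (- 3/2 - \<kappa>) else 0))"
        by (auto simp: indicator_def fun_eq_iff)
      also have "\<dots> \<in> borel_measurable (lborel \<Otimes>\<^sub>M lborel)" by measurable
      finally show "(\<lambda>p::real\<times>real. ennreal (indicator {0<..<t} (fst p) * (indicator {t - fst p<..} (snd p) * snd p powr (- 3/2 - \<kappa>)))) \<in> borel_measurable (lborel \<Otimes>\<^sub>M lborel)" .
    qed
    also have "(\<integral>\<^sup>+p. ennreal (indicator {0<..<t} (fst p) * (indicator {t - fst p<..} (snd p) * snd p powr (- 3/2 - \<kappa>))) \<partial>(lborel \<Otimes>\<^sub>M lborel))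
      = (\<integral>\<^sup>+s. \<integral>\<^sup>+r. ennreal (indicator {0<..<t} s * (indicator {t - s<..} r * r powr (- 3/2 - \<kappa>))) \<partial>lborel \<partial>lborel)"
    proof -
      have "(\<lambda>p::real\<times>real. ennreal (indicator {0<..<t} (fst p) * (indicator {t - fst p<..} (snd p) * snd p powr (- 3/2 - \<kappa>))))
        = (\<lambda>p. ennreal (if 0 < fst p \<and> fst p < t \<and> t - fst p < snd p then snd p powr (- 3/2 - \<kappa>) else 0))"
        by (auto simp: indicator_def fun_eq_iff)
      also have "\<dots> \<in> borel_measurable (lborel \<Otimes>\<^sub>M lborel)" by measurable
      finally show ?thesis by (subst lborel.nn_integral_fst[symmetric]) auto
    qed
    also have "\<dots> = ennreal (t powr (1/2 - \<kappa>) / ((1/2 + \<kappa>) * (1/2 - \<kappa>)))" by (rule time_integral[OF \<kappa>(2,3) t])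
    also have "ennreal ?D * \<dots> = ennreal (dconst q * t powr (1/2 - \<kappa>) * b\<^sup>2)"
      using kernel_const_pos[of L] \<kappa>(2,3) b by (subst ennreal_mult[symmetric]) (auto simp: dconst_def \<kappa>(1)[symmetric])
    finally show "(\<integral>\<^sup>+p. ennreal (bb p) \<partial>(lborel \<Otimes>\<^sub>M lborel)) \<le> ennreal (dconst q * t powr (1/2 - \<kappa>) * b\<^sup>2)" by simp
    show "0 < dconst q * t powr (1/2 - \<kappa>) * b\<^sup>2"
      using kernel_const_pos[of L] \<kappa>(2,3) b t by (simp add: dconst_def \<kappa>(1)[symmetric])
  qed
  moreover have "(\<integral>\<^sup>+p'. k (t, x) p' * (u p')\<^sup>2 \<partial>(lborel \<Otimes>\<^sub>M lborel)) = (\<integral>\<^sup>+p. f p x \<partial>(lborel \<Otimes>\<^sub>M lborel))" for x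
  proof -
    let ?g = "\<lambda>s r y. ennreal (c (s, r)) * (ennreal (gauss (4 * r) (x - y)) * (u (s, y))\<^sup>2)"
    have kk: "k (t, x) (s, y) * (u (s, y))\<^sup>2 = (\<integral>\<^sup>+r. ?g s r y \<partial>lborel)" for s y
    proof -
      have "k (t, x) (s, y) = (\<integral>\<^sup>+r. ennreal (c (s, r)) * ennreal (gauss (4 * r) (x - y)) \<partial>lborel)"
      proof (cases "0 < s \<and> s < t")
        case True
        have "ennreal (c (s, r)) * ennreal (gauss (4 * r) (x - y)) = 9 * ennreal (kernel_majorant L (t - s) (x - y) r)" for r
        proof -
          have "c (s, r) * gauss (4 * r) (x - y) = 9 * kernel_majorant L (t - s) (x - y) r"
            using True by (simp add: c_def kernel_majorant_def)
          then show ?thesis using c0[of "(s, r)"] kernel_majorant_nonneg[of L "t - s" "x - y" r]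
            by (simp add: ennreal_mult[symmetric] ennreal_mult'[symmetric] numeral_mult_ennreal)
        qed
        then show ?thesis using True by (simp add: k_def nn_integral_cmult)
      qed (auto simp: k_def c_def)
      then show ?thesis by (simp add: nn_integral_multc mult.assoc[symmetric])
    qed
    have "(\<integral>\<^sup>+p'. k (t, x) p' * (u p')\<^sup>2 \<partial>(lborel \<Otimes>\<^sub>M lborel)) = (\<integral>\<^sup>+s. \<integral>\<^sup>+y. k (t, x) (s, y) * (u (s, y))\<^sup>2 \<partial>lborel \<partial>lborel)"
      using k_meas1[of "(t, x)"] by (subst lborel.nn_integral_fst[symmetric]) (auto simp: space_pair_measure)
    also have "\<dots> = (\<integral>\<^sup>+s. \<integral>\<^sup>+r. \<integral>\<^sup>+y. ?g s r y \<partial>lborel \<partial>lborel \<partial>lborel)"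
      unfolding kk by (intro nn_integral_cong lborel_pair.Fubini') measurable
    also have "\<dots> = (\<integral>\<^sup>+s. \<integral>\<^sup>+r. f (s, r) x \<partial>lborel \<partial>lborel)"
      unfolding f_def by (intro nn_integral_cong) (simp add: nn_integral_cmult)
    also have "\<dots> = (\<integral>\<^sup>+p. f p x \<partial>(lborel \<Otimes>\<^sub>M lborel))"
      unfolding f_def by (subst lborel.nn_integral_fst[symmetric]) auto
    finally show ?thesis .
  qed
  ultimately show ?thesis by simp
qed

lemma U_measurable_slice: "(\<lambda>x. U m (t, x)) \<in> borel_measurable borel"
  using measurable_Pair2[OF U_measurable, of t m] by (simp add: space_pair_measure)

lemma Uinf_measurable_slice: "(\<lambda>x. Uinf (t, x)) \<in> borel_measurable borel"
  using measurable_Pair2[OF Uinf_measurable, of t] by (simp add: space_pair_measure)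

lemma dconst_pos:
  assumes "0 \<le> three_over q / 2" "three_over q / 2 < 1/2"
  shows "0 < dconst q"
  using assms kernel_const_pos[of L] by (simp add: dconst_def)

text \<open>\<open>Q\<close> is twice the bound for \<open>V\<close>, and the smallness condition
  makes the quadratic term at most \<open>Q / 2\<close>. So the bound \<open>Q\<close> reproduces
  itself along the iteration and passes to the supremum.\<close>

lemma Uinf_bound:
  assumes q: "3 < q" and \<kappa>: "\<kappa> = three_over q / 2" "0 \<le> \<kappa>" "\<kappa> < 1/2"
    and A: "Lq_bound q (\<lambda>x. ennreal (norm (a x))) A" "0 < A"
    and Q: "Q = 16 * exp (3 * L\<^sup>2 / 4) * A" and small: "dconst q * T powr (1/2 - \<kappa>) * Q \<le> 1/2"
    and t: "0 < t" "t \<le> T"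
  shows "Lq_bound q (\<lambda>x. Uinf (t, x)) Q"
proof -
  note q1 = three_less_ennreal(2)[OF q]
  have Q0: "0 < Q" using A Q by simp
  have d: "0 < dconst q" using \<kappa> by (intro dconst_pos) auto
  have U: "Lq_bound q (\<lambda>x. U m (t, x)) Q" if "0 < t" "t \<le> T" for m t
    using that
  proof (induction m arbitrary: t)
    case 0
    then show ?case
      by (simp, intro Lq_bound_mono[OF V_bound[OF q1 A, of t]]) (use Q A in auto)
  next
    case (Suc m)
    have "Lq_bound q (\<lambda>x. V (t, x) + (\<integral>\<^sup>+p'. k (t, x) p' * (U m p')\<^sup>2 \<partial>(lborel \<Otimes>\<^sub>M lborel)))
      (8 * exp (3 * L\<^sup>2 / 4) * A + dconst q * t powr (1/2 - \<kappa>) * Q\<^sup>2)"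
    proof (rule Lq_bound_add[OF q1])
      show "Lq_bound q (\<lambda>x. V (t, x)) (8 * exp (3 * L\<^sup>2 / 4) * A)" by (rule V_bound[OF q1 A Suc.prems(1)])
      show "Lq_bound q (\<lambda>x. \<integral>\<^sup>+p'. k (t, x) p' * (U m p')\<^sup>2 \<partial>(lborel \<Otimes>\<^sub>M lborel)) (dconst q * t powr (1/2 - \<kappa>) * Q\<^sup>2)"
        by (rule bilinear_bound[OF q Suc.IH Q0 Suc.prems(1) _ \<kappa>]) (use Suc.prems in auto)
      show "(\<lambda>x. V (t, x)) \<in> borel_measurable borel"
        using U_measurable_slice[of 0 t] by simp
      show "(\<lambda>x. \<integral>\<^sup>+p'. k (t, x) p' * (U m p')\<^sup>2 \<partial>(lborel \<Otimes>\<^sub>M lborel)) \<in> borel_measurable borel"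
      proof -
        have "(\<lambda>p. \<integral>\<^sup>+p'. k p p' * (U m p')\<^sup>2 \<partial>(lborel \<Otimes>\<^sub>M lborel)) \<in> borel_measurable (lborel \<Otimes>\<^sub>M lborel)" by measurable
        from measurable_Pair2[OF this, of t] show ?thesis by (simp add: space_pair_measure)
      qed
    qed (use A d Suc.prems Q0 in auto)
    moreover have "8 * exp (3 * L\<^sup>2 / 4) * A + dconst q * t powr (1/2 - \<kappa>) * Q\<^sup>2 \<le> Q"
    proof -
      have "dconst q * t powr (1/2 - \<kappa>) * Q\<^sup>2 = (dconst q * t powr (1/2 - \<kappa>) * Q) * Q" by (simp add: power2_eq_square)
      also have "\<dots> \<le> (dconst q * T powr (1/2 - \<kappa>) * Q) * Q"
        using d Q0 Suc.prems \<kappa> by (intro mult_right_mono mult_left_mono powr_mono2) auto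
      also have "\<dots> \<le> 1/2 * Q" using Q0 small by (intro mult_right_mono) auto
      finally show ?thesis using Q by simp
    qed
    ultimately show ?case
      by (simp, elim Lq_bound_mono) (use A d Suc.prems Q0 in auto)
  qed
  show ?thesis unfolding Uinf_def
    by (rule Lq_bound_SUP[OF q1 U[OF t] incseq_U U_measurable_slice])
qed

end

section \<open>Derivatives of fields with complex translates\<close>

text \<open>By Montel's theorem a subsequence converges to a holomorphic function, which must agree
  with the pointwise limit.\<close>

lemma holomorphic_pointwise_limit:
  fixes f :: "nat \<Rightarrow> complex \<Rightarrow> complex"
  assumes S: "open S" and hol: "\<And>n. f n holomorphic_on S" and bnd: "\<And>n z. z \<in> S \<Longrightarrow> norm (f n z) \<le> b"
    and lim: "\<And>z. z \<in> S \<Longrightarrow> (\<lambda>n. f n z) \<longlonglongrightarrow> g z"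
  shows "g holomorphic_on S"
proof -
  obtain g' r where g': "g' holomorphic_on S" "strict_mono (r :: nat \<Rightarrow> nat)" "\<And>x. x \<in> S \<Longrightarrow> ((\<lambda>n. f (r n) x) \<longlongrightarrow> g' x) sequentially"
    by (rule Montel[OF S, of "range f" f]) (use hol bnd in blast)+
  have "g z = g' z" if "z \<in> S" for z
    using LIMSEQ_subseq_LIMSEQ[OF lim[OF that] g'(2)] g'(3)[OF that] by (auto simp: o_def intro: LIMSEQ_unique)
  then show ?thesis using g'(1) by (metis holomorphic_cong)
qed

definition polydisc :: "real \<Rightarrow> (3 \<Rightarrow> complex) set" where
  "polydisc R = {\<eta>. \<forall>l. norm (\<eta> l) \<le> R}"

text \<open>What the solution at one fixed time provides: Borel slices, real shifts acting as
  translations by \<open>g\<close> times the shift, one majorant \<open>U\<close> for all shifts in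
  the polydisc, and holomorphy in each coordinate where \<open>U\<close> is finite. Here
  \<open>g\<close> will be \<open>sqrt t\<close>. It is stated for a general \<open>w\<close> so
  that it can be passed on to derivatives.\<close>

definition translatable ::
    "real \<Rightarrow> real \<Rightarrow> (real^3 \<Rightarrow> ennreal) \<Rightarrow> ((3 \<Rightarrow> complex) \<Rightarrow> real^3 \<Rightarrow> complex) \<Rightarrow> bool" where
  "translatable R g U w \<longleftrightarrow> (\<forall>\<eta>. w \<eta> \<in> borel_measurable borel)
     \<and> (\<forall>\<omega> e x. w (\<lambda>l. \<omega> l + complex_of_real (e $ l)) x = w \<omega> (x + g *\<^sub>R e))
     \<and> (\<forall>\<eta>\<in>polydisc R. \<forall>x. ennreal (norm (w \<eta> x)) \<le> U x)
     \<and> (\<forall>\<eta>\<in>polydisc R. \<forall>c x. U x < \<top> \<longrightarrow> (\<lambda>z. w (\<eta>(c := z)) x) holomorphic_on ball 0 R)"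

lemma translatableD:
  assumes "translatable R g U w"
  shows "w \<eta> \<in> borel_measurable borel"
    and "w (\<lambda>l. \<omega> l + complex_of_real (e $ l)) x = w \<omega> (x + g *\<^sub>R e)"
    and "\<eta> \<in> polydisc R \<Longrightarrow> ennreal (norm (w \<eta> x)) \<le> U x"
    and "\<eta> \<in> polydisc R \<Longrightarrow> U x < \<top> \<Longrightarrow> (\<lambda>z. w (\<eta>(c := z)) x) holomorphic_on ball 0 R"
proof -
  note a = assms[unfolded translatable_def]
  show "w \<eta> \<in> borel_measurable borel" by (rule conjunct1[OF a, rule_format])
  show "w (\<lambda>l. \<omega> l + complex_of_real (e $ l)) x = w \<omega> (x + g *\<^sub>R e)"
    by (rule conjunct1[OF conjunct2[OF a], rule_format])
  show "ennreal (norm (w \<eta> x)) \<le> U x" if "\<eta> \<in> polydisc R"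
    by (rule conjunct1[OF conjunct2[OF conjunct2[OF a]], rule_format, OF that])
  show "(\<lambda>z. w (\<eta>(c := z)) x) holomorphic_on ball 0 R" if "\<eta> \<in> polydisc R" "U x < \<top>"
    by (rule conjunct2[OF conjunct2[OF conjunct2[OF a]], rule_format, OF that])
qed

definition hstep :: "nat \<Rightarrow> real" where "hstep j = 1 / (real j + 1)"

lemma hstep: "0 < hstep j" "hstep j \<le> 1"
  by (auto simp: hstep_def)

lemma hstep_lim: "hstep \<longlonglongrightarrow> 0"
  unfolding hstep_def by real_asymp

definition shift_quot :: "3 \<Rightarrow> ((3 \<Rightarrow> complex) \<Rightarrow> real^3 \<Rightarrow> complex) \<Rightarrow> nat \<Rightarrow> (3 \<Rightarrow> complex) \<Rightarrow> real^3 \<Rightarrow> complex" where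
  "shift_quot c w j \<eta> x = (w (\<eta>(c := \<eta> c + complex_of_real (hstep j))) x - w \<eta> x) / complex_of_real (hstep j)"

text \<open>A limit of quotients with real steps in place of \<open>deriv\<close>: measurability and
  the translation identity carry over directly, and at zero shift the quotients are difference
  quotients in space.\<close>

definition shift_deriv :: "3 \<Rightarrow> ((3 \<Rightarrow> complex) \<Rightarrow> real^3 \<Rightarrow> complex) \<Rightarrow> (3 \<Rightarrow> complex) \<Rightarrow> real^3 \<Rightarrow> complex" where
  "shift_deriv c w \<eta> x = lim (\<lambda>j. shift_quot c w j \<eta> x)"

lemma polydisc_mono: "\<eta> \<in> polydisc R \<Longrightarrow> R \<le> R' \<Longrightarrow> \<eta> \<in> polydisc R'"
  unfolding polydisc_def by (auto intro: order_trans)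

lemma polydisc_upd: "\<eta> \<in> polydisc R \<Longrightarrow> norm z \<le> R \<Longrightarrow> \<eta>(c := z) \<in> polydisc R"
  by (auto simp: polydisc_def)

text \<open>With 2 to spare in the radius, Cauchy's estimate gives the factor \<open>2 / 2\<close>,
  so the derivative obeys the same majorant with no new constant. The quotients use steps of length
  at most 1, which leaves radius 1 and hence the factor 2.\<close>

lemma shift_deriv_props:
  assumes w: "translatable R g U w" and \<eta>: "\<eta> \<in> polydisc (R - 2)" and fin: "U x < \<top>"
  shows "(\<lambda>j. shift_quot c w j \<eta> x) \<longlonglongrightarrow> shift_deriv c w \<eta> x"
    and "norm (shift_deriv c w \<eta> x) \<le> enn2real (U x)"
    and "norm (shift_quot c w j \<eta> x) \<le> 2 * enn2real (U x)"
proof -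
  let ?F = "\<lambda>z. w (\<eta>(c := z)) x"
  have c: "norm (\<eta> c) \<le> R - 2" using \<eta> by (simp add: polydisc_def)
  have \<eta>R: "\<eta> \<in> polydisc R" using polydisc_mono[OF \<eta>] by simp
  have hol: "?F holomorphic_on ball 0 R" by (rule translatableD(4)[OF w \<eta>R fin])
  have bd: "norm (?F z) \<le> enn2real (U x)" if "z \<in> ball 0 R" for z
  proof -
    have "ennreal (norm (?F z)) \<le> U x" using that by (intro translatableD(3)[OF w] polydisc_upd \<eta>R) auto
    then have "ennreal (norm (?F z)) \<le> ennreal (enn2real (U x))" using fin by simp
    then show ?thesis by simp
  qed
  have sub: "ball z r \<subseteq> ball 0 R" if "norm z + r \<le> R" for z :: complex and r
  proof
    fix v assume "v \<in> ball z r"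
    then have "norm v < norm z + r" using norm_triangle_ineq2[of v z] by (simp add: dist_norm norm_minus_commute)
    then show "v \<in> ball 0 R" using that by simp
  qed
  have d2: "norm (deriv ?F z) \<le> 2 * enn2real (U x) / r" if "norm z + r \<le> R" "0 < r" for z r
    using sub[OF that(1)] that(2) by (intro holomorphic_deriv_bound holomorphic_on_subset[OF hol] bd) auto
  have df: "(?F has_field_derivative deriv ?F z) (at z)" if "norm z < R" for z
    by (rule holomorphic_derivI[OF hol open_ball]) (use that in simp)
  have lim: "(\<lambda>j. shift_quot c w j \<eta> x) \<longlonglongrightarrow> deriv ?F (\<eta> c)"
  proof -
    have h: "(\<lambda>j. complex_of_real (hstep j)) \<longlonglongrightarrow> 0" using tendsto_of_real[OF hstep_lim, where 'a=complex] by simp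
    have "((\<lambda>h. (?F (\<eta> c + h) - ?F (\<eta> c)) / h) \<longlongrightarrow> deriv ?F (\<eta> c)) (at 0)"
      using df[of "\<eta> c"] c by (simp add: DERIV_def)
    then have "((\<lambda>h. (?F (\<eta> c + h) - ?F (\<eta> c)) / h) \<circ> (\<lambda>j. complex_of_real (hstep j))) \<longlonglongrightarrow> deriv ?F (\<eta> c)"
      unfolding tendsto_at_iff_sequentially using h hstep(1) by (auto simp: less_imp_neq[symmetric])
    then show ?thesis by (simp add: shift_quot_def o_def)
  qed
  then show "(\<lambda>j. shift_quot c w j \<eta> x) \<longlonglongrightarrow> shift_deriv c w \<eta> x"
    by (simp add: shift_deriv_def limI)
  have "shift_deriv c w \<eta> x = deriv ?F (\<eta> c)" using lim by (simp add: shift_deriv_def limI)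
  then show "norm (shift_deriv c w \<eta> x) \<le> enn2real (U x)" using d2[of "\<eta> c" 2] c by simp
  show "norm (shift_quot c w j \<eta> x) \<le> 2 * enn2real (U x)"
  proof -
    let ?h = "complex_of_real (hstep j)"
    have nh: "norm ?h = hstep j" using hstep(1)[of j] by simp
    have "norm (?F (\<eta> c + ?h) - ?F (\<eta> c)) \<le> 2 * enn2real (U x) * norm (\<eta> c + ?h - \<eta> c)"
    proof (rule field_differentiable_bound[where S="cball (\<eta> c) (hstep j)" and f'="deriv ?F"])
      fix z assume "z \<in> cball (\<eta> c) (hstep j)"
      then have z: "norm z \<le> R - 1"
        using c hstep(2)[of j] norm_triangle_ineq2[of z "\<eta> c"] by (simp add: dist_norm norm_minus_commute)
      then show "norm (deriv ?F z) \<le> 2 * enn2real (U x)" using d2[of z 1] by simp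
      show "(?F has_field_derivative deriv ?F z) (at z within cball (\<eta> c) (hstep j))"
        by (rule has_field_derivative_at_within[OF df]) (use z in simp)
    qed (use hstep(1)[of j] in \<open>auto simp: dist_norm\<close>)
    then show ?thesis using hstep(1)[of j] nh by (simp add: shift_quot_def norm_divide pos_divide_le_eq)
  qed
qed

text \<open>The class reproduces itself with a smaller radius and the same majorant, so derivatives
  can be iterated. Holomorphy of the derivative follows from that of the quotients, which are
  bounded and converge pointwise.\<close>

lemma shift_deriv_translatable:
  assumes w: "translatable R g U w"
  shows "translatable (R - 2) g U (shift_deriv c w)"
  unfolding translatable_def
proof (intro conjI allI ballI impI)
  have [measurable]: "w \<eta> \<in> borel_measurable borel" for \<eta> by (rule translatableD(1)[OF w])
  show "shift_deriv c w \<eta> \<in> borel_measurable borel" for \<eta>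
    unfolding shift_deriv_def shift_quot_def by measurable
  fix \<omega> e x
  have "(\<lambda>l. \<omega> l + complex_of_real (e $ l))(c := \<omega> c + complex_of_real (e $ c) + h) = (\<lambda>l. fun_upd \<omega> c (\<omega> c + h) l + complex_of_real (e $ l))" for h
    by (auto simp: fun_eq_iff)
  then show "shift_deriv c w (\<lambda>l. \<omega> l + complex_of_real (e $ l)) x = shift_deriv c w \<omega> (x + g *\<^sub>R e)"
    unfolding shift_deriv_def shift_quot_def by (simp only: translatableD(2)[OF w])
next
  fix \<eta> :: "3 \<Rightarrow> complex" and x :: "real^3" assume \<eta>: "\<eta> \<in> polydisc (R - 2)"
  show "ennreal (norm (shift_deriv c w \<eta> x)) \<le> U x"
  proof (cases "U x < \<top>")
    case True
    have "ennreal (norm (shift_deriv c w \<eta> x)) \<le> ennreal (enn2real (U x))"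
      by (rule ennreal_leI[OF shift_deriv_props(2)[OF w \<eta> True]])
    then show ?thesis using True by simp
  qed (simp add: less_top[symmetric])
next
  fix \<eta> :: "3 \<Rightarrow> complex" and x :: "real^3" and d assume \<eta>: "\<eta> \<in> polydisc (R - 2)" and fin: "U x < \<top>"
  have up: "\<eta>(d := z) \<in> polydisc (R - 2)" if "z \<in> ball 0 (R - 2)" for z
    using that by (intro polydisc_upd \<eta>) auto
  have \<eta>R: "\<eta> \<in> polydisc R" using polydisc_mono[OF \<eta>] by simp
  have hol: "(\<lambda>z. w (\<eta>(d := z)) x) holomorphic_on ball 0 (R - 2)"
    by (rule holomorphic_on_subset[OF translatableD(4)[OF w \<eta>R fin]]) auto
  have hol': "(\<lambda>z. w ((\<eta>(d := z))(c := (\<eta>(d := z)) c + complex_of_real (hstep j))) x) holomorphic_on ball 0 (R - 2)" for j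
  proof (cases "d = c")
    case True
    \<comment> \<open>In the differentiated coordinate the step moves the smaller disc by at most 1,
      so it stays inside the larger one.\<close>
    have "((\<lambda>z. w (\<eta>(c := z)) x) \<circ> (\<lambda>z. z + complex_of_real (hstep j))) holomorphic_on ball 0 (R - 2)"
    proof (rule holomorphic_on_compose_gen[where t="ball 0 R"])
      show "(\<lambda>z. w (\<eta>(c := z)) x) holomorphic_on ball 0 R" by (rule translatableD(4)[OF w \<eta>R fin])
      show "(\<lambda>z. z + complex_of_real (hstep j)) ` ball 0 (R - 2) \<subseteq> ball 0 R"
      proof (intro image_subsetI)
        fix z :: complex assume "z \<in> ball 0 (R - 2)"
        then show "z + complex_of_real (hstep j) \<in> ball 0 R"
          using norm_triangle_ineq[of z "complex_of_real (hstep j)"] hstep[of j] by simp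
      qed
    qed (intro holomorphic_intros)
    then show ?thesis using True by (simp add: o_def)
  next
    case False
    let ?\<eta> = "\<eta>(c := \<eta> c + complex_of_real (hstep j))"
    have "norm (\<eta> c) \<le> R - 2" using \<eta> by (simp add: polydisc_def)
    then have "norm (\<eta> c + complex_of_real (hstep j)) \<le> R"
      using norm_triangle_ineq[of "\<eta> c" "complex_of_real (hstep j)"] hstep[of j] by simp
    then have "?\<eta> \<in> polydisc R" by (intro polydisc_upd \<eta>R)
    then have "(\<lambda>z. w (?\<eta>(d := z)) x) holomorphic_on ball 0 R" by (rule translatableD(4)[OF w _ fin])
    then show ?thesis using False by (auto simp: fun_upd_twist elim!: holomorphic_on_subset)
  qed
  show "(\<lambda>z. shift_deriv c w (\<eta>(d := z)) x) holomorphic_on ball 0 (R - 2)"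
  proof (rule holomorphic_pointwise_limit[OF open_ball])
    show "(\<lambda>z. shift_quot c w j (\<eta>(d := z)) x) holomorphic_on ball 0 (R - 2)" for j
      unfolding shift_quot_def using hstep(1)[of j] by (intro holomorphic_intros hol hol') auto
    show "norm (shift_quot c w j (\<eta>(d := z)) x) \<le> 2 * enn2real (U x)" if "z \<in> ball 0 (R - 2)" for j z
      by (rule shift_deriv_props(3)[OF w up[OF that] fin])
    show "(\<lambda>j. shift_quot c w j (\<eta>(d := z)) x) \<longlonglongrightarrow> shift_deriv c w (\<eta>(d := z)) x" if "z \<in> ball 0 (R - 2)" for z
      by (rule shift_deriv_props(1)[OF w up[OF that] fin])
  qed
qed

section \<open>Elementary properties of test functions\<close>

lemma iter_partial_append: "iter_partial js (iter_partial is \<phi>) = iter_partial (js @ is) \<phi>"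
  by (induction js) auto

lemma test_function_support:
  assumes "test_function \<phi>"
  shows "\<exists>r>0. \<forall>x. \<phi> x \<noteq> 0 \<longrightarrow> norm x \<le> r"
proof -
  have "bounded {x. \<phi> x \<noteq> 0}" using assms by (simp add: test_function_def)
  then show ?thesis unfolding bounded_pos by blast
qed

lemma test_function_differentiable:
  assumes "test_function \<phi>"
  shows "(\<phi> has_derivative frechet_derivative \<phi> (at x)) (at x)"
proof -
  have "iter_partial [] \<phi> differentiable (at x)" using assms unfolding test_function_def by blast
  then show ?thesis by (simp add: frechet_derivative_works)
qed

lemma partial_eq_0:
  assumes \<phi>: "test_function \<phi>" and r: "\<And>x. \<phi> x \<noteq> 0 \<Longrightarrow> norm x \<le> r" and x: "r < norm x"
  shows "iter_partial [c] \<phi> x = 0"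
proof -
  have "(\<phi> has_derivative (\<lambda>_. 0)) (at x)"
  proof (rule has_derivative_transform_within_open[OF has_derivative_const[of 0]])
    show "open (- cball 0 r)" by auto
    show "\<And>y. y \<in> - cball 0 r \<Longrightarrow> 0 = \<phi> y" using r by force
  qed (use x in auto)
  then have "frechet_derivative \<phi> (at x) = (\<lambda>_. 0)"
    using frechet_derivative_at by metis
  then show ?thesis by simp
qed

lemma test_function_partial:
  assumes \<phi>: "test_function \<phi>"
  shows "test_function (iter_partial [c] \<phi>)"
proof -
  obtain r where r: "0 < r" "\<And>x. \<phi> x \<noteq> 0 \<Longrightarrow> norm x \<le> r" using test_function_support[OF \<phi>] by blast
  have "norm x \<le> r" if "iter_partial [c] \<phi> x \<noteq> 0" for x
    using partial_eq_0[OF \<phi> r(2), of x c] that by (cases "norm x \<le> r") auto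
  then have "bounded {x. iter_partial [c] \<phi> x \<noteq> 0}" unfolding bounded_iff by blast
  then show ?thesis
    using \<phi> iter_partial_append[of _ "[c]" \<phi>] by (simp add: test_function_def del: iter_partial.simps)
qed

lemma test_function_iter_partial: "test_function \<phi> \<Longrightarrow> test_function (iter_partial is \<phi>)"
proof (induction "is")
  case (Cons i "is")
  then show ?case using test_function_partial[of "iter_partial is \<phi>" i] by simp
qed simp

lemma test_function_continuous:
  assumes "test_function \<phi>"
  shows "continuous_on UNIV \<phi>"
  by (rule continuous_at_imp_continuous_on)
    (intro ballI has_derivative_continuous[OF test_function_differentiable[OF assms]])

lemma test_function_measurable: "test_function \<phi> \<Longrightarrow> \<phi> \<in> borel_measurable borel"
  by (intro borel_measurable_continuous_onI test_function_continuous)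

lemma test_function_bounded:
  assumes \<phi>: "test_function \<phi>"
  shows "\<exists>b>0. \<forall>x. norm (\<phi> x) \<le> b"
proof -
  obtain r where r: "0 < r" "\<And>x. \<phi> x \<noteq> 0 \<Longrightarrow> norm x \<le> r" using test_function_support[OF \<phi>] by blast
  have "compact (\<phi> ` cball 0 r)"
    by (rule compact_continuous_image[OF continuous_on_subset[OF test_function_continuous[OF \<phi>]]]) auto
  then obtain b where b: "0 < b" "\<And>y. y \<in> \<phi> ` cball 0 r \<Longrightarrow> norm y \<le> b"
    using compact_imp_bounded bounded_pos by metis
  have "norm (\<phi> x) \<le> b" for x
    using b r(2)[of x] by (cases "\<phi> x = 0") auto
  then show ?thesis using b(1) by blast
qed

lemma test_function_line_deriv:
  assumes \<phi>: "test_function \<phi>"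
  shows "((\<lambda>h. \<phi> (x + h *\<^sub>R axis c 1)) has_field_derivative iter_partial [c] \<phi> (x + h *\<^sub>R axis c 1)) (at h)"
proof -
  have "((\<lambda>h. x + h *\<^sub>R axis c 1) has_derivative (\<lambda>k. k *\<^sub>R axis c 1)) (at h)"
    by (auto intro!: derivative_eq_intros)
  from has_derivative_compose[OF this test_function_differentiable[OF \<phi>]]
  have "((\<lambda>h. \<phi> (x + h *\<^sub>R axis c 1)) has_derivative (\<lambda>k. frechet_derivative \<phi> (at (x + h *\<^sub>R axis c 1)) (k *\<^sub>R axis c 1))) (at h)" .
  moreover have "frechet_derivative \<phi> (at (x + h *\<^sub>R axis c 1)) (k *\<^sub>R axis c 1) = iter_partial [c] \<phi> (x + h *\<^sub>R axis c 1) * k" for k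
    using linear_cmul[OF has_derivative_linear[OF test_function_differentiable[OF \<phi>]]] by (simp add: mult.commute)
  ultimately show ?thesis unfolding has_field_derivative_def by (simp del: iter_partial.simps)
qed

text \<open>Bounds the difference quotients uniformly in the step, as dominated convergence
  requires.\<close>

lemma test_function_lipschitz:
  assumes \<phi>: "test_function \<phi>"
  shows "\<exists>b>0. \<forall>x h. \<bar>\<phi> (x + h *\<^sub>R axis c 1) - \<phi> x\<bar> \<le> b * \<bar>h\<bar>"
proof -
  obtain b where b: "0 < b" "\<And>x. norm (iter_partial [c] \<phi> x) \<le> b"
    using test_function_bounded[OF test_function_partial[OF \<phi>]] by blast
  have "\<bar>\<phi> (x + h *\<^sub>R axis c 1) - \<phi> x\<bar> \<le> b * \<bar>h\<bar>" for x h
    using field_differentiable_bound[of UNIV "\<lambda>h. \<phi> (x + h *\<^sub>R axis c 1)" "\<lambda>h. iter_partial [c] \<phi> (x + h *\<^sub>R axis c 1)" b h 0]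
      test_function_line_deriv[OF \<phi>] b(2) by simp
  then show ?thesis using b(1) by blast
qed

text \<open>Local integrability of the majorant; on a ball it is the dominating function in the
  limits below.\<close>

definition locally_finite :: "(real^3 \<Rightarrow> ennreal) \<Rightarrow> bool" where
  "locally_finite U \<longleftrightarrow> U \<in> borel_measurable borel \<and> (\<forall>r. (\<integral>\<^sup>+x. U x * indicator (cball 0 r) x \<partial>lborel) < \<top>)"

lemma locally_finite_AE:
  assumes "locally_finite U"
  shows "AE x in lborel. U x < \<top>"
proof -
  have [measurable]: "U \<in> borel_measurable borel" using assms by (simp add: locally_finite_def)
  have [measurable]: "cball (0::real^3) r \<in> sets borel" for r by simp
  have "AE x in lborel. U x * indicator (cball 0 (real n)) x \<noteq> \<infinity>" for n
  proof (rule nn_integral_PInf_AE)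
    show "(\<integral>\<^sup>+x. U x * indicator (cball 0 (real n)) x \<partial>lborel) \<noteq> \<infinity>"
      using assms by (auto simp: locally_finite_def less_top)
  qed measurable
  then have "AE x in lborel. \<forall>n. U x * indicator (cball 0 (real n)) x \<noteq> \<infinity>" by (simp add: AE_all_countable)
  then show ?thesis
  proof eventually_elim
    fix x assume h: "\<forall>n. U x * indicator (cball 0 (real n)) x \<noteq> \<infinity>"
    obtain n where "norm x \<le> real n" using real_arch_simple by blast
    then show "U x < \<top>" using h[rule_format, of n] by (simp add: less_top)
  qed
qed

lemma locally_finite_integrable:
  assumes U: "locally_finite U"
  shows "integrable lborel (\<lambda>x. C * enn2real (U x) * indicator (cball 0 r) x)"
proof -
  have [measurable]: "U \<in> borel_measurable borel" using assms by (simp add: locally_finite_def)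
  have [measurable]: "cball (0::real^3) r \<in> sets borel" for r by simp
  have "(\<integral>\<^sup>+x. ennreal (norm (enn2real (U x) * indicator (cball 0 r) x)) \<partial>lborel) \<le> (\<integral>\<^sup>+x. U x * indicator (cball 0 r) x \<partial>lborel)"
    by (intro nn_integral_mono) (auto simp: indicator_def ennreal_enn2real_if abs_mult)
  also have "\<dots> < \<infinity>" using U by (simp add: locally_finite_def)
  finally have "integrable lborel (\<lambda>x. enn2real (U x) * indicator (cball 0 r) x)"
    by (auto simp: integrable_iff_bounded)
  then show ?thesis using integrable_mult_right[of C lborel "\<lambda>x. enn2real (U x) * indicator (cball 0 r) x"] by (simp add: mult.assoc)
qed

lemma norm_le_enn2real: "ennreal (norm z) \<le> u \<Longrightarrow> u < \<top> \<Longrightarrow> norm z \<le> enn2real u"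
  by (metis ennreal_enn2real ennreal_le_iff enn2real_nonneg)

text \<open>A step \<open>h\<close> in coordinate \<open>c\<close> of the shift is a step
  \<open>g * h\<close> in space. Translation invariance moves the difference quotient from
  \<open>w\<close> to the test function, and dominated convergence on both sides turns quotients
  into derivatives; the scaling by \<open>g\<close> appears as \<open>1 / g\<close>.\<close>

lemma weak_partial_step:
  assumes w: "translatable R g U w" and R: "2 \<le> R" and g: "0 < g" and U: "locally_finite U" and \<psi>: "test_function \<psi>"
  shows "(\<integral>x. iter_partial [c] \<psi> x *\<^sub>R w (\<lambda>_. 0) x \<partial>lborel) = - (1 / g) *\<^sub>R (\<integral>x. \<psi> x *\<^sub>R shift_deriv c w (\<lambda>_. 0) x \<partial>lborel)"
proof -
  let ?f = "w (\<lambda>_. 0)"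
  let ?e = "axis c 1 :: real^3"
  have [measurable]: "w \<eta> \<in> borel_measurable borel" for \<eta> by (rule translatableD(1)[OF w])
  have [measurable]: "shift_deriv c w \<eta> \<in> borel_measurable borel" for \<eta>
    by (rule translatableD(1)[OF shift_deriv_translatable[OF w]])
  have [measurable]: "\<psi> \<in> borel_measurable borel" by (rule test_function_measurable[OF \<psi>])
  have [measurable]: "iter_partial [c] \<psi> \<in> borel_measurable borel"
    by (intro test_function_measurable test_function_partial \<psi>)
  have 0: "(\<lambda>_. 0) \<in> polydisc (R - 2)" "(\<lambda>_. 0) \<in> polydisc R" using R by (auto simp: polydisc_def)
  obtain r where r: "0 < r" "\<And>x. \<psi> x \<noteq> 0 \<Longrightarrow> norm x \<le> r" using test_function_support[OF \<psi>] by blast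
  obtain b where b: "0 < b" "\<And>x. norm (\<psi> x) \<le> b" using test_function_bounded[OF \<psi>] by blast
  obtain l where l: "0 < l" "\<And>x h. \<bar>\<psi> (x + h *\<^sub>R ?e) - \<psi> x\<bar> \<le> l * \<bar>h\<bar>" using test_function_lipschitz[OF \<psi>] by blast
  note AE = locally_finite_AE[OF U]
  let ?h = "\<lambda>j. g * hstep j"
  have fU: "norm (?f x) \<le> enn2real (U x)" if "U x < \<top>" for x
    using translatableD(3)[OF w 0(2)] that by (rule norm_le_enn2real)
  have int_f: "integrable lborel (\<lambda>x. \<psi> x *\<^sub>R ?f x)"
  proof (rule Bochner_Integration.integrable_bound[OF locally_finite_integrable[OF U, of b r]])
    show "AE x in lborel. norm (\<psi> x *\<^sub>R ?f x) \<le> norm (b * enn2real (U x) * indicator (cball 0 r) x)"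
      using AE
    proof eventually_elim
      fix x assume "U x < \<top>"
      then show "norm (\<psi> x *\<^sub>R ?f x) \<le> norm (b * enn2real (U x) * indicator (cball 0 r) x)"
        using fU[of x] b r(2)[of x] by (cases "\<psi> x = 0") (auto intro!: mult_mono simp: abs_mult)
    qed
  qed measurable
  have shift: "w ((\<lambda>_. 0)(c := 0 + complex_of_real (hstep j))) x = ?f (x + ?h j *\<^sub>R ?e)" for j x
  proof -
    have "((\<lambda>_. 0)(c := 0 + complex_of_real (hstep j))) = (\<lambda>l. 0 + complex_of_real ((hstep j *\<^sub>R ?e) $ l))"
      by (auto simp: fun_eq_iff axis_def)
    then show ?thesis using translatableD(2)[OF w, of "\<lambda>_. 0" "hstep j *\<^sub>R ?e" x] by simp
  qed
  have A: "(\<lambda>j. \<integral>x. \<psi> x *\<^sub>R shift_quot c w j (\<lambda>_. 0) x \<partial>lborel) \<longlonglongrightarrow> (\<integral>x. \<psi> x *\<^sub>R shift_deriv c w (\<lambda>_. 0) x \<partial>lborel)"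
  proof (rule integral_dominated_convergence[OF _ _ locally_finite_integrable[OF U, of "b * 2" r]])
    show "AE x in lborel. (\<lambda>j. \<psi> x *\<^sub>R shift_quot c w j (\<lambda>_. 0) x) \<longlonglongrightarrow> \<psi> x *\<^sub>R shift_deriv c w (\<lambda>_. 0) x"
      using AE by eventually_elim (intro tendsto_intros shift_deriv_props[OF w 0(1)])
    show "AE x in lborel. norm (\<psi> x *\<^sub>R shift_quot c w j (\<lambda>_. 0) x) \<le> b * 2 * enn2real (U x) * indicator (cball 0 r) x" for j
      using AE
    proof eventually_elim
      fix x assume "U x < \<top>"
      then have "norm (\<psi> x) * norm (shift_quot c w j (\<lambda>_. 0) x) \<le> b * (2 * enn2real (U x))"
        using b by (intro mult_mono b shift_deriv_props[OF w 0(1)]) auto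
      then show "norm (\<psi> x *\<^sub>R shift_quot c w j (\<lambda>_. 0) x) \<le> b * 2 * enn2real (U x) * indicator (cball 0 r) x"
        using r(2)[of x] by (cases "\<psi> x = 0") auto
    qed
  qed (unfold shift_quot_def, measurable)
  let ?q = "\<lambda>j x. (\<psi> (x + (- ?h j) *\<^sub>R ?e) - \<psi> x) / hstep j"
  \<comment> \<open>The discrete integration by parts: the step passes to the test function with the
    opposite sign.\<close>
  have eq: "(\<integral>x. \<psi> x *\<^sub>R shift_quot c w j (\<lambda>_. 0) x \<partial>lborel) = (\<integral>x. ?q j x *\<^sub>R ?f x \<partial>lborel)" for j
  proof -
    have i1: "integrable lborel (\<lambda>x. \<psi> (x + (- ?h j) *\<^sub>R ?e) *\<^sub>R ?f x)"
    \<comment> \<open>Spatial steps have length at most \<open>g\<close> because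
      \<open>hstep\<close> is at most 1, so all shifted supports lie in one ball.\<close>
    proof (rule Bochner_Integration.integrable_bound[OF locally_finite_integrable[OF U, of b "r + g"]])
      show "AE x in lborel. norm (\<psi> (x + (- ?h j) *\<^sub>R ?e) *\<^sub>R ?f x) \<le> norm (b * enn2real (U x) * indicator (cball 0 (r + g)) x)"
        using AE
      proof eventually_elim
        fix x assume u: "U x < \<top>"
        show "norm (\<psi> (x + (- ?h j) *\<^sub>R ?e) *\<^sub>R ?f x) \<le> norm (b * enn2real (U x) * indicator (cball 0 (r + g)) x)"
        proof (cases "\<psi> (x + (- ?h j) *\<^sub>R ?e) = 0")
          case False
          then have "norm (x + (- ?h j) *\<^sub>R ?e) \<le> r" by (rule r)
          moreover have "norm ((- ?h j) *\<^sub>R ?e) \<le> g" using g hstep[of j] by (simp add: abs_mult mult_left_le)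
          ultimately have "norm x \<le> r + g" using norm_triangle_ineq2[of x "- ((- ?h j) *\<^sub>R ?e)"] by simp
          then show ?thesis using fU[OF u] b by (auto intro!: mult_mono simp: abs_mult)
        qed simp
      qed
    qed measurable
    have i2: "(\<integral>x. \<psi> (x + (- ?h j) *\<^sub>R ?e) *\<^sub>R ?f x \<partial>lborel) = (\<integral>x. \<psi> x *\<^sub>R ?f (x + ?h j *\<^sub>R ?e) \<partial>lborel)"
      using integral_lborel_shift[of "\<lambda>x. \<psi> (x + (- ?h j) *\<^sub>R ?e) *\<^sub>R ?f x" "?h j *\<^sub>R ?e"] by simp
    have i3: "integrable lborel (\<lambda>x. \<psi> x *\<^sub>R ?f (x + ?h j *\<^sub>R ?e))"
      using integrable_lborel_shift[OF i1, of "?h j *\<^sub>R ?e"] by simp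
    have "(\<integral>x. \<psi> x *\<^sub>R shift_quot c w j (\<lambda>_. 0) x \<partial>lborel) = (\<integral>x. (1 / hstep j) *\<^sub>R (\<psi> x *\<^sub>R ?f (x + ?h j *\<^sub>R ?e) - \<psi> x *\<^sub>R ?f x) \<partial>lborel)"
      unfolding shift_quot_def shift
      by (intro Bochner_Integration.integral_cong) (auto simp: scaleR_conv_of_real field_simps)
    also have "\<dots> = (1 / hstep j) *\<^sub>R ((\<integral>x. \<psi> x *\<^sub>R ?f (x + ?h j *\<^sub>R ?e) \<partial>lborel) - (\<integral>x. \<psi> x *\<^sub>R ?f x \<partial>lborel))"
      by (simp only: integral_scaleR_right Bochner_Integration.integral_diff[OF i3 int_f])
    also have "\<dots> = (1 / hstep j) *\<^sub>R (\<integral>x. \<psi> (x + (- ?h j) *\<^sub>R ?e) *\<^sub>R ?f x - \<psi> x *\<^sub>R ?f x \<partial>lborel)"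
      by (simp only: i2[symmetric] Bochner_Integration.integral_diff[OF i1 int_f])
    also have "\<dots> = (\<integral>x. ?q j x *\<^sub>R ?f x \<partial>lborel)"
      unfolding integral_scaleR_right[symmetric]
      by (intro Bochner_Integration.integral_cong) (auto simp: scaleR_left_diff_distrib diff_divide_distrib scaleR_right_diff_distrib)
    finally show ?thesis .
  qed
  have B: "(\<lambda>j. \<integral>x. ?q j x *\<^sub>R ?f x \<partial>lborel) \<longlonglongrightarrow> (\<integral>x. (- g * iter_partial [c] \<psi> x) *\<^sub>R ?f x \<partial>lborel)"
  proof (rule integral_dominated_convergence[OF _ _ locally_finite_integrable[OF U, of "l * g" "r + g"]])
    have "(\<lambda>j. ?q j x) \<longlonglongrightarrow> - g * iter_partial [c] \<psi> x" for x
    proof -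
      have "((\<lambda>h. (\<psi> (x + (0 + h) *\<^sub>R ?e) - \<psi> (x + 0 *\<^sub>R ?e)) / h) \<longlongrightarrow> iter_partial [c] \<psi> (x + 0 *\<^sub>R ?e)) (at 0)"
        using test_function_line_deriv[OF \<psi>, of x c 0] unfolding DERIV_def .
      moreover have "filterlim (\<lambda>j. - ?h j) (at 0) sequentially"
        unfolding filterlim_at using tendsto_mult[OF tendsto_const hstep_lim, of "- g"] g hstep(1)
        by (auto simp: less_imp_neq[symmetric])
      ultimately have "(\<lambda>j. (\<psi> (x + (0 + - ?h j) *\<^sub>R ?e) - \<psi> (x + 0 *\<^sub>R ?e)) / (- ?h j)) \<longlonglongrightarrow> iter_partial [c] \<psi> (x + 0 *\<^sub>R ?e)"
        by (rule filterlim_compose)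
      from tendsto_mult_left[OF this, of "- g"] show ?thesis
        using g hstep(1) by (simp add: less_imp_neq[symmetric] del: iter_partial.simps)
    qed
    then show "AE x in lborel. (\<lambda>j. ?q j x *\<^sub>R ?f x) \<longlonglongrightarrow> (- g * iter_partial [c] \<psi> x) *\<^sub>R ?f x"
      by (intro AE_I2 tendsto_intros)
    show "AE x in lborel. norm (?q j x *\<^sub>R ?f x) \<le> l * g * enn2real (U x) * indicator (cball 0 (r + g)) x" for j
      using AE
    proof eventually_elim
      fix x assume u: "U x < \<top>"
      have "\<bar>?q j x\<bar> \<le> l * g * indicator (cball 0 (r + g)) x"
      proof (cases "norm x \<le> r + g")
        case True
        have "\<bar>\<psi> (x + (- ?h j) *\<^sub>R ?e) - \<psi> x\<bar> \<le> l * \<bar>- ?h j\<bar>" by (rule l)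
        then show ?thesis using True g hstep(1)[of j] by (simp add: abs_mult pos_divide_le_eq mult.assoc)
      next
        case False
        have "norm ((- ?h j) *\<^sub>R ?e) \<le> g" using g hstep[of j] by (simp add: abs_mult mult_left_le)
        then have "\<not> norm (x + (- ?h j) *\<^sub>R ?e) \<le> r" using False norm_triangle_ineq2[of x "- ((- ?h j) *\<^sub>R ?e)"] by simp
        then have "\<psi> (x + (- ?h j) *\<^sub>R ?e) = 0" "\<psi> x = 0" using r(2)[of x] r(2)[of "x + (- ?h j) *\<^sub>R ?e"] False g by auto
        then show ?thesis using l g by simp
      qed
      then have "\<bar>?q j x\<bar> * norm (?f x) \<le> (l * g * indicator (cball 0 (r + g)) x) * enn2real (U x)"
        using l g by (intro mult_mono fU u) auto
      then show "norm (?q j x *\<^sub>R ?f x) \<le> l * g * enn2real (U x) * indicator (cball 0 (r + g)) x"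
        by (simp only: norm_scaleR mult_ac)
    qed
  qed measurable
  have "(\<integral>x. (- g * iter_partial [c] \<psi> x) *\<^sub>R ?f x \<partial>lborel) = (\<integral>x. \<psi> x *\<^sub>R shift_deriv c w (\<lambda>_. 0) x \<partial>lborel)"
    using B A unfolding eq by (rule LIMSEQ_unique)
  then have "- g *\<^sub>R (\<integral>x. iter_partial [c] \<psi> x *\<^sub>R ?f x \<partial>lborel) = (\<integral>x. \<psi> x *\<^sub>R shift_deriv c w (\<lambda>_. 0) x \<partial>lborel)"
    by (simp only: scaleR_scaleR[symmetric] integral_scaleR_right)
  from arg_cong[OF this, of "\<lambda>v. - (1 / g) *\<^sub>R v"] show ?thesis using g by simp
qed

text \<open>The head of the list acts on \<open>w\<close> first. This matches
  \<open>iter_partial\<close>, where the head is the outermost derivative and thus the first to be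
  moved off the test function.\<close>

primrec shift_derivs :: "3 list \<Rightarrow> ((3 \<Rightarrow> complex) \<Rightarrow> real^3 \<Rightarrow> complex) \<Rightarrow> (3 \<Rightarrow> complex) \<Rightarrow> real^3 \<Rightarrow> complex" where
  "shift_derivs [] w = w"
| "shift_derivs (i # is) w = shift_derivs is (shift_deriv i w)"

lemma shift_derivs_translatable:
  "translatable R g U w \<Longrightarrow> translatable (R - 2 * real (length is)) g U (shift_derivs is w)"
proof (induction "is" arbitrary: R w)
  case (Cons i "is")
  then show ?case using Cons.IH[OF shift_deriv_translatable[OF Cons.prems, of i]] by (simp add: algebra_simps)
qed simp

lemma weak_partial_shift_derivs:
  assumes g: "0 < g" and U: "locally_finite U" and \<psi>: "test_function \<psi>"
  shows "translatable R g U w \<Longrightarrow> 2 * real (length is) \<le> R \<Longrightarrow>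
    (\<integral>x. iter_partial is \<psi> x *\<^sub>R w (\<lambda>_. 0) x \<partial>lborel)
      = (- 1) ^ length is *\<^sub>R (\<integral>x. \<psi> x *\<^sub>R ((1 / g) ^ length is *\<^sub>R shift_derivs is w (\<lambda>_. 0) x) \<partial>lborel)"
proof (induction "is" arbitrary: R w)
  case (Cons i "is")
  have "(\<integral>x. iter_partial (i # is) \<psi> x *\<^sub>R w (\<lambda>_. 0) x \<partial>lborel)
    = - (1 / g) *\<^sub>R (\<integral>x. iter_partial is \<psi> x *\<^sub>R shift_deriv i w (\<lambda>_. 0) x \<partial>lborel)"
    using weak_partial_step[OF Cons.prems(1) _ g U test_function_iter_partial[OF \<psi>, of "is"], where c = i] Cons.prems(2) by simp
  also have "\<dots> = - (1 / g) *\<^sub>R (- 1) ^ length is *\<^sub>R (\<integral>x. \<psi> x *\<^sub>R ((1 / g) ^ length is *\<^sub>R shift_derivs is (shift_deriv i w) (\<lambda>_. 0) x) \<partial>lborel)"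
    using Cons.prems(2) by (subst Cons.IH[OF shift_deriv_translatable[OF Cons.prems(1)]]) auto
  also have "\<dots> = (- 1) ^ length (i # is) *\<^sub>R (1 / g) *\<^sub>R (\<integral>x. \<psi> x *\<^sub>R ((1 / g) ^ length is *\<^sub>R shift_derivs is (shift_deriv i w) (\<lambda>_. 0) x) \<partial>lborel)"
    by (simp del: scaleR_left.minus) 
  finally show ?case by (simp add: integral_scaleR_right[symmetric] scaleR_left_commute mult.commute del: integral_scaleR_right)
qed simp

text \<open>For every \<open>x\<close> in the cube of half-width \<open>g\<close> around
  \<open>y\<close>, the value at \<open>y\<close> is a value at \<open>x\<close> for a real shift
  with entries at most 1, hence below \<open>U x\<close>. Averaging the \<open>p\<close>-th power
  over the cube turns the integral bound into a pointwise one.\<close>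

lemma translatable_sup_bound:
  assumes w: "translatable R g U w" and R: "1 \<le> R" and g: "0 < g" and q: "1 \<le> q" and U: "Lq_bound q U Q" and Q: "0 < Q"
  shows "norm (w (\<lambda>_. 0) y) \<le> Q * g powr (- three_over q)"
proof -
  have le: "ennreal (norm (w (\<lambda>_. 0) y)) \<le> U x" if x: "x \<in> cbox (y - (\<chi> i. g)) (y + (\<chi> i. g))" for x
  proof -
    let ?e = "(1 / g) *\<^sub>R (y - x)"
    have "\<bar>?e $ l\<bar> \<le> 1" for l
    proof -
      have "y $ l - g \<le> x $ l \<and> x $ l \<le> y $ l + g" using x by (auto simp: mem_box_cart)
      then have "\<bar>y $ l - x $ l\<bar> \<le> g" by auto
      then show ?thesis using g by (simp add: abs_mult)
    qed
    then have "norm (0 + complex_of_real (?e $ l)) \<le> R" for l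
      unfolding add_0 norm_of_real using R by (rule order_trans)
    then have "(\<lambda>l. 0 + complex_of_real (?e $ l)) \<in> polydisc R" unfolding polydisc_def by blast
    from translatableD(3)[OF w this, of x] show ?thesis
      unfolding translatableD(2)[OF w] using g by simp
  qed
  show ?thesis
  proof (cases "q = \<infinity>")
    case True
    have "y \<in> cbox (y - (\<chi> i. g)) (y + (\<chi> i. g))" using g by (auto simp: mem_box_cart)
    then have "ennreal (norm (w (\<lambda>_. 0) y)) \<le> U y" by (rule le)
    also have "\<dots> \<le> ennreal Q" using U True by (simp add: Lq_bound_def)
    finally show ?thesis using Q g True by (simp add: three_over_def)
  next
    case False
    define p where "p = enn2real q"
    have p: "1 \<le> p" using enn2real_ge_1 q False p_def by blast
    let ?n = "norm (w (\<lambda>_. 0) y)"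
    have vol: "emeasure lborel (cbox (y - (\<chi> i. g)) (y + (\<chi> i. g))) = ennreal ((2 * g)^3)"
    proof -
      have "emeasure lborel (cbox (y - (\<chi> i. g)) (y + (\<chi> i. g))) = ennreal (\<Prod>b\<in>Basis. ((y + (\<chi> i. g)) - (y - (\<chi> i. g))) \<bullet> b)"
        using g by (intro emeasure_lborel_cbox) (auto simp: Basis_vec3 inner_axis)
      also have "(\<Prod>b\<in>Basis. ((y + (\<chi> i. g)) - (y - (\<chi> i. g))) \<bullet> b) = (2 * g)^3"
        unfolding prod_Basis_vec3 by (simp add: inner_axis)
      finally show ?thesis .
    qed
    have "ennreal (?n powr p) * ennreal ((2 * g)^3) = (\<integral>\<^sup>+x. ennreal (?n powr p) * indicator (cbox (y - (\<chi> i. g)) (y + (\<chi> i. g))) x \<partial>lborel)"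
      by (simp add: nn_integral_cmult_indicator vol)
    also have "\<dots> \<le> (\<integral>\<^sup>+x. epowr (U x) p \<partial>lborel)"
    proof (rule nn_integral_mono)
      fix x
      show "ennreal (?n powr p) * indicator (cbox (y - (\<chi> i. g)) (y + (\<chi> i. g))) x \<le> epowr (U x) p"
        using epowr_mono[OF le, of x p] p by (auto simp: indicator_def)
    qed
    also have "\<dots> \<le> ennreal (Q powr p)" using U False by (simp add: Lq_bound_def p_def)
    finally have "ennreal (?n powr p * (2 * g)^3) \<le> ennreal (Q powr p)" using g by (simp add: ennreal_mult)
    then have 1: "?n powr p * (2 * g)^3 \<le> Q powr p" by (subst (asm) ennreal_le_iff) auto
    \<comment> \<open>The volume of the cube is \<open>(2 * g)^3\<close>; the factor 8 is given
      away.\<close>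
    have "?n powr p * g^3 \<le> ?n powr p * (2 * g)^3" using g by (intro mult_left_mono power_mono) auto
    then have "?n powr p * g powr 3 \<le> Q powr p" using order_trans[OF _ 1] g by (simp add: powr_numeral)
    then have "?n powr p \<le> Q powr p * g powr (- 3)" using g by (simp add: powr_minus field_simps)
    then have "(?n powr p) powr (1/p) \<le> (Q powr p * g powr (- 3)) powr (1/p)" using p by (intro powr_mono2) auto
    then show ?thesis using p g Q False by (simp add: powr_powr powr_mult three_over_def p_def[symmetric])
  qed
qed

text \<open>For finite exponents, \<open>f powr p2\<close> is at most the pointwise bound to the
  power \<open>p2 - p1\<close> times \<open>f powr p1\<close>.\<close>

lemma Lq_bound_interpolate:
  fixes f :: "real^3 \<Rightarrow> real"
  assumes q: "1 \<le> q1" "q1 \<le> q2" and f: "Lq_bound q1 (\<lambda>x. ennreal (f x)) Q" "\<And>x. 0 \<le> f x" "\<And>x. f x \<le> Q * g powr (- three_over q1)"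
    and Q: "0 < Q" and g: "0 < g" and [measurable]: "f \<in> borel_measurable borel"
  shows "Lq_bound q2 (\<lambda>x. ennreal (f x)) (Q * g powr (three_over q2 - three_over q1))"
proof (cases "q2 = \<infinity>")
  case True
  then show ?thesis using f(3) by (simp add: Lq_bound_def three_over_def ennreal_leI)
next
  case False
  then have fin: "q1 \<noteq> \<infinity>" using q by (metis infinity_ennreal_def top.extremum_uniqueI)
  define p1 p2 where "p1 = enn2real q1" and "p2 = enn2real q2"
  have p: "1 \<le> p1" "p1 \<le> p2" using enn2real_ge_1[OF q(1) fin] enn2real_mono[OF q(2)] False by (auto simp: p1_def p2_def less_top)
  define S where "S = Q * g powr (- (3 / p1))"
  have S: "0 < S" "\<And>x. f x \<le> S" using Q g f(3) fin by (auto simp: S_def three_over_def p1_def)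
  have "(\<integral>\<^sup>+x. epowr (ennreal (f x)) p2 \<partial>lborel) \<le> (\<integral>\<^sup>+x. ennreal (S powr (p2 - p1)) * epowr (ennreal (f x)) p1 \<partial>lborel)"
  proof (rule nn_integral_mono)
    fix x
    have "f x powr p2 = f x powr (p2 - p1) * f x powr p1" using f(2)[of x] by (simp add: powr_add[symmetric])
    also have "\<dots> \<le> S powr (p2 - p1) * f x powr p1" using S f(2) p by (intro mult_right_mono powr_mono2) auto
    finally show "epowr (ennreal (f x)) p2 \<le> ennreal (S powr (p2 - p1)) * epowr (ennreal (f x)) p1"
      using f(2)[of x] by (simp add: ennreal_mult[symmetric] ennreal_leI)
  qed
  also have "\<dots> = ennreal (S powr (p2 - p1)) * (\<integral>\<^sup>+x. epowr (ennreal (f x)) p1 \<partial>lborel)"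
    by (rule nn_integral_cmult) measurable
  also have "\<dots> \<le> ennreal (S powr (p2 - p1)) * ennreal (Q powr p1)"
    using f(1) fin by (intro mult_left_mono) (auto simp: Lq_bound_def p1_def)
  also have "\<dots> = ennreal (S powr (p2 - p1) * Q powr p1)" by (simp add: ennreal_mult)
  also have "S powr (p2 - p1) * Q powr p1 = (Q * g powr (3 / p2 - 3 / p1)) powr p2"
  proof -
    have "S powr (p2 - p1) * Q powr p1 = Q powr (p2 - p1) * Q powr p1 * g powr (- (3 / p1) * (p2 - p1))"
      using Q g by (simp add: S_def powr_mult powr_powr)
    also have "Q powr (p2 - p1) * Q powr p1 = Q powr p2" by (simp add: powr_add[symmetric])
    also have "- (3 / p1) * (p2 - p1) = (3 / p2 - 3 / p1) * p2" using p by (simp add: field_simps)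
    finally show ?thesis using Q g by (simp add: powr_mult powr_powr)
  qed
  finally show ?thesis using False fin by (simp add: Lq_bound_def three_over_def p1_def p2_def)
qed

section \<open>Test functions and weak derivatives of order zero\<close>

text \<open>The classical smooth function that is flat at 0, with the powers of \<open>1 / x\<close>
  that its derivatives produce. Sending \<epsilon> to 0 with \<open>k = 0\<close> recovers the
  indicator of the half-line.\<close>

definition flat :: "nat \<Rightarrow> real \<Rightarrow> real \<Rightarrow> real" where
  "flat k \<epsilon> x = (if 0 < x then exp (- \<epsilon> / x) / x ^ k else 0)"

text \<open>The exponential beats the power: \<open>pow_le_fact_exp\<close> at
  \<open>\<epsilon> / x\<close> with exponent \<open>k + 1\<close>, one more than in
  \<open>flat\<close>, leaves a factor \<open>x\<close>.\<close>

lemma flat_le: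
  assumes \<epsilon>: "0 < \<epsilon>"
  shows "\<bar>flat k \<epsilon> x\<bar> \<le> fact (k + 1) / \<epsilon> ^ (k + 1) * \<bar>x\<bar>"
proof (cases "0 < x")
  case True
  have "(\<epsilon> / x) ^ (k + 1) \<le> fact (k + 1) * exp (\<epsilon> / x)"
    using True \<epsilon> by (intro pow_le_fact_exp) auto
  then have "exp (- \<epsilon> / x) * (\<epsilon> / x) ^ (k + 1) \<le> exp (- \<epsilon> / x) * (fact (k + 1) * exp (\<epsilon> / x))"
    by (rule mult_left_mono) simp
  also have "\<dots> = fact (k + 1) * (exp (- \<epsilon> / x) * exp (\<epsilon> / x))" by (simp only: mult_ac)
  also have "exp (- \<epsilon> / x) * exp (\<epsilon> / x) = 1" by (simp add: exp_add[symmetric])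
  finally have "exp (- \<epsilon> / x) * (\<epsilon> / x) ^ (k + 1) \<le> fact (k + 1)" by simp
  then have "exp (- \<epsilon> / x) * (\<epsilon> / x) ^ (k + 1) * x \<le> fact (k + 1) * x"
    using True by (intro mult_right_mono) auto
  also have "exp (- \<epsilon> / x) * (\<epsilon> / x) ^ (k + 1) * x = (exp (- \<epsilon> / x) / x ^ k) * \<epsilon> ^ (k + 1)"
    using True by (simp add: power_divide)
  finally have "exp (- \<epsilon> / x) / x ^ k \<le> fact (k + 1) * x / \<epsilon> ^ (k + 1)"
    using \<epsilon> by (subst pos_le_divide_eq) auto
  then show ?thesis using True by (simp add: flat_def)
next
  case False
  have "0 \<le> fact (k + 1) / \<epsilon> ^ (k + 1) * \<bar>x\<bar>" using \<epsilon> by (intro mult_nonneg_nonneg divide_nonneg_nonneg) auto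
  then show ?thesis using False by (simp only: flat_def if_False abs_zero)
qed

text \<open>For positive \<open>x\<close> this is the product rule. At 0 the difference quotient of
  \<open>flat k\<close> is \<open>flat (k + 1)\<close>, which tends to 0 by
  \<open>flat_le\<close>.\<close>

lemma DERIV_flat:
  assumes \<epsilon>: "0 < \<epsilon>"
  shows "(flat k \<epsilon> has_real_derivative (- real k * flat (k + 1) \<epsilon> x + \<epsilon> * flat (k + 2) \<epsilon> x)) (at x)"
proof -
  consider "0 < x" | "x < 0" | "x = 0" by linarith
  then show ?thesis
  proof cases
    case 1
    have pos: "flat j \<epsilon> z = exp (- \<epsilon> * inverse z) * inverse z ^ j" if "0 < z" for j z
      using that by (simp add: flat_def divide_inverse power_inverse)
    have "((\<lambda>x. exp (- \<epsilon> * inverse x) * inverse x ^ k) has_real_derivative (- real k * flat (k + 1) \<epsilon> x + \<epsilon> * flat (k + 2) \<epsilon> x)) (at x)"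
      unfolding pos[OF 1]
      by (rule DERIV_cong[OF DERIV_mult[OF DERIV_fun_exp[OF DERIV_cmult[OF DERIV_inverse]] DERIV_power[OF DERIV_inverse]]])
        (use 1 in \<open>cases k; simp add: algebra_simps power2_eq_square\<close>)+
    then show ?thesis
      by (rule has_field_derivative_transform_within_open[where S="{0<..}"]) (use 1 pos in auto)
  next
    case 2
    have "((\<lambda>_. 0) has_real_derivative 0) (at x)" by simp
    then have "(flat k \<epsilon> has_real_derivative 0) (at x)"
      by (rule has_field_derivative_transform_within_open[where S="{..<0}"]) (use 2 in \<open>auto simp: flat_def\<close>)
    then show ?thesis using 2 by (simp add: flat_def)
  next
    case 3
    have 0: "((\<lambda>h::real. fact (k + 2) / \<epsilon> ^ (k + 2) * \<bar>h\<bar>) \<longlongrightarrow> 0) (at 0)"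
      using tendsto_mult_right_zero[OF tendsto_rabs_zero[OF tendsto_ident_at]] .
    have lim: "((\<lambda>h. flat (k + 1) \<epsilon> h) \<longlongrightarrow> 0) (at 0)"
    proof (rule Lim_null_comparison[OF always_eventually 0], intro allI)
      show "norm (flat (k + 1) \<epsilon> h) \<le> fact (k + 2) / \<epsilon> ^ (k + 2) * \<bar>h\<bar>" for h
        using flat_le[OF \<epsilon>, of "k + 1" h] by (simp only: real_norm_def add.assoc one_add_one)
    qed
    have "((\<lambda>h. (flat k \<epsilon> (0 + h) - flat k \<epsilon> 0) / h) \<longlongrightarrow> 0) (at 0)"
    proof (rule Lim_transform_eventually[OF lim])
      show "\<forall>\<^sub>F h in at 0. flat (k + 1) \<epsilon> h = (flat k \<epsilon> (0 + h) - flat k \<epsilon> 0) / h"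
        by (auto simp: eventually_at_filter flat_def)
    qed
    then have "(flat k \<epsilon> has_real_derivative 0) (at 0)" unfolding DERIV_def .
    then show ?thesis using 3 by (simp add: flat_def)
  qed
qed

text \<open>A class that contains the required bump functions and is closed under partial
  derivatives, so that the infinitely many conditions in \<open>test_function\<close> follow by
  induction on the list of directions.\<close>

inductive_set smooth3 :: "(real^3 \<Rightarrow> real) set" where
  const: "(\<lambda>_. c) \<in> smooth3"
| flat: "0 < \<epsilon> \<Longrightarrow> (\<lambda>x. flat k \<epsilon> (s * x $ i + a)) \<in> smooth3"
| add: "f \<in> smooth3 \<Longrightarrow> g \<in> smooth3 \<Longrightarrow> (\<lambda>x. f x + g x) \<in> smooth3"
| mult: "f \<in> smooth3 \<Longrightarrow> g \<in> smooth3 \<Longrightarrow> (\<lambda>x. f x * g x) \<in> smooth3"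

lemma smooth3_derivative:
  "f \<in> smooth3 \<Longrightarrow> \<exists>f'. (\<forall>x. (f has_derivative f' x) (at x)) \<and> (\<forall>c. (\<lambda>x. f' x (axis c 1)) \<in> smooth3)"
proof (induction rule: smooth3.induct)
  case (const c)
  show ?case by (intro exI[of _ "\<lambda>_ _. 0"]) (auto intro: smooth3.const)
next
  case (flat \<epsilon> k s i a)
  let ?d = "\<lambda>y. - real k * flat (k + 1) \<epsilon> y + \<epsilon> * flat (k + 2) \<epsilon> y"
  show ?case
  proof (intro exI[of _ "\<lambda>x h. ?d (s * x $ i + a) * (s * h $ i)"] conjI allI)
    fix x :: "real^3"
    have "((\<lambda>x :: real^3. s * x $ i + a) has_derivative (\<lambda>h. s * h $ i)) (at x)"
      by (auto intro!: derivative_eq_intros bounded_linear.has_derivative[OF bounded_linear_vec_nth])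
    from has_derivative_compose[OF this DERIV_flat[OF flat, unfolded has_field_derivative_def]]
    show "((\<lambda>x. flat k \<epsilon> (s * x $ i + a)) has_derivative (\<lambda>h. ?d (s * x $ i + a) * (s * h $ i))) (at x)" .
  next
    fix c
    show "(\<lambda>x. ?d (s * x $ i + a) * (s * axis c 1 $ i)) \<in> smooth3"
      by (intro smooth3.mult smooth3.add smooth3.const smooth3.flat flat)
  qed
next
  case (add f g)
  then obtain f' g' where d: "\<forall>x. (f has_derivative f' x) (at x)" "\<forall>c. (\<lambda>x. f' x (axis c 1)) \<in> smooth3"
    "\<forall>x. (g has_derivative g' x) (at x)" "\<forall>c. (\<lambda>x. g' x (axis c 1)) \<in> smooth3" by blast
  show ?case
    using d by (intro exI[of _ "\<lambda>x h. f' x h + g' x h"]) (auto intro: has_derivative_add smooth3.add)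
next
  case (mult f g)
  then obtain f' g' where d: "\<forall>x. (f has_derivative f' x) (at x)" "\<forall>c. (\<lambda>x. f' x (axis c 1)) \<in> smooth3"
    "\<forall>x. (g has_derivative g' x) (at x)" "\<forall>c. (\<lambda>x. g' x (axis c 1)) \<in> smooth3" by blast
  show ?case
  proof (intro exI[of _ "\<lambda>x h. f x * g' x h + f' x h * g x"] conjI allI)
    show "((\<lambda>x. f x * g x) has_derivative (\<lambda>h. f x * g' x h + f' x h * g x)) (at x)" for x
      using d by (intro has_derivative_mult) auto
    show "(\<lambda>x. f x * g' x (axis c 1) + f' x (axis c 1) * g x) \<in> smooth3" for c
      by (intro smooth3.add smooth3.mult mult.hyps d(2)[rule_format] d(4)[rule_format])
  qed
qed

lemma smooth3_iter_partial: "f \<in> smooth3 \<Longrightarrow> iter_partial is f \<in> smooth3"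
proof (induction "is")
  case (Cons c "is")
  from smooth3_derivative[OF Cons.IH[OF Cons.prems]] obtain f' where
    f': "\<And>x. (iter_partial is f has_derivative f' x) (at x)" "\<And>c. (\<lambda>x. f' x (axis c 1)) \<in> smooth3" by blast
  have "frechet_derivative (iter_partial is f) (at x) = f' x" for x
    using frechet_derivative_at[OF f'(1)] by simp
  then show ?case using f'(2)[of c] by simp
qed simp

lemma smooth3_test_function:
  assumes "f \<in> smooth3" "bounded {x. f x \<noteq> 0}"
  shows "test_function f"
  unfolding test_function_def
proof (intro conjI allI assms(2))
  fix "is" x
  obtain f' where "\<And>x. (iter_partial is f has_derivative f' x) (at x)"
    using smooth3_derivative[OF smooth3_iter_partial[OF assms(1), of "is"]] by blast
  then show "iter_partial is f differentiable (at x)" unfolding differentiable_def by blast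
qed

lemma smooth3_prod: "finite A \<Longrightarrow> (\<And>i. i \<in> A \<Longrightarrow> f i \<in> smooth3) \<Longrightarrow> (\<lambda>x. \<Prod>i\<in>A. f i x) \<in> smooth3"
  by (induction A rule: finite_induct) (auto intro: smooth3.const smooth3.mult)

definition box_approx :: "real^3 \<Rightarrow> real^3 \<Rightarrow> nat \<Rightarrow> real^3 \<Rightarrow> real" where
  "box_approx a b n x = (\<Prod>i\<in>UNIV. flat 0 (1 / (real n + 1)) (x $ i - a $ i) * flat 0 (1 / (real n + 1)) (b $ i - x $ i))"

lemma box_approx_outside: "x \<notin> box a b \<Longrightarrow> box_approx a b n x = 0"
  by (auto simp: box_approx_def mem_box_cart flat_def prod_zero_iff)

lemma box_approx_range: "0 \<le> box_approx a b n x" "box_approx a b n x \<le> 1"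
proof -
  have f: "0 \<le> flat 0 (1 / (real n + 1)) y" "flat 0 (1 / (real n + 1)) y \<le> 1" for y
    by (simp_all add: flat_def)
  show "0 \<le> box_approx a b n x" "box_approx a b n x \<le> 1"
    unfolding box_approx_def by (auto intro!: prod_nonneg prod_le_1 mult_nonneg_nonneg mult_le_one f)
qed

lemma box_approx_lim: "(\<lambda>n. box_approx a b n x) \<longlonglongrightarrow> indicator (box a b) x"
proof (cases "x \<in> box a b")
  case True
  have f: "(\<lambda>n. flat 0 (1 / (real n + 1)) y) \<longlonglongrightarrow> 1" if "0 < y" for y
  proof -
    have "(\<lambda>n. exp (- (1 / (real n + 1)) / y)) \<longlonglongrightarrow> 1" using that by real_asymp
    then show ?thesis using that by (simp add: flat_def)
  qed
  have "(\<lambda>n. box_approx a b n x) \<longlonglongrightarrow> (\<Prod>i\<in>(UNIV::3 set). 1 * 1)"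
    unfolding box_approx_def using True by (intro tendsto_prod tendsto_mult f) (auto simp: mem_box_cart)
  then show ?thesis using True by simp
qed (simp add: box_approx_outside)

lemma box_approx_test_function: "test_function (box_approx a b n)"
proof (rule smooth3_test_function)
  have "(\<lambda>x. flat 0 (1 / (real n + 1)) (1 * x $ i + - a $ i) * flat 0 (1 / (real n + 1)) (- 1 * x $ i + b $ i)) \<in> smooth3" for i
    by (intro smooth3.mult smooth3.flat) auto
  then show "box_approx a b n \<in> smooth3"
    unfolding box_approx_def by (intro smooth3_prod) (auto simp: algebra_simps)
  show "bounded {x. box_approx a b n x \<noteq> 0}"
    by (rule bounded_subset[OF bounded_box[of a b]]) (use box_approx_outside in blast)
qed

text \<open>\<open>ennreal\<close> cuts off negative values, so the two densities are the positive
  and the negative part of \<open>d\<close>. They give equal finite mass to all open boxes, which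
  are stable under intersection and exhaust the space; so the measures agree, and then the
  densities.\<close>

lemma AE_zero_if_box_integrals_zero:
  fixes d :: "real^3 \<Rightarrow> real"
  assumes [measurable]: "d \<in> borel_measurable borel"
    and int: "\<And>a b. integrable lborel (\<lambda>x. indicator (box a b) x * d x)"
    and zero: "\<And>a b. (\<integral>x. indicator (box a b) x * d x \<partial>lborel) = 0"
  shows "AE x in lborel. d x = 0"
proof -
  have bm [measurable]: "box (a :: real^3) b \<in> sets borel" for a b by simp
  have em: "emeasure (density lborel (\<lambda>x. ennreal (d x))) (box a b) = (\<integral>\<^sup>+x. ennreal (indicator (box a b) x * d x) \<partial>lborel)"
    "emeasure (density lborel (\<lambda>x. ennreal (- d x))) (box a b) = (\<integral>\<^sup>+x. ennreal (- (indicator (box a b) x * d x)) \<partial>lborel)" for a b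
    by (auto simp: emeasure_density indicator_def intro!: nn_integral_cong)
  have fin: "(\<integral>\<^sup>+x. ennreal (indicator (box a b) x * d x) \<partial>lborel) \<noteq> \<infinity>"
    "(\<integral>\<^sup>+x. ennreal (- (indicator (box a b) x * d x)) \<partial>lborel) \<noteq> \<infinity>" for a b
    using real_integrable_def[THEN iffD1, OF int[of a b]] by auto
  have eq: "(\<integral>\<^sup>+x. ennreal (indicator (box a b) x * d x) \<partial>lborel) = (\<integral>\<^sup>+x. ennreal (- (indicator (box a b) x * d x)) \<partial>lborel)" for a b
  proof -
    have "enn2real (\<integral>\<^sup>+x. ennreal (indicator (box a b) x * d x) \<partial>lborel) = enn2real (\<integral>\<^sup>+x. ennreal (- (indicator (box a b) x * d x)) \<partial>lborel)"
      using real_lebesgue_integral_def[OF int[of a b]] zero[of a b] by simp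
    then have "ennreal (enn2real (\<integral>\<^sup>+x. ennreal (indicator (box a b) x * d x) \<partial>lborel)) = ennreal (enn2real (\<integral>\<^sup>+x. ennreal (- (indicator (box a b) x * d x)) \<partial>lborel))"
      by (rule arg_cong)
    then show ?thesis using fin[of a b] by (simp only: ennreal_enn2real_if infinity_ennreal_def if_False)
  qed
  have "density lborel (\<lambda>x. ennreal (d x)) = density lborel (\<lambda>x. ennreal (- d x))"
  proof (rule measure_eqI_generator_eq[where E="range (\<lambda>(a, b). box a b)" and \<Omega>=UNIV and A="\<lambda>n::nat. box (- (\<chi> i. real n)) (\<chi> i. real n)"])
    show "Int_stable (range (\<lambda>(a, b). box a b :: (real^3) set))"
      by (auto simp: Int_stable_def box_Int_box)
    show "emeasure (density lborel (\<lambda>x. ennreal (d x))) X = emeasure (density lborel (\<lambda>x. ennreal (- d x))) X"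
      if "X \<in> range (\<lambda>(a, b). box a b)" for X
      using that eq by (auto simp: em)
    show "sets (density lborel (\<lambda>x. ennreal (d x))) = sigma_sets UNIV (range (\<lambda>(a, b). box a b))"
      "sets (density lborel (\<lambda>x. ennreal (- d x))) = sigma_sets UNIV (range (\<lambda>(a, b). box a b))"
      by (simp_all, simp_all add: borel_eq_box)
    show "(\<Union>n::nat. box (- (\<chi> i. real n)) (\<chi> i. real n)) = (UNIV :: (real^3) set)"
    proof safe
      fix x :: "real^3"
      obtain n where n: "norm x < real n" using reals_Archimedean2 by blast
      have "\<bar>x $ i\<bar> < real n" for i using component_le_norm_cart[of x i] n by linarith
      then have "x \<in> box (- (\<chi> i. real n)) (\<chi> i. real n)" by (auto simp: mem_box_cart abs_less_iff minus_less_iff)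
      then show "x \<in> (\<Union>n::nat. box (- (\<chi> i. real n)) (\<chi> i. real n))" by blast
    qed simp
    show "emeasure (density lborel (\<lambda>x. ennreal (d x))) (box (- (\<chi> i. real n)) (\<chi> i. real n)) \<noteq> \<infinity>" for n :: nat
      unfolding em by (rule fin)
  qed auto
  then have "AE x in lborel. ennreal (d x) = ennreal (- d x)"
    by (intro sigma_finite_measure.density_unique[OF sigma_finite_lborel, rotated 2]) simp_all
  then show ?thesis
  proof eventually_elim
    fix x assume h: "ennreal (d x) = ennreal (- d x)"
    show "d x = 0"
    proof (rule ccontr)
      assume "d x \<noteq> 0"
      then consider "d x > 0" | "d x < 0" by linarith
      then show False using h by cases (auto simp: ennreal_neg ennreal_eq_0_iff)
    qed
  qed
qed

text \<open>Completeness of Lebesgue measure. It applies to fields such as those of the given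
  solution, which are identified only up to null sets.\<close>

lemma borel_measurable_lebesgue_AE:
  fixes f g :: "'a::euclidean_space \<Rightarrow> 'b::topological_space"
  assumes g: "g \<in> borel_measurable lebesgue" and ae: "AE x in lebesgue. f x = g x"
  shows "f \<in> borel_measurable lebesgue"
proof (rule measurableI)
  fix A :: "'b set" assume "A \<in> sets borel"
  then have A: "g -` A \<inter> space lebesgue \<in> sets lebesgue" using g by (rule measurable_sets[rotated])
  have AE: "AE x in lebesgue. x \<in> g -` A \<inter> space lebesgue \<longleftrightarrow> x \<in> f -` A \<inter> space lebesgue"
    using ae by eventually_elim auto
  show "f -` A \<inter> space lebesgue \<in> sets lebesgue"
    by (rule completion.in_sets_AE[OF AE A]) simp
qed simp

lemma AE_lebesgue_borel_vec:
  fixes f :: "real^3 \<Rightarrow> real^3"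
  assumes f: "f \<in> borel_measurable lebesgue"
  shows "\<exists>g\<in>borel_measurable borel. AE x in lebesgue. f x = g x"
proof -
  have "\<forall>i. \<exists>g. g \<in> borel_measurable lborel \<and> (AE x in lborel. f x $ i = g x)"
  proof
    fix i
    have "(\<lambda>x. f x $ i) \<in> borel_measurable lebesgue" using f by measurable
    from completion_ex_borel_measurable_real[OF this]
    show "\<exists>g. g \<in> borel_measurable lborel \<and> (AE x in lborel. f x $ i = g x)" by blast
  qed
  from choice[OF this] obtain g where "\<forall>i. g i \<in> borel_measurable lborel \<and> (AE x in lborel. f x $ i = g i x)" by blast
  then have g: "\<And>i. g i \<in> borel_measurable borel" "\<And>i. AE x in lborel. f x $ i = g i x" by auto
  have "(\<lambda>x. \<chi> i. g i x) \<in> borel_measurable borel"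
    using g(1) by (subst borel_measurable_euclidean_space) (auto simp: Basis_vec3 inner_axis)
  moreover have "AE x in lborel. \<forall>i. f x $ i = g i x" using g(2) by (simp add: AE_all_countable)
  then have "AE x in lborel. f x = (\<chi> i. g i x)" by eventually_elim (simp add: vec_eq_iff)
  from AE_completion[OF this] have "AE x in lebesgue. f x = (\<chi> i. g i x)" .
  ultimately show ?thesis by (intro bexI[where x="\<lambda>x. \<chi> i. g i x"])
qed

lemma locally_integrable_measurable:
  assumes "locally_integrable f"
  shows "f \<in> borel_measurable lebesgue"
proof (rule borel_measurable_LIMSEQ_metric)
  show "(\<lambda>x. indicator (cball 0 (real n)) x *\<^sub>R f x) \<in> borel_measurable lebesgue" for n
  proof -
    have "integrable lebesgue (\<lambda>x. indicator (cball 0 (real n)) x *\<^sub>R f x)"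
      using assms unfolding locally_integrable_def set_integrable_def by simp
    then show ?thesis by (rule borel_measurable_integrable)
  qed
  fix x :: "real^3"
  obtain N where N: "norm x \<le> real N" using real_arch_simple by blast
  have "eventually (\<lambda>n. indicator (cball 0 (real n)) x *\<^sub>R f x = f x) sequentially"
    using eventually_ge_at_top[of N] by eventually_elim (use N in auto)
  then show "(\<lambda>n. indicator (cball 0 (real n)) x *\<^sub>R f x) \<longlonglongrightarrow> f x" by (rule tendsto_eventually)
qed

text \<open>The fundamental lemma of the calculus of variations: \<open>box_approx\<close> tends to
  the indicator of a box, so \<open>f - g\<close> has integral 0 over all boxes. It enters because
  \<open>grad_norm 0\<close> is formed with the weak derivatives of order zero, not with
  \<open>f\<close> itself.\<close>

lemma weak_partial_nil:
  assumes wp: "weak_partial [] f g"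
  shows "AE x in lebesgue. f x = g x"
proof -
  have f: "locally_integrable f" and g: "locally_integrable g"
    and eq: "\<And>\<phi>. test_function \<phi> \<Longrightarrow> (LINT x|lebesgue. \<phi> x *\<^sub>R f x) = (LINT x|lebesgue. \<phi> x *\<^sub>R g x)"
    using wp by (auto simp: weak_partial_def)
  have fgm [measurable]: "f \<in> borel_measurable lebesgue" "g \<in> borel_measurable lebesgue"
    using locally_integrable_measurable f g by auto
  have ib: "integrable lebesgue (\<lambda>x. indicator (cbox a b) x *\<^sub>R h x)" if "locally_integrable h" for h a b
    using that by (auto simp: locally_integrable_def set_integrable_def)
  have BA [measurable]: "box_approx a b n \<in> borel_measurable lebesgue" for a b n
    by (intro measurable_completion) (simp add: test_function_measurable[OF box_approx_test_function])
  have [measurable]: "box a b \<in> sets lebesgue" for a b :: "real^3" by simp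
  have int: "integrable lebesgue (\<lambda>x. box_approx a b n x *\<^sub>R h x)" if h: "locally_integrable h" for h a b n
  proof (rule Bochner_Integration.integrable_bound[OF ib[OF h, of a b]])
    show "(\<lambda>x. box_approx a b n x *\<^sub>R h x) \<in> borel_measurable lebesgue"
      using locally_integrable_measurable[OF h] by measurable
    show "AE x in lebesgue. norm (box_approx a b n x *\<^sub>R h x) \<le> norm (indicator (cbox a b) x *\<^sub>R h x)"
    proof (rule AE_I2)
      fix x
      show "norm (box_approx a b n x *\<^sub>R h x) \<le> norm (indicator (cbox a b) x *\<^sub>R h x)"
        using box_approx_outside[of x a b n] box_approx_range[of a b n x] box_subset_cbox[of a b]
        by (cases "x \<in> box a b") (auto simp: mult_left_le_one_le subset_eq)
    qed
  qed
  define d where "d x = f x - g x" for x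
  have dl: "locally_integrable d"
    using f g unfolding locally_integrable_def d_def set_integrable_def scaleR_diff_right
    by (auto intro: Bochner_Integration.integrable_diff)
  have dm [measurable]: "d \<in> borel_measurable lebesgue" using locally_integrable_measurable[OF dl] .
  have zero: "(LINT x|lebesgue. indicator (box a b) x *\<^sub>R d x) = 0" for a b
  proof -
    have "(\<lambda>n. LINT x|lebesgue. box_approx a b n x *\<^sub>R d x) \<longlonglongrightarrow> (LINT x|lebesgue. indicator (box a b) x *\<^sub>R d x)"
    proof (rule integral_dominated_convergence[OF _ _ integrable_norm[OF ib[OF dl, of a b]]])
      show "AE x in lebesgue. (\<lambda>n. box_approx a b n x *\<^sub>R d x) \<longlonglongrightarrow> indicator (box a b) x *\<^sub>R d x"
        by (intro AE_I2 tendsto_intros box_approx_lim)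
      show "AE x in lebesgue. norm (box_approx a b n x *\<^sub>R d x) \<le> norm (indicator (cbox a b) x *\<^sub>R d x)" for n
      proof (rule AE_I2)
        fix x
        show "norm (box_approx a b n x *\<^sub>R d x) \<le> norm (indicator (cbox a b) x *\<^sub>R d x)"
          using box_approx_outside[of x a b n] box_approx_range[of a b n x] box_subset_cbox[of a b]
          by (cases "x \<in> box a b") (auto simp: mult_left_le_one_le subset_eq)
      qed
    qed measurable
    moreover have "(LINT x|lebesgue. box_approx a b n x *\<^sub>R d x) = 0" for n
      unfolding d_def scaleR_diff_right
      using eq[OF box_approx_test_function, of a b n] by (subst Bochner_Integration.integral_diff[OF int[OF f] int[OF g]]) simp
    ultimately show ?thesis by (simp add: LIMSEQ_const_iff)
  qed
  \<comment> \<open>A Borel version, because the uniqueness argument compares densities over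
    \<open>lborel\<close>.\<close>
  obtain e where e[measurable]: "e \<in> borel_measurable borel" and de: "AE x in lebesgue. d x = e x"
    using AE_lebesgue_borel_vec[OF dm] by blast
  have ie: "integrable lebesgue (\<lambda>x. indicator (box a b) x *\<^sub>R e x)" for a b
  proof -
    have "integrable lebesgue (\<lambda>x. indicator (box a b) x *\<^sub>R d x)"
      by (rule Bochner_Integration.integrable_bound[OF ib[OF dl, of a b]])
        (auto simp: indicator_def intro: subsetD[OF box_subset_cbox])
    moreover have [measurable]: "e \<in> borel_measurable lebesgue" by (intro measurable_completion) simp
    ultimately show ?thesis
      by (subst integrable_cong_AE[of _ _ "\<lambda>x. indicator (box a b) x *\<^sub>R d x"]) (use de in auto)
  qed
  have ze: "(LINT x|lebesgue. indicator (box a b) x *\<^sub>R e x) = 0" for a b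
  proof -
    have [measurable]: "e \<in> borel_measurable lebesgue" by (intro measurable_completion) simp
    have "(LINT x|lebesgue. indicator (box a b) x *\<^sub>R e x) = (LINT x|lebesgue. indicator (box a b) x *\<^sub>R d x)"
      by (rule integral_cong_AE) (use de in auto)
    then show ?thesis by (simp add: zero)
  qed
  have "AE x in lborel. e x $ i = 0" for i
  proof (rule AE_zero_if_box_integrals_zero)
    have ieb: "integrable lborel (\<lambda>x. indicator (box a b) x *\<^sub>R e x)" for a b
      using ie[of a b] by (subst (asm) integrable_completion) auto
    have zeb: "(\<integral>x. indicator (box a b) x *\<^sub>R e x \<partial>lborel) = 0" for a b
      using ze[of a b] by (subst (asm) integral_completion) auto
    show "integrable lborel (\<lambda>x. indicator (box a b) x * e x $ i)" for a b
      using integrable_bounded_linear[OF bounded_linear_vec_nth ieb[of a b], of i] by simp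
    show "(\<integral>x. indicator (box a b) x * e x $ i \<partial>lborel) = 0" for a b
      using integral_bounded_linear[OF bounded_linear_vec_nth ieb[of a b], of i] zeb[of a b] by simp
  qed measurable
  then have "AE x in lborel. \<forall>i. e x $ i = 0" by (simp add: AE_all_countable)
  then have "AE x in lebesgue. \<forall>i. e x $ i = 0" by (rule AE_completion)
  with de show ?thesis by eventually_elim (simp add: d_def vec_eq_iff)
qed

lemma Lq_norm_le:
  fixes f :: "real^3 \<Rightarrow> 'b::real_normed_vector" and h :: "real^3 \<Rightarrow> real"
  assumes f: "f \<in> borel_measurable lebesgue" and nf: "(\<lambda>x. norm (f x)) \<in> borel_measurable lebesgue"
    and fh: "AE x in lebesgue. norm (f x) \<le> h x"
    and h[measurable]: "h \<in> borel_measurable borel" and q: "1 \<le> q" and b: "Lq_bound q (\<lambda>x. ennreal (h x)) c" "0 \<le> c"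
  shows "Lq_norm q f \<le> ennreal c"
proof (cases "q = \<infinity>")
  case True
  have "esssup lebesgue (\<lambda>x. ennreal (norm (f x))) \<le> ennreal c"
  proof (rule esssup_I)
    show "AE x in lebesgue. ennreal (norm (f x)) \<le> ennreal c"
      using fh
    proof eventually_elim
      fix x assume "norm (f x) \<le> h x"
      then have "ennreal (norm (f x)) \<le> ennreal (h x)" by (rule ennreal_leI)
      also have "\<dots> \<le> ennreal c" using b True by (simp add: Lq_bound_def)
      finally show "ennreal (norm (f x)) \<le> ennreal c" .
    qed
  qed (use nf in measurable)
  then show ?thesis using f True by (simp add: Lq_norm_def)
next
  case False
  define p where "p = enn2real q"
  have p: "1 \<le> p" using enn2real_ge_1 q False p_def by blast
  have "(\<integral>\<^sup>+x. ennreal (norm (f x) powr p) \<partial>lebesgue) \<le> (\<integral>\<^sup>+x. epowr (ennreal (h x)) p \<partial>lebesgue)"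
  proof (rule nn_integral_mono_AE)
    show "AE x in lebesgue. ennreal (norm (f x) powr p) \<le> epowr (ennreal (h x)) p"
      using fh
    proof eventually_elim
      fix x assume fx: "norm (f x) \<le> h x"
      then have "0 \<le> h x" using norm_ge_zero order_trans by blast
      then show "ennreal (norm (f x) powr p) \<le> epowr (ennreal (h x)) p"
        using fx p by (simp add: ennreal_leI powr_mono2)
    qed
  qed
  also have "\<dots> \<le> ennreal (c powr p)"
    using b False by (simp add: nn_integral_completion Lq_bound_def p_def)
  finally have I: "(\<integral>\<^sup>+x. ennreal (norm (f x) powr p) \<partial>lebesgue) \<le> ennreal (c powr p)" .
  let ?I = "\<integral>\<^sup>+x. ennreal (norm (f x) powr p) \<partial>lebesgue"
  have fin: "?I \<noteq> \<infinity>" using I by (auto simp: top_unique)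
  have "enn2real ?I \<le> c powr p" using enn2real_mono[OF I] by simp
  then have "enn2real ?I powr (1 / p) \<le> (c powr p) powr (1 / p)" using p by (intro powr_mono2) auto
  also have "\<dots> = c" using p b(2) by (simp add: powr_powr)
  finally show ?thesis using f False fin by (simp add: Lq_norm_def p_def[symmetric] Let_def ennreal_leI)
qed

text \<open>A strict bound on the infimum yields an admissible \<open>G\<close>, whose component for
  the empty list equals \<open>f\<close> almost everywhere. A Borel version of it becomes the
  initial value of the iteration.\<close>

lemma grad_norm_0_less:
  assumes gn: "grad_norm 0 q f < ennreal c" and q: "1 \<le> q" and c: "0 < c"
  shows "\<exists>a. a \<in> borel_measurable borel \<and> (AE x in lebesgue. f x = a x) \<and> Lq_bound q (\<lambda>x. ennreal (norm (a x))) c"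
proof -
  have nil: "{is :: 3 list. length is = 0} = {[]}" by auto
  obtain G where G: "weak_partial [] f (G [])" "Lq_norm q (\<lambda>x. sqrt (\<Sum>is\<in>{is :: 3 list. length is = 0}. (norm (G is x))\<^sup>2)) < ennreal c"
    using gn unfolding grad_norm_def INF_less_iff by auto
  have L: "Lq_norm q (\<lambda>x. norm (G [] x)) < ennreal c" using G(2) unfolding nil by simp
  have Gm: "G [] \<in> borel_measurable lebesgue"
    using G(1) by (auto simp: weak_partial_def intro: locally_integrable_measurable)
  then have nGm: "(\<lambda>x. norm (G [] x)) \<in> borel_measurable lebesgue" by measurable
  obtain a0 where a0[measurable]: "a0 \<in> borel_measurable borel" and ae: "AE x in lebesgue. G [] x = a0 x"
    using AE_lebesgue_borel_vec[OF Gm] by blast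
  have fa: "AE x in lebesgue. f x = a0 x" using weak_partial_nil[OF G(1)] ae by eventually_elim simp
  show ?thesis
  proof (cases "q = \<infinity>")
    case True
    \<comment> \<open>The essential bound is turned into a bound at every point, as
      \<open>Lq_bound\<close> demands for \<open>q = \<infinity>\<close>, by replacing values that
      are too large by 0.\<close>
    define a where "a x = (if norm (a0 x) \<le> c then a0 x else 0)" for x
    have lt: "esssup lebesgue (\<lambda>x. ennreal (norm (G [] x))) < ennreal c" using L True nGm by (simp add: Lq_norm_def)
    have "AE x in lebesgue. ennreal (norm (G [] x)) \<le> ennreal c"
      using esssup_AE[of "\<lambda>x. ennreal (norm (G [] x))" lebesgue]
      by eventually_elim (rule order_trans[OF _ less_imp_le[OF lt]])
    then have "AE x in lebesgue. f x = a x"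
      using fa ae
    proof eventually_elim
      fix x assume "ennreal (norm (G [] x)) \<le> ennreal c" "f x = a0 x" "G [] x = a0 x"
      then show "f x = a x" using c by (simp add: a_def)
    qed
    moreover have "Lq_bound q (\<lambda>x. ennreal (norm (a x))) c" using True c by (auto simp: Lq_bound_def a_def intro!: ennreal_leI)
    moreover have "a \<in> borel_measurable borel" unfolding a_def[abs_def] by measurable
    ultimately show ?thesis by blast
  next
    case False
    define p where "p = enn2real q"
    have p: "1 \<le> p" using enn2real_ge_1 q False p_def by blast
    let ?I = "\<integral>\<^sup>+x. ennreal (norm (G [] x) powr p) \<partial>lebesgue"
    have Leq: "Lq_norm q (\<lambda>x. norm (G [] x)) = (if ?I = \<infinity> then \<infinity> else ennreal (enn2real ?I powr (1/p)))"
      unfolding Lq_norm_def Let_def p_def[symmetric] using nGm False by simp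
    have fin: "?I \<noteq> \<infinity>"
    proof
      assume "?I = \<infinity>"
      then show False using L unfolding Leq by simp
    qed
    have lt: "ennreal (enn2real ?I powr (1/p)) < ennreal c"
      using L unfolding Leq if_not_P[OF fin] .
    have "enn2real ?I powr (1/p) \<le> c" using lt c by (simp add: ennreal_less_iff)
    then have "(enn2real ?I powr (1/p)) powr p \<le> c powr p" using p by (intro powr_mono2) auto
    then have "enn2real ?I \<le> c powr p" using p by (simp add: powr_powr)
    then have I: "?I \<le> ennreal (c powr p)" 
    proof -
      have "?I = ennreal (enn2real ?I)" using fin by (simp add: less_top)
      also have "\<dots> \<le> ennreal (c powr p)" by (rule ennreal_leI) fact
      finally show ?thesis .
    qed
    have "?I = (\<integral>\<^sup>+x. ennreal (norm (a0 x) powr p) \<partial>lebesgue)"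
      by (rule nn_integral_cong_AE) (use ae in \<open>auto elim!: eventually_mono\<close>)
    also have "\<dots> = (\<integral>\<^sup>+x. epowr (ennreal (norm (a0 x))) p \<partial>lborel)" by (simp add: nn_integral_completion)
    finally have "Lq_bound q (\<lambda>x. ennreal (norm (a0 x))) c" using I False by (simp add: Lq_bound_def p_def)
    then show ?thesis using a0 fa by blast
  qed
qed

section \<open>The mild solution\<close>

context picard
begin

text \<open>Integrability of each term, not only of the sum in \<open>B\<close>, so that Fubini's
  theorem applies entry by entry as in \<open>heat_leray_div\<close>.\<close>

lemma integrable_term:
  assumes h: "h \<in> H" and p: "p \<in> space M" and fin: "Uinf p < \<top>"
  shows "integrable M (\<lambda>p'. K h p p' i j l * (Winf h p' j * Winf h p' l))"
proof -
  have "(\<integral>\<^sup>+p'. ennreal (norm (K h p p' i j l * (Winf h p' j * Winf h p' l))) \<partial>M) \<le> (\<integral>\<^sup>+p'. k p p' * (Uinf p')\<^sup>2 \<partial>M)"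
  proof (rule nn_integral_mono)
    fix p' assume p': "p' \<in> space M"
    have "norm (K h p p' i j l) \<le> (\<Sum>l\<in>UNIV. norm (K h p p' i j l))"
      by (rule member_le_sum) auto
    also have "\<dots> \<le> (\<Sum>j\<in>UNIV. \<Sum>l\<in>UNIV. norm (K h p p' i j l))"
      by (rule member_le_sum[where f="\<lambda>j. \<Sum>l\<in>UNIV. norm (K h p p' i j l)"]) (auto intro: sum_nonneg)
    finally have "ennreal (norm (K h p p' i j l)) \<le> k p p'"
      using K_le[OF h, of p p' i] order_trans ennreal_leI by blast
    then have "ennreal (norm (K h p p' i j l)) * (ennreal (norm (Winf h p' j)) * ennreal (norm (Winf h p' l))) \<le> k p p' * (Uinf p' * Uinf p')"
      by (intro mult_mono norm_Winf_le[OF h p']) auto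
    then show "ennreal (norm (K h p p' i j l * (Winf h p' j * Winf h p' l))) \<le> k p p' * (Uinf p')\<^sup>2"
      by (simp add: norm_mult ennreal_mult power2_eq_square)
  qed
  also have "\<dots> < \<infinity>" using Uinf_eq[OF p] fin by (simp add: less_top)
  finally show ?thesis using p by (auto simp: integrable_iff_bounded)
qed

end

lemma locally_finite_Lq_bound:
  assumes q: "1 \<le> q" and U: "Lq_bound q U Q" and [measurable]: "U \<in> borel_measurable borel"
  shows "locally_finite U"
  unfolding locally_finite_def
proof (intro conjI allI assms(3))
  fix r
  have [measurable]: "cball (0::real^3) r \<in> sets borel" by simp
  have ball: "emeasure lborel (cball (0::real^3) r) < \<top>" using emeasure_lborel_cball_finite by (simp add: less_top)
  show "(\<integral>\<^sup>+x. U x * indicator (cball 0 r) x \<partial>lborel) < \<top>"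
  proof (cases "q = \<infinity>")
    case True
    have "(\<integral>\<^sup>+x. U x * indicator (cball 0 r) x \<partial>lborel) \<le> (\<integral>\<^sup>+x. ennreal Q * indicator (cball (0::real^3) r) x \<partial>lborel)"
    proof (rule nn_integral_mono)
      show "U x * indicator (cball 0 r) x \<le> ennreal Q * indicator (cball 0 r) x" for x
        using U True by (simp add: Lq_bound_def indicator_def)
    qed
    also have "\<dots> = ennreal Q * emeasure lborel (cball (0::real^3) r)" by (simp add: nn_integral_cmult_indicator)
    also have "\<dots> < \<top>" using ball by (simp add: ennreal_mult_less_top)
    finally show ?thesis .
  next
    case False
    define p where "p = enn2real q"
    have p: "1 \<le> p" using enn2real_ge_1 q False p_def by blast
    \<comment> \<open>Splitting at \<open>u = 1\<close> gives local integrability without Hoelder's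
      inequality.\<close>
    have le: "u \<le> 1 + epowr u p" for u
    proof (cases "u \<le> 1")
      case False
      have "u \<le> epowr u p"
      proof (cases u)
        case (real x)
        then have "1 \<le> x" using False by (simp add: ennreal_le_1)
        then have "x powr 1 \<le> x powr p" using p by (intro powr_mono) auto
        then show ?thesis using real \<open>1 \<le> x\<close> by (simp add: ennreal_leI)
      qed simp
      then show ?thesis by (simp add: add_increasing)
    qed (simp add: add_increasing2)
    have "(\<integral>\<^sup>+x. U x * indicator (cball 0 r) x \<partial>lborel) \<le> (\<integral>\<^sup>+x. indicator (cball (0::real^3) r) x + epowr (U x) p \<partial>lborel)"
      by (intro nn_integral_mono) (auto simp: indicator_def le)
    also have "\<dots> = emeasure lborel (cball (0::real^3) r) + (\<integral>\<^sup>+x. epowr (U x) p \<partial>lborel)"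
      by (subst nn_integral_add) auto
    also have "\<dots> < \<top>" using ball U False by (auto simp: Lq_bound_def p_def less_top[symmetric] top_unique)
    finally show ?thesis .
  qed
qed

lemma heat_leray_div_kernel_measurable:
  assumes "0 < t"
  shows "(\<lambda>y. heat_leray_div_kernel t (x - y) i j l) \<in> borel_measurable borel"
proof -
  have "heat_leray_div_kernel t z i j l = Re (oseen_kernel t (cvec z) i j l)" for z
    using heat_leray_div_kernel_eq[OF assms, of z i j l] by (metis Re_complex_of_real)
  moreover have "(\<lambda>y. oseen_kernel t (cvec (x - y)) i j l) \<in> borel_measurable borel"
    by (rule measurable_oseen_kernel) (auto simp: cvec_def)
  ultimately show ?thesis by simp
qed

context ns_data
begin

lemma H_polydisc: "H = polydisc L"
  by (auto simp: H_def polydisc_def)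

lemma zero_in_H: "(\<lambda>_. 0) \<in> H"
  using L_nonneg by (simp add: H_def)

lemma Winf_measurable_slice: "(\<lambda>x. Winf \<eta> (t, x) i) \<in> borel_measurable borel"
  using measurable_Pair2[OF Winf_measurable, of t \<eta> i] by (simp add: space_pair_measure)

lemma Winf_slice_translatable:
  assumes t: "0 < t"
  shows "translatable L (sqrt t) (\<lambda>x. Uinf (t, x)) (\<lambda>\<eta> x. Winf \<eta> (t, x) i)"
  unfolding translatable_def H_polydisc[symmetric]
proof (intro conjI allI ballI impI)
  show "(\<lambda>x. Winf \<eta> (t, x) i) \<in> borel_measurable borel" for \<eta>
    by (rule Winf_measurable_slice)
  show "Winf (\<lambda>l. \<omega> l + complex_of_real (e $ l)) (t, x) i = Winf \<omega> (t, x + sqrt t *\<^sub>R e) i" for \<omega> e x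
    by (rule Winf_translate)
  show "ennreal (norm (Winf \<eta> (t, x) i)) \<le> Uinf (t, x)" if "\<eta> \<in> H" for \<eta> x
    by (rule norm_Winf_le[OF that]) (simp add: space_pair_measure)
  show "(\<lambda>z. Winf (\<eta>(c := z)) (t, x) i) holomorphic_on ball 0 L" if "\<eta> \<in> H" "Uinf (t, x) < \<top>" for \<eta> c x
    by (rule Winf_holomorphic_coordinate[OF that])
qed

text \<open>At zero shift the data and the kernels are real. Hence the real part in the definition
  of \<open>v\<close> loses nothing where the iteration converges.\<close>

lemma W_real: "Im (W m (\<lambda>_. 0) p i) = 0"
proof -
  have w0: "Im (w0 (\<lambda>_. 0) p i) = 0" for p i
  proof (cases "0 < fst p")
    case True
    have "w0 (\<lambda>_. 0) p i = (\<integral>y. complex_of_real (gauss (fst p) (snd p - y) * a y $ i) \<partial>lborel)"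
      using True cgauss_cvec[of "fst p" "snd p - _"] by (simp add: w0_def cvec_def)
    then show ?thesis by (simp add: integral_complex_of_real del: of_real_mult)
  qed (simp add: w0_def)
  show ?thesis
  proof (induction m arbitrary: p i)
    case (Suc m)
    have real: "B (\<lambda>_. 0) (W m (\<lambda>_. 0)) p p' i = complex_of_real (Re (B (\<lambda>_. 0) (W m (\<lambda>_. 0)) p p' i))" for p'
    proof -
      have "K (\<lambda>_. 0) p p' i j l \<in> \<real>" for j l
      proof (cases "0 < fst p' \<and> fst p' < fst p")
        case True
        then have "K (\<lambda>_. 0) p p' i j l = complex_of_real (heat_leray_div_kernel (fst p - fst p') (snd p - snd p') i j l)"
          unfolding K_def if_P[OF True] by (simp add: heat_leray_div_kernel_eq cvec_def)
        then show ?thesis by simp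
      next
        case False
        show ?thesis unfolding K_def if_not_P[OF False] by simp
      qed
      moreover have "W m (\<lambda>_. 0) p' j \<in> \<real>" for j using Suc[of p' j] by (simp add: complex_is_Real_iff)
      ultimately have "B (\<lambda>_. 0) (W m (\<lambda>_. 0)) p p' i \<in> \<real>" unfolding B_def by (intro sum_in_Reals Reals_mult)
      then show ?thesis by (simp add: complex_is_Real_iff complex_eq_iff)
    qed
    have "(\<integral>p'. B (\<lambda>_. 0) (W m (\<lambda>_. 0)) p p' i \<partial>(lborel \<Otimes>\<^sub>M lborel)) = (\<integral>p'. complex_of_real (Re (B (\<lambda>_. 0) (W m (\<lambda>_. 0)) p p' i)) \<partial>(lborel \<Otimes>\<^sub>M lborel))"
      by (rule Bochner_Integration.integral_cong[OF refl real])
    also have "Im \<dots> = 0" by (simp add: integral_complex_of_real)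
    finally show ?case using w0[of p i] by simp
  qed (simp add: w0)
qed

definition v :: "real \<Rightarrow> real^3 \<Rightarrow> real^3" where
  "v t x = (\<chi> i. Re (Winf (\<lambda>_. 0) (t, x) i))"

lemma Winf_eq_v:
  assumes "Uinf (t, x) < \<top>"
  shows "Winf (\<lambda>_. 0) (t, x) i = complex_of_real (v t x $ i)"
proof -
  have "(\<lambda>m. Im (W m (\<lambda>_. 0) (t, x) i)) \<longlonglongrightarrow> Im (Winf (\<lambda>_. 0) (t, x) i)"
    by (intro tendsto_Im W_tendsto zero_in_H assms) (simp add: space_pair_measure)
  then have "Im (Winf (\<lambda>_. 0) (t, x) i) = 0" by (simp add: W_real LIMSEQ_const_iff)
  then show ?thesis by (simp add: v_def complex_eq_iff)
qed

lemma v_measurable: "(\<lambda>p. v (fst p) (snd p)) \<in> borel_measurable (lborel \<Otimes>\<^sub>M lborel)"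
proof -
  have [measurable]: "(\<lambda>p. Re (Winf (\<lambda>_. 0) p i)) \<in> borel_measurable (lborel \<Otimes>\<^sub>M lborel)" for i by measurable
  show ?thesis unfolding v_def
    by (subst borel_measurable_euclidean_space) (auto simp: Basis_vec3 inner_axis)
qed

lemma v_slice_measurable: "v t \<in> borel_measurable borel"
  using measurable_Pair2[OF v_measurable, of t] by (simp add: space_pair_measure)

lemma norm_v_le: "ennreal (norm (v t x)) \<le> 3 * Uinf (t, x)"
proof -
  have "ennreal (norm (v t x)) \<le> ennreal (\<Sum>i\<in>UNIV. \<bar>v t x $ i\<bar>)"
    by (rule ennreal_leI[OF norm_le_l1_cart])
  also have "\<dots> = (\<Sum>i\<in>UNIV. ennreal \<bar>v t x $ i\<bar>)" by simp
  also have "\<dots> \<le> (\<Sum>i\<in>(UNIV::3 set). Uinf (t, x))"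
  proof (rule sum_mono)
    fix i
    have "ennreal \<bar>v t x $ i\<bar> \<le> ennreal (norm (Winf (\<lambda>_. 0) (t, x) i))"
      by (simp add: v_def abs_Re_le_cmod ennreal_leI)
    also have "\<dots> \<le> Uinf (t, x)" by (rule norm_Winf_le[OF zero_in_H]) (simp add: space_pair_measure)
    finally show "ennreal \<bar>v t x $ i\<bar> \<le> Uinf (t, x)" .
  qed
  finally show ?thesis by simp
qed

lemma w0_eq_heat:
  assumes t: "0 < t" and fin: "Uinf (t, x) < \<top>"
  shows "w0 (\<lambda>_. 0) (t, x) i = complex_of_real (heat t a x $ i)"
proof -
  have "(\<integral>\<^sup>+y. ennreal (8 * exp (3 * L\<^sup>2 / 4) * (gauss (4 * t) (x - y) * norm (a y))) \<partial>lborel) < \<top>"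
    using le_less_trans[OF V_le_Uinf fin] t by (simp add: V_def ennreal_mult)
  then have b: "integrable lborel (\<lambda>y. 8 * exp (3 * L\<^sup>2 / 4) * (gauss (4 * t) (x - y) * norm (a y)))"
    by (intro integrableI_nonneg) auto
  have int: "integrable lborel (\<lambda>y. gauss t (x - y) *\<^sub>R a y)"
  proof (rule Bochner_Integration.integrable_bound[OF b])
    show "AE y in lborel. norm (gauss t (x - y) *\<^sub>R a y) \<le> norm (8 * exp (3 * L\<^sup>2 / 4) * (gauss (4 * t) (x - y) * norm (a y)))"
    proof (rule AE_I2)
      fix y
      \<comment> \<open>At an unshifted point the complex bound compares \<open>gauss t\<close> with
        \<open>gauss (4 * t)\<close>, so that finiteness of \<open>V\<close> gives
        integrability.\<close>
      have "norm (cgauss t (cvec (x - y))) \<le> 8 * exp (3 * L\<^sup>2 / 4) * gauss (4 * t) (x - y)"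
        by (rule norm_cgauss_le_gauss[OF t]) (use L_nonneg t in \<open>auto simp: near_def\<close>)
      then have "gauss t (x - y) * norm (a y) \<le> 8 * exp (3 * L\<^sup>2 / 4) * gauss (4 * t) (x - y) * norm (a y)"
        by (intro mult_right_mono) (auto simp: cgauss_cvec)
      then show "norm (gauss t (x - y) *\<^sub>R a y) \<le> norm (8 * exp (3 * L\<^sup>2 / 4) * (gauss (4 * t) (x - y) * norm (a y)))"
        by (simp add: abs_mult mult.assoc)
    qed
  qed measurable
  have "heat t a x = (\<integral>y. gauss t (x - y) *\<^sub>R a y \<partial>lborel)"
    using t unfolding heat_def gauss_def by (simp, subst integral_completion) auto
  then have "heat t a x $ i = (\<integral>y. gauss t (x - y) * a y $ i \<partial>lborel)"
    using integral_bounded_linear[OF bounded_linear_vec_nth int, of i] by simp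
  moreover have "w0 (\<lambda>_. 0) (t, x) i = (\<integral>y. complex_of_real (gauss t (x - y) * a y $ i) \<partial>lborel)"
    using t cgauss_cvec[of t "x - _"] by (simp add: w0_def cvec_def)
  ultimately show ?thesis by (simp add: integral_complex_of_real del: of_real_mult)
qed

text \<open>The integrand of Duhamel's formula is identified only for almost every \<open>s\<close>,
  namely where the slice of the majorant is finite almost everywhere. \<open>G\<close> is an
  integrable version, zero outside the open time interval, in a form that can be shifted in
  time.\<close>

lemma duhamel:
  assumes t: "0 < t" and fin: "Uinf (t, x) < \<top>"
  shows "\<exists>G. integrable lborel G \<and> (\<forall>s. s \<notin> {0<..<t} \<longrightarrow> G s = 0) \<and>
     (AE s in lborel. 0 < s \<and> s < t \<longrightarrow> heat_leray_div (t - s) (\<lambda>y. tensor (v s y) (v s y)) x = G s) \<and>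
     v t x = heat t a x - (\<integral>s. G s \<partial>lborel)"
proof -
  have p: "(t, x) \<in> space (lborel \<Otimes>\<^sub>M lborel)" by (simp add: space_pair_measure)
  define F where "F i j l s y = K (\<lambda>_. 0) (t, x) (s, y) i j l * (Winf (\<lambda>_. 0) (s, y) j * Winf (\<lambda>_. 0) (s, y) l)" for i j l s y
  have int: "integrable (lborel \<Otimes>\<^sub>M lborel) (\<lambda>(s, y). F i j l s y)" for i j l
  proof -
    have "(\<lambda>(s, y). F i j l s y) = (\<lambda>p'. K (\<lambda>_. 0) (t, x) p' i j l * (Winf (\<lambda>_. 0) p' j * Winf (\<lambda>_. 0) p' l))"
      by (auto simp: F_def fun_eq_iff)
    then show ?thesis using integrable_term[OF zero_in_H p fin, of i j l] by simp
  qed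
  have int1: "integrable lborel (\<lambda>s. \<integral>y. F i j l s y \<partial>lborel)" for i j l
    using lborel_pair.integrable_fst'[OF int[of i j l]] by simp
  have fub: "(\<integral>p'. (case p' of (s, y) \<Rightarrow> F i j l s y) \<partial>(lborel \<Otimes>\<^sub>M lborel)) = (\<integral>s. \<integral>y. F i j l s y \<partial>lborel \<partial>lborel)" for i j l
    using lborel_pair.integral_fst'[OF int[of i j l]] by simp
  define C where "C i s = (\<Sum>j\<in>UNIV. \<Sum>l\<in>UNIV. \<integral>y. F i j l s y \<partial>lborel)" for i s
  have intC: "integrable lborel (C i)" for i
    unfolding C_def[abs_def] by (intro Bochner_Integration.integrable_sum int1)
  define G where "G s = (\<Sum>i\<in>UNIV. Re (C i s) *\<^sub>R (axis i 1 :: real^3))" for s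
  have Gi: "G s $ i = Re (C i s)" for s i
    by (simp add: G_def axis_def if_distrib[of "\<lambda>x. _ * x"] sum.delta cong: if_cong)
  have intG: "integrable lborel G"
    unfolding G_def[abs_def] by (intro Bochner_Integration.integrable_sum integrable_scaleR_left integrable_Re intC)
  have out: "G s = 0" if "s \<notin> {0<..<t}" for s
    using that by (auto simp: vec_eq_iff Gi C_def F_def K_def)
  \<comment> \<open>\<open>k (t, x)\<close> is positive for \<open>0 < s < t\<close>, so finiteness
    of the majorant at \<open>(t, x)\<close> forces it to be finite almost everywhere at earlier
    times.\<close>
  have AEU: "AE s in lborel. 0 < s \<and> s < t \<longrightarrow> (AE y in lborel. Uinf (s, y) < \<top>)"
  proof -
    have "AE p' in (lborel \<Otimes>\<^sub>M lborel). k (t, x) p' * (Uinf p')\<^sup>2 < \<top>" by (rule AE_kernel_finite[OF p fin])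
    then have "AE p' in (lborel \<Otimes>\<^sub>M lborel). 0 < fst p' \<and> fst p' < t \<longrightarrow> Uinf p' < \<top>"
    proof eventually_elim
      fix p' :: "real \<times> (real^3)" assume f: "k (t, x) p' * (Uinf p')\<^sup>2 < \<top>"
      show "0 < fst p' \<and> fst p' < t \<longrightarrow> Uinf p' < \<top>"
      proof
        assume s: "0 < fst p' \<and> fst p' < t"
        have "k (t, x) p' \<noteq> 0"
        proof -
          have "(\<integral>\<^sup>+r. ennreal (kernel_majorant L (t - fst p') (x - snd p') r) \<partial>lborel) \<noteq> 0"
          proof
            assume "(\<integral>\<^sup>+r. ennreal (kernel_majorant L (t - fst p') (x - snd p') r) \<partial>lborel) = 0"
            then have "AE r in lborel. ennreal (kernel_majorant L (t - fst p') (x - snd p') r) = 0"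
              by (subst (asm) nn_integral_0_iff_AE) auto
            then have "AE r in lborel. r \<notin> {t - fst p'<..<t - fst p' + 1}"
            proof eventually_elim
              fix r assume "ennreal (kernel_majorant L (t - fst p') (x - snd p') r) = 0"
              then have "kernel_majorant L (t - fst p') (x - snd p') r = 0"
                using kernel_majorant_nonneg[of L "t - fst p'" "x - snd p'" r] by (simp add: ennreal_eq_0_iff)
              then show "r \<notin> {t - fst p'<..<t - fst p' + 1}"
                using s kernel_const_pos[of L] gauss_pos[of "4 * r" "x - snd p'"] by (auto simp: kernel_majorant_def)
            qed
            then have "emeasure lborel {t - fst p'<..<t - fst p' + 1} = 0"
              using AE_iff_null_sets[of "{t - fst p'<..<t - fst p' + 1}" lborel] by (auto dest: null_setsD1)
            then show False by simp
          qed
          then show ?thesis using s by (simp add: k_def)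
        qed
        then show "Uinf p' < \<top>" using kernel_finite_cases[OF f] by blast
      qed
    qed
    then have "AE s in lborel. AE y in lborel. 0 < fst (s, y) \<and> fst (s, y) < t \<longrightarrow> Uinf (s, y) < \<top>"
      by (rule lborel_pair.AE_pair)
    then show ?thesis by eventually_elim auto
  qed
  have HLD: "AE s in lborel. 0 < s \<and> s < t \<longrightarrow> heat_leray_div (t - s) (\<lambda>y. tensor (v s y) (v s y)) x = G s"
    using AEU
  proof eventually_elim
    fix s assume ae: "0 < s \<and> s < t \<longrightarrow> (AE y in lborel. Uinf (s, y) < \<top>)"
    show "0 < s \<and> s < t \<longrightarrow> heat_leray_div (t - s) (\<lambda>y. tensor (v s y) (v s y)) x = G s"
    proof
      assume s: "0 < s \<and> s < t"
      have [measurable]: "v s \<in> borel_measurable borel" by (rule v_slice_measurable)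
      have [measurable]: "(\<lambda>y. heat_leray_div_kernel (t - s) (x - y) i j l) \<in> borel_measurable borel" for i j l
        using s by (intro heat_leray_div_kernel_measurable) simp
      have Fm: "(\<lambda>y. F i j l s y) \<in> borel_measurable borel" for i j l
        using measurable_Pair2[OF borel_measurable_integrable[OF int[of i j l]], of s] by (simp add: space_pair_measure)
      have "(LINT y|lebesgue. heat_leray_div_kernel (t - s) (x - y) i j l * (v s y $ j * v s y $ l)) = Re (\<integral>y. F i j l s y \<partial>lborel)" for i j l
      proof -
        have "(\<integral>y. F i j l s y \<partial>lborel) = (\<integral>y. complex_of_real (heat_leray_div_kernel (t - s) (x - y) i j l * (v s y $ j * v s y $ l)) \<partial>lborel)"
        proof (rule integral_cong_AE)
          have "AE y in lborel. Uinf (s, y) < \<top>" using ae s by blast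
          then show "AE y in lborel. F i j l s y = complex_of_real (heat_leray_div_kernel (t - s) (x - y) i j l * (v s y $ j * v s y $ l))"
          proof eventually_elim
            fix y assume u: "Uinf (s, y) < \<top>"
            have "K (\<lambda>_. 0) (t, x) (s, y) i j l = complex_of_real (heat_leray_div_kernel (t - s) (x - y) i j l)"
              using s by (simp add: heat_leray_div_kernel_eq K_def cvec_def)
            then show "F i j l s y = complex_of_real (heat_leray_div_kernel (t - s) (x - y) i j l * (v s y $ j * v s y $ l))"
              by (simp add: F_def Winf_eq_v[OF u])
          qed
        qed (use Fm in measurable)
        then have "Re (\<integral>y. F i j l s y \<partial>lborel) = (\<integral>y. heat_leray_div_kernel (t - s) (x - y) i j l * (v s y $ j * v s y $ l) \<partial>lborel)"
          by (simp add: integral_complex_of_real del: of_real_mult)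
        then show ?thesis by (subst integral_completion) auto
      qed
      then show "heat_leray_div (t - s) (\<lambda>y. tensor (v s y) (v s y)) x = G s"
        by (simp add: vec_eq_iff heat_leray_div_def Gi C_def tensor_def)
    qed
  qed
  have "v t x $ i = heat t a x $ i - (\<integral>s. G s \<partial>lborel) $ i" for i
  proof -
    have "(\<integral>p'. B (\<lambda>_. 0) (Winf (\<lambda>_. 0)) (t, x) p' i \<partial>(lborel \<Otimes>\<^sub>M lborel)) = (\<integral>p'. (\<Sum>j\<in>UNIV. \<Sum>l\<in>UNIV. (case p' of (s, y) \<Rightarrow> F i j l s y)) \<partial>(lborel \<Otimes>\<^sub>M lborel))"
      by (simp add: B_def F_def case_prod_beta)
    also have "\<dots> = (\<Sum>j\<in>UNIV. \<Sum>l\<in>UNIV. \<integral>s. \<integral>y. F i j l s y \<partial>lborel \<partial>lborel)"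
      by (subst Bochner_Integration.integral_sum, intro Bochner_Integration.integrable_sum int,
          subst Bochner_Integration.integral_sum, intro int, simp only: fub)
    also have "\<dots> = (\<integral>s. C i s \<partial>lborel)"
      unfolding C_def by (simp add: Bochner_Integration.integral_sum Bochner_Integration.integrable_sum int1)
    finally have e: "Winf (\<lambda>_. 0) (t, x) i = complex_of_real (heat t a x $ i) - (\<integral>s. C i s \<partial>lborel)"
      using Winf_eq(2)[OF zero_in_H p fin, of i] w0_eq_heat[OF t fin, of i] by simp
    have "(\<integral>s. G s \<partial>lborel) $ i = (\<integral>s. Re (C i s) \<partial>lborel)"
      using integral_bounded_linear[OF bounded_linear_vec_nth intG, of i] by (simp add: Gi)
    also have "\<dots> = Re (\<integral>s. C i s \<partial>lborel)" by (rule integral_Re[OF intC])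
    finally show ?thesis using e by (simp add: v_def)
  qed
  then have "v t x = heat t a x - (\<integral>s. G s \<partial>lborel)" by (simp add: vec_eq_iff)
  then show ?thesis using intG out HLD by blast
qed

text \<open>The solution with time moved to start at \<open>t0\<close>. At \<open>t0\<close> the
  value is the datum, so \<open>v\<close> enters at positive times only.\<close>

definition sol :: "real \<Rightarrow> real \<Rightarrow> real^3 \<Rightarrow> real^3" where
  "sol t0 s x = (if s \<le> t0 then a x else v (s - t0) x)"

lemma sol_measurable: "(\<lambda>p. sol t0 (fst p) (snd p)) \<in> borel_measurable borel"
proof -
  have vb: "(\<lambda>p. v (fst p) (snd p)) \<in> borel_measurable borel"
    using v_measurable by (simp add: lborel_prod)
  have "(\<lambda>p. (fst p - t0, snd p)) \<in> borel_measurable (borel :: (real \<times> (real^3)) measure)"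
    by (intro borel_measurable_continuous_onI continuous_intros)
  from measurable_compose[OF this vb] have [measurable]: "(\<lambda>p. v (fst p - t0) (snd p)) \<in> borel_measurable (borel :: (real \<times> (real^3)) measure)"
    by simp
  have [measurable]: "fst \<in> borel_measurable (borel :: (real \<times> (real^3)) measure)" "snd \<in> borel_measurable (borel :: (real \<times> (real^3)) measure)"
    by (intro borel_measurable_continuous_onI continuous_intros)+
  show ?thesis unfolding sol_def by measurable
qed

text \<open>\<open>f\<close> will be the given field at time \<open>t0\<close> and \<open>a\<close>
  its Borel version. The bound on \<open>Uinf\<close> makes it finite almost everywhere at each
  positive time, and at such points \<open>duhamel\<close> is the mild equation up to a shift of the
  time variable.\<close>

lemma mild_solution_sol:
  assumes q: "3 < q" and A: "Lq_bound q (\<lambda>x. ennreal (norm (a x))) A" "0 < A"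
    and U: "\<And>t. 0 < t \<Longrightarrow> t < T \<Longrightarrow> Lq_bound q (\<lambda>x. Uinf (t, x)) Q" and Q: "0 < Q"
    and f: "AE x in lebesgue. f x = a x"
  shows "mild_solution t0 T f (sol t0)"
  unfolding mild_solution_def
proof (intro conjI ballI)
  note q1 = three_less_ennreal(2)[OF q]
  have am: "a \<in> borel_measurable lebesgue" by (intro measurable_completion) simp
  have fm: "f \<in> borel_measurable lebesgue" by (rule borel_measurable_lebesgue_AE[OF am f])
  have vb: "Lq_bound q (\<lambda>x. ennreal (norm (v t x))) (3 * Q)" if "0 < t" "t < T" for t
    by (rule Lq_bound_mono[OF Lq_bound_cmult[OF U[OF that], of 3]]) (use Q q1 norm_v_le Uinf_measurable_slice in auto)
  have Ln: "Lq_norm q g \<le> ennreal (max A (3 * Q))" if "g \<in> borel_measurable borel" "Lq_bound q (\<lambda>x. ennreal (norm (g x))) c" "0 \<le> c" "c \<le> max A (3 * Q)" for g :: "real^3 \<Rightarrow> real^3" and c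
  proof -
    have gm: "g \<in> borel_measurable lebesgue" using that(1) by (intro measurable_completion) simp
    have "Lq_norm q g \<le> ennreal c"
      by (rule Lq_norm_le[OF gm _ _ _ q1 that(2,3)]) (use gm that(1) in auto)
    also have "\<dots> \<le> ennreal (max A (3 * Q))" using that(4) by (rule ennreal_leI)
    finally show ?thesis .
  qed
  show "\<exists>q>3. Lq_norm q f < \<infinity> \<and> (\<forall>t\<in>{t0..<t0 + T}. \<exists>M<\<infinity>. \<forall>s\<in>{t0..t}. Lq_norm q (sol t0 s) \<le> M)"
  proof (rule exI[of _ q], intro conjI ballI q)
    have "Lq_norm q f \<le> ennreal A"
    proof (rule Lq_norm_le[OF fm _ _ _ q1 A(1)])
      show "AE x in lebesgue. norm (f x) \<le> norm (a x)" using f by eventually_elim simp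
    qed (use fm A in auto)
    then show "Lq_norm q f < \<infinity>" by (simp add: le_less_trans)
    fix t assume t: "t \<in> {t0..<t0 + T}"
    show "\<exists>M<\<infinity>. \<forall>s\<in>{t0..t}. Lq_norm q (sol t0 s) \<le> M"
    proof (rule exI[of _ "ennreal (max A (3 * Q))"], intro conjI ballI)
      fix s assume s: "s \<in> {t0..t}"
      show "Lq_norm q (sol t0 s) \<le> ennreal (max A (3 * Q))"
      proof (cases "s \<le> t0")
        case True
        then have "sol t0 s = a" by (auto simp: sol_def fun_eq_iff)
        then show ?thesis using Ln[OF a_meas A(1)] A by simp
      next
        case False
        then have "sol t0 s = v (s - t0)" by (auto simp: sol_def fun_eq_iff)
        then show ?thesis using Ln[OF v_slice_measurable vb[of "s - t0"]] Q False s t by simp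
      qed
    qed simp
  qed
  have "(\<lambda>p. indicator ({t0..<t0 + T} \<times> UNIV) p *\<^sub>R sol t0 (fst p) (snd p)) \<in> borel_measurable borel"
  proof (rule borel_measurable_scaleR[OF _ sol_measurable])
    have "{t0..<t0 + T} \<times> (UNIV :: (real^3) set) \<in> sets (borel \<Otimes>\<^sub>M borel)" by (intro pair_measureI) auto
    then show "indicator ({t0..<t0 + T} \<times> (UNIV :: (real^3) set)) \<in> borel_measurable (borel :: (real \<times> (real^3)) measure)"
      unfolding borel_prod by (rule borel_measurable_indicator)
  qed
  then show "set_borel_measurable lebesgue ({t0..<t0 + T} \<times> UNIV) (\<lambda>(s, x). sol t0 s x)"
    unfolding set_borel_measurable_def by (intro measurable_completion) (simp add: case_prod_beta)
  fix t assume t: "t \<in> {t0..<t0 + T}"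
  show "AE x in lebesgue. set_integrable lebesgue {t0..t} (\<lambda>s. heat_leray_div (t - s) (\<lambda>y. tensor (sol t0 s y) (sol t0 s y)) x) \<and>
        sol t0 t x = heat (t - t0) f x - (LINT s:{t0..t}|lebesgue. heat_leray_div (t - s) (\<lambda>y. tensor (sol t0 s y) (sol t0 s y)) x)"
  proof (cases "t = t0")
    case True
    \<comment> \<open>At the initial time the integral extends over one point and
      \<open>heat\<close> is the identity, so what remains is \<open>f = a\<close> almost
      everywhere. The integrand is arbitrary there, and its measurability comes from
      completeness.\<close>
    have null: "AE s in lebesgue. indicator {t0..t0} s *\<^sub>R g s = 0" for g :: "real \<Rightarrow> real^3"
      using AE_completion[OF AE_lborel_singleton[of t0]] by eventually_elim auto
    have m0: "(\<lambda>s. indicator {t0..t0} s *\<^sub>R g s) \<in> borel_measurable lebesgue" for g :: "real \<Rightarrow> real^3"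
      by (rule borel_measurable_lebesgue_AE[OF _ null]) simp
    have i0: "integrable lebesgue (\<lambda>s. indicator {t0..t0} s *\<^sub>R g s)" for g :: "real \<Rightarrow> real^3"
      using integrable_cong_AE[OF m0 _ null, of "g"] by simp
    have l0: "(LINT s|lebesgue. indicator {t0..t0} s *\<^sub>R g s) = 0" for g :: "real \<Rightarrow> real^3"
      using integral_cong_AE[OF m0 _ null, of "g"] by simp
    show ?thesis using f
      by eventually_elim (simp add: True set_integrable_def set_lebesgue_integral_def i0 l0 sol_def heat_def del: atLeastAtMost_singleton)
  next
    case False
    then have t': "0 < t - t0" "t - t0 < T" using t by auto
    have heat_eq: "heat (t - t0) f x = heat (t - t0) a x" for x
    proof -
      have gm: "(\<lambda>y. (4 * pi * (t - t0)) powr (- 3/2) * exp (- (norm (x - y))\<^sup>2 / (4 * (t - t0)))) \<in> borel_measurable lebesgue"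
        by (intro measurable_completion) measurable
      have ae: "AE y in lebesgue. ((4 * pi * (t - t0)) powr (- 3/2) * exp (- (norm (x - y))\<^sup>2 / (4 * (t - t0)))) *\<^sub>R f y
          = ((4 * pi * (t - t0)) powr (- 3/2) * exp (- (norm (x - y))\<^sup>2 / (4 * (t - t0)))) *\<^sub>R a y"
        using f by eventually_elim simp
      have ne: "t - t0 \<noteq> 0" using t'(1) by simp
      show ?thesis unfolding heat_def if_not_P[OF ne]
        by (rule integral_cong_AE[OF borel_measurable_scaleR[OF gm fm] borel_measurable_scaleR[OF gm am] ae])
    qed
    have "AE x in lborel. Uinf (t - t0, x) < \<top>"
      by (rule locally_finite_AE[OF locally_finite_Lq_bound[OF q1 U[OF t'] Uinf_measurable_slice]])
    then have "AE x in lebesgue. Uinf (t - t0, x) < \<top>" by (rule AE_completion)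
    then show ?thesis
    proof eventually_elim
      fix x assume fin: "Uinf (t - t0, x) < \<top>"
      let ?D = "\<lambda>s. heat_leray_div (t - s) (\<lambda>y. tensor (sol t0 s y) (sol t0 s y)) x"
      obtain G where G: "integrable lborel G" "\<And>s. s \<notin> {0<..<t - t0} \<Longrightarrow> G s = 0"
        "AE s in lborel. 0 < s \<and> s < t - t0 \<longrightarrow> heat_leray_div (t - t0 - s) (\<lambda>y. tensor (v s y) (v s y)) x = G s"
        "v (t - t0) x = heat (t - t0) a x - (\<integral>s. G s \<partial>lborel)"
        using duhamel[OF t'(1) fin] by blast
      have Gm[measurable]: "G \<in> borel_measurable borel" using borel_measurable_integrable[OF G(1)] by simp
      have iG: "integrable lborel (\<lambda>s. G (s + - t0))" by (rule integrable_lborel_shift[OF G(1)])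
      have "AE s in lborel. indicator {t0..t} s *\<^sub>R ?D s = G (s + - t0)"
      proof -
        have [measurable]: "G \<in> borel_measurable borel" by (rule Gm)
        have "AE s in lborel. 0 < s - t0 \<and> s - t0 < t - t0 \<longrightarrow> heat_leray_div (t - t0 - (s - t0)) (\<lambda>y. tensor (v (s - t0) y) (v (s - t0) y)) x = G (s - t0)"
        proof -
          have "AE s in distr lborel borel ((+) (- t0)). 0 < s \<and> s < t - t0 \<longrightarrow> heat_leray_div (t - t0 - s) (\<lambda>y. tensor (v s y) (v s y)) x = G s"
            using G(3) by (simp only: lborel_distr_plus)
          then have "AE s in lborel. 0 < - t0 + s \<and> - t0 + s < t - t0 \<longrightarrow> heat_leray_div (t - t0 - (- t0 + s)) (\<lambda>y. tensor (v (- t0 + s) y) (v (- t0 + s) y)) x = G (- t0 + s)"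
            by (rule AE_distrD[rotated]) measurable
          then show ?thesis by (simp add: add.commute)
        qed
        then show ?thesis using AE_lborel_singleton[of t0] AE_lborel_singleton[of t]
        proof eventually_elim
          fix s assume h: "0 < s - t0 \<and> s - t0 < t - t0 \<longrightarrow> heat_leray_div (t - t0 - (s - t0)) (\<lambda>y. tensor (v (s - t0) y) (v (s - t0) y)) x = G (s - t0)"
            and "s \<noteq> t0" "s \<noteq> t"
          show "indicator {t0..t} s *\<^sub>R ?D s = G (s + - t0)"
          proof (cases "t0 < s \<and> s < t")
            case True
            then have "sol t0 s = v (s - t0)" by (auto simp: sol_def fun_eq_iff)
            then show ?thesis using h True by simp
          next
            case False
            then show ?thesis using G(2)[of "s - t0"] \<open>s \<noteq> t0\<close> \<open>s \<noteq> t\<close> by (auto simp: indicator_def)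
          qed
        qed
      qed
      then have ae: "AE s in lebesgue. indicator {t0..t} s *\<^sub>R ?D s = G (s + - t0)" by (rule AE_completion)
      have Gm': "(\<lambda>s. G (s + - t0)) \<in> borel_measurable lebesgue" by (intro measurable_completion) measurable
      have Dm: "(\<lambda>s. indicator {t0..t} s *\<^sub>R ?D s) \<in> borel_measurable lebesgue" by (rule borel_measurable_lebesgue_AE[OF Gm' ae])
      have "integrable lebesgue (\<lambda>s. G (s + - t0))" using iG by (subst integrable_completion) auto
      then have 1: "integrable lebesgue (\<lambda>s. indicator {t0..t} s *\<^sub>R ?D s)"
        by (subst integrable_cong_AE[OF Dm Gm' ae])
      have "(LINT s|lebesgue. indicator {t0..t} s *\<^sub>R ?D s) = (LINT s|lebesgue. G (s + - t0))"
        by (rule integral_cong_AE[OF Dm Gm' ae])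
      also have "\<dots> = (\<integral>s. G (s + - t0) \<partial>lborel)" by (rule integral_completion) measurable
      also have "\<dots> = (\<integral>s. G s \<partial>lborel)" by (rule integral_lborel_shift) measurable
      finally have 2: "(LINT s|lebesgue. indicator {t0..t} s *\<^sub>R ?D s) = (\<integral>s. G s \<partial>lborel)" .
      show "set_integrable lebesgue {t0..t} ?D \<and> sol t0 t x = heat (t - t0) f x - (LINT s:{t0..t}|lebesgue. ?D s)"
        using 1 2 G(4) t'(1) by (simp add: set_integrable_def set_lebesgue_integral_def sol_def heat_eq)
    qed
  qed
qed

end

section \<open>Derivatives of the mild solution\<close>

lemma integrable_test_mult:
  fixes w :: "real^3 \<Rightarrow> 'b::{banach, second_countable_topology}"
  assumes U: "locally_finite U" and w[measurable]: "w \<in> borel_measurable borel"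
    and wU: "\<And>x. ennreal (norm (w x)) \<le> ennreal C * U x" and C: "0 \<le> C" and \<psi>: "test_function \<psi>"
  shows "integrable lborel (\<lambda>x. \<psi> x *\<^sub>R w x)"
proof -
  obtain r where r: "0 < r" "\<And>x. \<psi> x \<noteq> 0 \<Longrightarrow> norm x \<le> r" using test_function_support[OF \<psi>] by blast
  obtain b where b: "0 < b" "\<And>x. norm (\<psi> x) \<le> b" using test_function_bounded[OF \<psi>] by blast
  have [measurable]: "\<psi> \<in> borel_measurable borel" by (rule test_function_measurable[OF \<psi>])
  show ?thesis
  proof (rule Bochner_Integration.integrable_bound[OF locally_finite_integrable[OF U, of "b * C" r]])
    show "AE x in lborel. norm (\<psi> x *\<^sub>R w x) \<le> norm (b * C * enn2real (U x) * indicator (cball 0 r) x)"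
      using locally_finite_AE[OF U]
    proof eventually_elim
      fix x assume u: "U x < \<top>"
      have "norm (w x) \<le> C * enn2real (U x)"
      proof -
        have "ennreal (norm (w x)) \<le> ennreal (C * enn2real (U x))" using wU[of x] u C by (simp add: ennreal_mult)
        then show ?thesis using C by (subst (asm) ennreal_le_iff) auto
      qed
      then have "norm (\<psi> x) * norm (w x) \<le> b * (C * enn2real (U x))" using b by (intro mult_mono b) auto
      then show "norm (\<psi> x *\<^sub>R w x) \<le> norm (b * C * enn2real (U x) * indicator (cball 0 r) x)"
        using r(2)[of x] b C by (cases "\<psi> x = 0") (auto simp: abs_mult)
    qed
  qed measurable
qed

lemma locally_integrable_dominated:
  fixes w f :: "real^3 \<Rightarrow> real^3"
  assumes U: "locally_finite U" and w[measurable]: "w \<in> borel_measurable borel"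
    and wU: "\<And>x. ennreal (norm (w x)) \<le> ennreal C * U x" and C: "0 \<le> C" and f: "AE x in lebesgue. f x = w x"
  shows "locally_integrable f"
  unfolding locally_integrable_def set_integrable_def
proof (intro allI impI)
  fix S :: "(real^3) set" assume S: "compact S"
  then obtain r where r: "\<And>x. x \<in> S \<Longrightarrow> norm x \<le> r" using compact_imp_bounded bounded_iff by metis
  have [measurable]: "S \<in> sets borel" using S by (simp add: compact_imp_closed)
  have "integrable lborel (\<lambda>x. indicator S x *\<^sub>R w x)"
  proof (rule Bochner_Integration.integrable_bound[OF locally_finite_integrable[OF U, of C r]])
    show "AE x in lborel. norm (indicator S x *\<^sub>R w x) \<le> norm (C * enn2real (U x) * indicator (cball 0 r) x)"
      using locally_finite_AE[OF U]
    proof eventually_elim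
      fix x assume u: "U x < \<top>"
      have "ennreal (norm (w x)) \<le> ennreal (C * enn2real (U x))" using wU[of x] u C by (simp add: ennreal_mult)
      then have "norm (w x) \<le> C * enn2real (U x)" using C by (subst (asm) ennreal_le_iff) auto
      then show "norm (indicator S x *\<^sub>R w x) \<le> norm (C * enn2real (U x) * indicator (cball 0 r) x)"
        using r[of x] C by (cases "x \<in> S") (auto simp: abs_mult)
    qed
  qed measurable
  then have i: "integrable lebesgue (\<lambda>x. indicator S x *\<^sub>R w x)" by (subst integrable_completion) auto
  have ae: "AE x in lebesgue. indicator S x *\<^sub>R f x = indicator S x *\<^sub>R w x" using f by eventually_elim simp
  have "(\<lambda>x. indicator S x *\<^sub>R f x) \<in> borel_measurable lebesgue"
    by (rule borel_measurable_lebesgue_AE[OF borel_measurable_integrable[OF i] ae])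
  from integrable_cong_AE[OF this borel_measurable_integrable[OF i] ae] i
  show "integrable lebesgue (\<lambda>x. indicator S x *\<^sub>R f x)" by simp
qed

lemma finite_lists3: "finite {is :: 3 list. length is = n}"
  using finite_lists_length_eq[of "UNIV :: 3 set" n] by simp

text \<open>Counts the lists of \<open>n\<close> directions times the three components of the
  field.\<close>

definition num_partials :: "nat \<Rightarrow> real" where
  "num_partials n = 3 * real (card {is :: 3 list. length is = n})"

lemma num_partials_pos: "0 < num_partials n"
proof -
  have "replicate n 1 \<in> {is :: 3 list. length is = n}" by simp
  then have "card {is :: 3 list. length is = n} \<noteq> 0" using finite_lists3[of n] by (metis card_eq_0_iff empty_iff)
  then show ?thesis by (simp add: num_partials_def)
qed

lemma sqrt_sum_squares_le: "sqrt (\<Sum>i\<in>A. (f i)\<^sup>2) \<le> (\<Sum>i\<in>A. \<bar>f i\<bar>)"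
  using L2_set_le_sum_abs[of f A] by (simp add: L2_set_def)

context ns_data
begin

definition dv :: "real \<Rightarrow> 3 list \<Rightarrow> 3 \<Rightarrow> real^3 \<Rightarrow> complex" where
  "dv t is i = shift_derivs is (\<lambda>\<eta> x. Winf \<eta> (t, x) i) (\<lambda>_. 0)"

text \<open>A derivative with respect to the shift at time \<open>t\<close> is \<open>sqrt t\<close>
  times a derivative in space; the power of \<open>1 / sqrt t\<close> undoes this.\<close>

definition grad_v :: "real \<Rightarrow> 3 list \<Rightarrow> real^3 \<Rightarrow> real^3" where
  "grad_v t is x = (\<chi> i. (1 / sqrt t) ^ length is * Re (dv t is i x))"

lemma dv_translatable:
  "0 < t \<Longrightarrow> translatable (L - 2 * real (length is)) (sqrt t) (\<lambda>x. Uinf (t, x)) (shift_derivs is (\<lambda>\<eta> x. Winf \<eta> (t, x) i))"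
  by (rule shift_derivs_translatable[OF Winf_slice_translatable])

lemma dv_measurable: "0 < t \<Longrightarrow> dv t is i \<in> borel_measurable borel"
  unfolding dv_def by (rule translatableD(1)[OF dv_translatable])

lemma dv_le:
  assumes "0 < t" "2 * real (length is) \<le> L"
  shows "ennreal (norm (dv t is i x)) \<le> Uinf (t, x)"
  unfolding dv_def by (rule translatableD(3)[OF dv_translatable[OF assms(1)]]) (use assms in \<open>simp add: polydisc_def\<close>)

lemma norm_grad_v_le:
  assumes "0 < t"
  shows "norm (grad_v t is x) \<le> (1 / sqrt t) ^ length is * (\<Sum>i\<in>UNIV. norm (dv t is i x))"
proof -
  have "norm (grad_v t is x) \<le> (\<Sum>i\<in>UNIV. \<bar>grad_v t is x $ i\<bar>)" by (rule norm_le_l1_cart)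
  also have "\<dots> \<le> (\<Sum>i\<in>UNIV. (1 / sqrt t) ^ length is * norm (dv t is i x))"
    using assms by (intro sum_mono) (auto simp: grad_v_def abs_mult intro!: mult_left_mono abs_Re_le_cmod)
  finally show ?thesis by (simp add: sum_distrib_left)
qed

lemma grad_v_measurable: "0 < t \<Longrightarrow> grad_v t is \<in> borel_measurable borel"
  using dv_measurable[of t "is"] unfolding grad_v_def[abs_def]
  by (subst borel_measurable_euclidean_space) (auto simp: Basis_vec3 inner_axis)

lemma grad_v_le_Uinf:
  assumes "0 < t" "2 * real (length is) \<le> L"
  shows "ennreal (norm (grad_v t is x)) \<le> ennreal (3 * (1 / sqrt t) ^ length is) * Uinf (t, x)"
proof -
  have "ennreal (norm (grad_v t is x)) \<le> ennreal ((1 / sqrt t) ^ length is * (\<Sum>i\<in>UNIV. norm (dv t is i x)))"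
    by (rule ennreal_leI[OF norm_grad_v_le[OF assms(1)]])
  also have "\<dots> = ennreal ((1 / sqrt t) ^ length is) * (\<Sum>i\<in>UNIV. ennreal (norm (dv t is i x)))"
    using assms by (simp add: ennreal_mult sum_nonneg)
  also have "\<dots> \<le> ennreal ((1 / sqrt t) ^ length is) * (\<Sum>i\<in>(UNIV::3 set). Uinf (t, x))"
    by (intro mult_left_mono sum_mono dv_le assms) auto
  also have "\<dots> = ennreal (3 * (1 / sqrt t) ^ length is) * Uinf (t, x)"
    using assms by (simp add: ennreal_mult mult_ac)
  finally show ?thesis .
qed

text \<open>Component by component this is the real part of \<open>weak_partial_shift_derivs\<close>
  for the complex extension at zero shift; \<open>f\<close> differs from \<open>v t\<close> on a
  null set only.\<close>

lemma weak_partial_v: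
  assumes t: "0 < t" and L: "2 * real (length is) \<le> L" and U: "locally_finite (\<lambda>x. Uinf (t, x))" and f: "AE x in lebesgue. f x = v t x"
  shows "weak_partial is f (grad_v t is)"
  unfolding weak_partial_def
proof (intro conjI allI impI)
  have [measurable]: "v t \<in> borel_measurable borel" by (rule v_slice_measurable)
  have gvm [measurable]: "grad_v t is \<in> borel_measurable borel" by (rule grad_v_measurable[OF t])
  have vU: "ennreal (norm (v t x)) \<le> ennreal 3 * Uinf (t, x)" for x using norm_v_le by simp
  have c0: "0 \<le> 3 * (1 / sqrt t) ^ length is" using t by simp
  show "locally_integrable f"
    by (rule locally_integrable_dominated[OF U _ vU _ f]) auto
  show "locally_integrable (grad_v t is)"
    by (rule locally_integrable_dominated[OF U gvm grad_v_le_Uinf[OF t L] c0]) simp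
  fix \<phi> assume \<phi>: "test_function \<phi>"
  let ?\<psi> = "iter_partial is \<phi>"
  have \<psi>: "test_function ?\<psi>" by (rule test_function_iter_partial[OF \<phi>])
  have [measurable]: "\<phi> \<in> borel_measurable borel" "?\<psi> \<in> borel_measurable borel"
    using test_function_measurable \<phi> \<psi> by auto
  have Wm: "(\<lambda>x. Winf (\<lambda>_. 0) (t, x) i) \<in> borel_measurable borel" for i by (rule Winf_measurable_slice)
  have Wi: "integrable lborel (\<lambda>x. ?\<psi> x *\<^sub>R Winf (\<lambda>_. 0) (t, x) i)" for i
    by (rule integrable_test_mult[OF U Wm _ _ \<psi>, of i 1]) (use norm_Winf_le[OF zero_in_H] in \<open>auto simp: space_pair_measure\<close>)
  have Di: "integrable lborel (\<lambda>x. \<phi> x *\<^sub>R ((1 / sqrt t) ^ length is *\<^sub>R dv t is i x))" for i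
  proof (rule integrable_test_mult[OF U _ _ _ \<phi>, of _ "(1 / sqrt t) ^ length is"])
    show "(\<lambda>x. (1 / sqrt t) ^ length is *\<^sub>R dv t is i x) \<in> borel_measurable borel"
      using dv_measurable[OF t, of "is" i] by measurable
    show "ennreal (norm ((1 / sqrt t) ^ length is *\<^sub>R dv t is i x)) \<le> ennreal ((1 / sqrt t) ^ length is) * Uinf (t, x)" for x
      using dv_le[OF t L, of i x] t by (simp add: ennreal_mult abs_mult mult_left_mono)
  qed (use t in simp)
  have vi: "integrable lborel (\<lambda>x. ?\<psi> x *\<^sub>R v t x)" by (rule integrable_test_mult[OF U _ vU _ \<psi>]) auto
  have gi: "integrable lborel (\<lambda>x. \<phi> x *\<^sub>R grad_v t is x)"
    by (rule integrable_test_mult[OF U gvm grad_v_le_Uinf[OF t L] c0 \<phi>])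
  have vm: "v t \<in> borel_measurable lebesgue" "?\<psi> \<in> borel_measurable lebesgue" by (intro measurable_completion; simp)+
  have "(LINT x|lebesgue. ?\<psi> x *\<^sub>R f x) = (LINT x|lebesgue. ?\<psi> x *\<^sub>R v t x)"
  proof (rule integral_cong_AE)
    show "AE x in lebesgue. ?\<psi> x *\<^sub>R f x = ?\<psi> x *\<^sub>R v t x" using f by eventually_elim simp
  qed (intro borel_measurable_scaleR vm borel_measurable_lebesgue_AE[OF vm(1) f])+
  also have "\<dots> = (\<integral>x. ?\<psi> x *\<^sub>R v t x \<partial>lborel)" by (rule integral_completion) measurable
  also have "\<dots> = (- 1) ^ length is *\<^sub>R (\<integral>x. \<phi> x *\<^sub>R grad_v t is x \<partial>lborel)"
  proof (rule vec_eq_iff[THEN iffD2], rule allI)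
    fix i
    have "(\<integral>x. ?\<psi> x *\<^sub>R v t x \<partial>lborel) $ i = (\<integral>x. Re (?\<psi> x *\<^sub>R Winf (\<lambda>_. 0) (t, x) i) \<partial>lborel)"
      using integral_bounded_linear[OF bounded_linear_vec_nth vi, of i] by (simp add: v_def)
    also have "\<dots> = Re (\<integral>x. ?\<psi> x *\<^sub>R Winf (\<lambda>_. 0) (t, x) i \<partial>lborel)" by (rule integral_Re[OF Wi])
    also have "(\<integral>x. ?\<psi> x *\<^sub>R Winf (\<lambda>_. 0) (t, x) i \<partial>lborel)
        = (- 1) ^ length is *\<^sub>R (\<integral>x. \<phi> x *\<^sub>R ((1 / sqrt t) ^ length is *\<^sub>R dv t is i x) \<partial>lborel)"
      unfolding dv_def
      by (rule weak_partial_shift_derivs[OF _ U \<phi> Winf_slice_translatable[OF t] L]) (use t in simp)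
    also have "Re \<dots> = (- 1) ^ length is * (\<integral>x. Re (\<phi> x *\<^sub>R ((1 / sqrt t) ^ length is *\<^sub>R dv t is i x)) \<partial>lborel)"
      by (subst integral_Re[OF Di]) simp
    also have "(\<integral>x. Re (\<phi> x *\<^sub>R ((1 / sqrt t) ^ length is *\<^sub>R dv t is i x)) \<partial>lborel) = (\<integral>x. \<phi> x *\<^sub>R grad_v t is x \<partial>lborel) $ i"
    proof -
      have "Re (\<phi> x *\<^sub>R ((1 / sqrt t) ^ length is *\<^sub>R dv t is i x)) = (\<phi> x *\<^sub>R grad_v t is x) $ i" for x
        by (simp add: grad_v_def)
      then show ?thesis
        using integral_bounded_linear[OF bounded_linear_vec_nth gi, of i] by (simp only:)
    qed
    finally show "(\<integral>x. ?\<psi> x *\<^sub>R v t x \<partial>lborel) $ i = ((- 1) ^ length is *\<^sub>R (\<integral>x. \<phi> x *\<^sub>R grad_v t is x \<partial>lborel)) $ i"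
      by simp
  qed
  also have "(\<integral>x. \<phi> x *\<^sub>R grad_v t is x \<partial>lborel) = (LINT x|lebesgue. \<phi> x *\<^sub>R grad_v t is x)"
    by (rule integral_completion[symmetric]) measurable
  finally show "(LINT x|lebesgue. ?\<psi> x *\<^sub>R f x) = (- 1) ^ length is *\<^sub>R (LINT x|lebesgue. \<phi> x *\<^sub>R grad_v t is x)" .
qed

text \<open>Of the radius \<open>L\<close>, the part \<open>2 * n\<close> is spent on derivatives
  and the remaining 1 on the averaging in \<open>translatable_sup_bound\<close>.\<close>

lemma grad_norm_v_le:
  assumes q: "3 < q1" "q1 \<le> q2" and t: "0 < t" and L: "2 * real n + 1 \<le> L"
    and U: "Lq_bound q1 (\<lambda>x. Uinf (t, x)) Q" and Q: "0 < Q" and f: "AE x in lebesgue. f x = v t x"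
  shows "grad_norm n q2 f \<le> ennreal ((1 / sqrt t) ^ n * (num_partials n * Q * sqrt t powr (three_over q2 - three_over q1)))"
proof -
  note q1 = three_less_ennreal(2)[OF q(1)]
  have q21: "1 \<le> q2" using q1 q(2) by (rule order_trans)
  have lf: "locally_finite (\<lambda>x. Uinf (t, x))" by (rule locally_finite_Lq_bound[OF q1 U Uinf_measurable_slice])
  let ?S = "{is :: 3 list. length is = n}"
  \<comment> \<open>One scalar function that, up to the power of \<open>sqrt t\<close>, dominates
    the Euclidean norm of the whole array. Both the integral bound and the pointwise bound are
    proved for it and then interpolated.\<close>
  define h where "h x = (\<Sum>is\<in>?S. \<Sum>i\<in>UNIV. norm (dv t is i x))" for x
  have [measurable]: "dv t is i \<in> borel_measurable borel" for "is" i by (rule dv_measurable[OF t])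
  have hm [measurable]: "h \<in> borel_measurable borel" unfolding h_def[abs_def] by measurable
  have h0: "0 \<le> h x" for x unfolding h_def by (intro sum_nonneg) auto
  have hU: "ennreal (h x) \<le> ennreal (num_partials n) * Uinf (t, x)" for x
  proof -
    have "ennreal (h x) = (\<Sum>is\<in>?S. \<Sum>i\<in>UNIV. ennreal (norm (dv t is i x)))"
      unfolding h_def by (simp add: sum_nonneg flip: sum_ennreal)
    also have "\<dots> \<le> (\<Sum>is\<in>?S. \<Sum>i\<in>(UNIV::3 set). Uinf (t, x))"
      using L by (intro sum_mono dv_le t) auto
    also have "\<dots> = ennreal (num_partials n) * Uinf (t, x)"
      by (simp add: num_partials_def ennreal_mult ennreal_of_nat_eq_real_of_nat mult_ac)
    finally show ?thesis .
  qed
  have hq1: "Lq_bound q1 (\<lambda>x. ennreal (h x)) (num_partials n * Q)"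
    by (rule Lq_bound_mono[OF Lq_bound_cmult[OF U, of "num_partials n"] hU])
      (use num_partials_pos[of n] Q q1 Uinf_measurable_slice in auto)
  have hsup: "h x \<le> num_partials n * Q * sqrt t powr (- three_over q1)" for x
  proof -
    have "h x \<le> (\<Sum>is\<in>?S. \<Sum>i\<in>(UNIV::3 set). Q * sqrt t powr (- three_over q1))"
      unfolding h_def
    proof (intro sum_mono)
      fix "is" :: "3 list" and i assume "is \<in> ?S"
      then show "norm (dv t is i x) \<le> Q * sqrt t powr (- three_over q1)"
        unfolding dv_def using L t by (intro translatable_sup_bound[OF dv_translatable[OF t] _ _ q1 U Q]) auto
    qed
    also have "\<dots> = num_partials n * Q * sqrt t powr (- three_over q1)" by (simp add: num_partials_def)
    finally show ?thesis .
  qed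
  have hq2: "Lq_bound q2 (\<lambda>x. ennreal (h x)) (num_partials n * Q * sqrt t powr (three_over q2 - three_over q1))"
    by (rule Lq_bound_interpolate[OF q1 q(2) hq1 h0 hsup]) (use num_partials_pos[of n] Q t in auto)
  let ?c = "num_partials n * Q * sqrt t powr (three_over q2 - three_over q1)"
  have c: "0 \<le> ?c" using num_partials_pos[of n] Q by (simp add: less_imp_le)
  let ?F = "\<lambda>x. sqrt (\<Sum>is\<in>?S. (norm (grad_v t is x))\<^sup>2)"
  have [measurable]: "grad_v t is \<in> borel_measurable borel" for "is" by (rule grad_v_measurable[OF t])
  have Fm: "?F \<in> borel_measurable borel" by measurable
  have Fm': "?F \<in> borel_measurable lebesgue" by (intro measurable_completion) (use Fm in simp)
  have "Lq_norm q2 ?F \<le> ennreal ((1 / sqrt t) ^ n * ?c)"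
  proof (rule Lq_norm_le[OF Fm' _ _ _ q21])
    show "AE x in lebesgue. norm (?F x) \<le> (1 / sqrt t) ^ n * h x"
    proof (rule AE_I2)
      fix x
      have "?F x \<le> (\<Sum>is\<in>?S. \<bar>norm (grad_v t is x)\<bar>)" by (rule sqrt_sum_squares_le)
      also have "\<dots> \<le> (\<Sum>is\<in>?S. (1 / sqrt t) ^ n * (\<Sum>i\<in>UNIV. norm (dv t is i x)))"
        using norm_grad_v_le[OF t] by (intro sum_mono) auto
      also have "\<dots> = (1 / sqrt t) ^ n * h x" by (simp add: h_def sum_distrib_left)
      finally show "norm (?F x) \<le> (1 / sqrt t) ^ n * h x" by (simp add: sum_nonneg)
    qed
    show "Lq_bound q2 (\<lambda>x. ennreal ((1 / sqrt t) ^ n * h x)) ((1 / sqrt t) ^ n * ?c)"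
      using Lq_bound_cmult[OF hq2, of "(1 / sqrt t) ^ n"] t c q21 h0 by (simp add: ennreal_mult)
  qed (use Fm' t c in \<open>auto intro!: mult_nonneg_nonneg\<close>)
  moreover have "grad_norm n q2 f \<le> Lq_norm q2 ?F"
    unfolding grad_norm_def using L
    by (intro INF_lower2[where i="grad_v t"]) (auto intro!: weak_partial_v[OF t _ lf f])
  ultimately show ?thesis by (rule order_trans[rotated])
qed

end

section \<open>Comparison of the time sets\<close>

text \<open>The sets may fail to be measurable, so a measurable cover of \<open>E\<close> with the
  same outer measure is translated in its place.\<close>

lemma time_measure_shift_le:
  assumes "\<And>t. t \<in> S \<Longrightarrow> t - c \<in> E"
  shows "time_measure S \<le> time_measure E"
proof -
  obtain F where F: "F \<in> sets lebesgue" "E \<subseteq> F" "outer_measure_of lebesgue E = emeasure lebesgue F"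
    using outer_measure_of_attain[of E lebesgue] by auto
  have S: "S \<subseteq> (\<lambda>x. c + x) ` F"
  proof
    fix t assume "t \<in> S"
    then have "t - c \<in> F" using assms F by blast
    then show "t \<in> (\<lambda>x. c + x) ` F" by (intro image_eqI[of _ _ "t - c"]) auto
  qed
  have m: "(\<lambda>x. c + x) ` F \<in> sets lebesgue" using F(1) by (rule lebesgue_sets_translation)
  have "time_measure S \<le> outer_measure_of lebesgue ((\<lambda>x. c + x) ` F)"
    unfolding time_measure_def by (rule outer_measure_of_mono[OF S])
  also have "\<dots> = emeasure lebesgue ((\<lambda>x. 1 *\<^sub>R x + c) ` F)"
    using outer_measure_of_eq[OF m] by (simp add: add.commute)
  also have "\<dots> = emeasure lebesgue F" by (subst emeasure_lebesgue_affine) simp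
  finally show ?thesis using F(3) by (simp add: time_measure_def)
qed

lemma three_over_range:
  assumes "3 < q"
  shows "0 \<le> three_over q / 2" "three_over q / 2 < 1/2"
proof -
  have "3 < enn2real q" if "q \<noteq> \<infinity>"
    using assms that by (cases q) (auto simp: ennreal_less_iff[symmetric] simp flip: ennreal_numeral)
  then show "0 \<le> three_over q / 2" "three_over q / 2 < 1/2" by (auto simp: three_over_def)
qed

text \<open>The contrapositive form of the comparison: a small norm at one time gives a small
  derivative at the time \<open>r\<^sup>2\<close> later. The constants are fixed before
  \<open>u\<close>, \<open>T\<close>, \<open>t0\<close> and \<open>r\<close>, and must not depend on
  them.\<close>

lemma smoothing_from_good_time:
  fixes q1 q2 :: ennreal and n :: nat
  assumes q: "3 < q1" "q1 \<le> q2"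
  shows "\<exists>c1 c3 :: real. 0 < c1 \<and> 0 < c3 \<and>
    (\<forall>u T t0 r. navier_stokes_solution T u \<longrightarrow> 0 \<le> t0 \<longrightarrow> 0 < r \<longrightarrow> t0 + r\<^sup>2 \<le> T \<longrightarrow>
      grad_norm 0 q1 (u t0) < ennreal (c3 * r powr (three_over q1 - 1)) \<longrightarrow>
      grad_norm n q2 (u (t0 + r\<^sup>2)) < ennreal (c1 * r powr (three_over q2 - real n - 1)))"
proof -
  define L where "L = 2 * real n + 1"
  define \<kappa> where "\<kappa> = three_over q1 / 2"
  have \<kappa>: "0 \<le> \<kappa>" "\<kappa> < 1/2" using three_over_range[OF q(1)] by (auto simp: \<kappa>_def)
  define d where "d = ns_data.dconst L q1"
  define e where "e = 16 * exp (3 * L\<^sup>2 / 4)"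
  \<comment> \<open>Makes \<open>2 * d * e * c3 = 1/2\<close>, which is the smallness condition once
    the powers of \<open>r\<close> have cancelled.\<close>
  define c3 where "c3 = 1 / (4 * d * e)"
  \<comment> \<open>The added 1 turns the final bound into a strict inequality.\<close>
  define c1 where "c1 = num_partials n * e * c3 + 1"
  have L0: "0 \<le> L" by (simp add: L_def)
  \<comment> \<open>\<open>dconst\<close> depends on \<open>L\<close> and the exponent only, so its
    positivity can be read off for the zero datum before the actual one is known.\<close>
  have nsd: "ns_data (\<lambda>_. 0) L" by unfold_locales (auto simp: L0)
  have d: "0 < d" using ns_data.dconst_pos[OF nsd, of q1] \<kappa> by (simp add: d_def \<kappa>_def)
  have e: "0 < e" by (simp add: e_def)
  have c3: "0 < c3" using d e by (simp add: c3_def)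
  have c1: "0 < c1" using num_partials_pos[of n] e c3 by (simp add: c1_def add_pos_pos)
  note q11 = three_less_ennreal(2)[OF q(1)]
  show ?thesis
  proof (intro exI conjI allI impI c1 c3)
    fix u :: "real \<Rightarrow> real^3 \<Rightarrow> real^3" and T t0 r :: real
    assume u: "navier_stokes_solution T u" and t0: "0 \<le> t0" and r: "0 < r" and T: "t0 + r\<^sup>2 \<le> T"
      and good: "grad_norm 0 q1 (u t0) < ennreal (c3 * r powr (three_over q1 - 1))"
    define A where "A = c3 * r powr (three_over q1 - 1)"
    have A: "0 < A" using c3 r by (simp add: A_def)
    obtain a where a: "a \<in> borel_measurable borel" "AE x in lebesgue. u t0 x = a x" "Lq_bound q1 (\<lambda>x. ennreal (norm (a x))) A"
      using grad_norm_0_less[OF good[folded A_def] q11 A] by blast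
    interpret ns_data a L by unfold_locales (auto simp: a L0)
    \<comment> \<open>Mild solutions live on half-open intervals, so the lifetime must exceed
      \<open>r\<^sup>2\<close>; doubling it costs at most the factor 2 in the smallness
      condition.\<close>
    define S where "S = 2 * r\<^sup>2"
    have rS: "r\<^sup>2 < S" "0 < r\<^sup>2" using r by (auto simp: S_def)
    have small: "dconst q1 * S powr (1/2 - \<kappa>) * (16 * exp (3 * L\<^sup>2 / 4) * A) \<le> 1/2"
    proof -
      have "S powr (1/2 - \<kappa>) = 2 powr (1/2 - \<kappa>) * (r powr 2) powr (1/2 - \<kappa>)"
        using r by (simp add: S_def powr_mult powr_numeral)
      also have "\<dots> \<le> 2 powr 1 * (r powr 2) powr (1/2 - \<kappa>)"
        using \<kappa> by (intro mult_right_mono powr_mono) auto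
      also have "(r powr 2) powr (1/2 - \<kappa>) = r powr (1 - three_over q1)"
        unfolding powr_powr by (simp add: \<kappa>_def algebra_simps)
      finally have S: "S powr (1/2 - \<kappa>) \<le> 2 * r powr (1 - three_over q1)" by simp
      have "d * S powr (1/2 - \<kappa>) * (e * A) \<le> d * (2 * r powr (1 - three_over q1)) * (e * A)"
        using d e A by (intro mult_right_mono mult_left_mono S) auto
      also have "\<dots> = 2 * d * e * c3 * (r powr (1 - three_over q1) * r powr (three_over q1 - 1))"
        by (simp add: A_def)
      also have "r powr (1 - three_over q1) * r powr (three_over q1 - 1) = 1"
        using r by (simp add: powr_add[symmetric])
      also have "2 * d * e * c3 * 1 = 1/2" using d e by (simp add: c3_def)
      finally show ?thesis by (simp add: d_def e_def)
    qed
    have U: "Lq_bound q1 (\<lambda>x. Uinf (t, x)) (e * A)" if "0 < t" "t \<le> S" for t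
      by (rule Uinf_bound[OF q(1) \<kappa>_def \<kappa> a(3) A _ _ that]) (use small in \<open>auto simp: e_def\<close>)
    have eA: "0 < e * A" using e A by simp
    have mild: "mild_solution t0 S (u t0) (sol t0)"
      by (rule mild_solution_sol[OF q(1) a(3) A U eA a(2)]) auto
    have agree: "0 \<le> t0 \<and> t0 \<le> T \<and> 0 < S \<and> mild_solution t0 S (u t0) (sol t0) \<longrightarrow>
        (\<forall>t\<in>{t0..<t0 + S}. t \<le> T \<longrightarrow> (AE x in lebesgue. u t x = sol t0 t x))"
      using u unfolding navier_stokes_solution_def by blast
    have t0T: "t0 \<le> T" using T rS by linarith
    have "0 < S" "t0 + r\<^sup>2 \<in> {t0..<t0 + S}" using rS by (linarith, simp)
    then have "AE x in lebesgue. u (t0 + r\<^sup>2) x = sol t0 (t0 + r\<^sup>2) x"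
      using agree mild t0 t0T T by blast
    moreover have "sol t0 (t0 + r\<^sup>2) = v (r\<^sup>2)" using rS by (auto simp: sol_def fun_eq_iff)
    ultimately have uv: "AE x in lebesgue. u (t0 + r\<^sup>2) x = v (r\<^sup>2) x" by simp
    have "grad_norm n q2 (u (t0 + r\<^sup>2)) \<le> ennreal ((1 / sqrt (r\<^sup>2)) ^ n * (num_partials n * (e * A) * sqrt (r\<^sup>2) powr (three_over q2 - three_over q1)))"
      by (rule grad_norm_v_le[OF q rS(2) _ U[OF rS(2)] eA uv]) (use rS in \<open>auto simp: L_def\<close>)
    also have "(1 / sqrt (r\<^sup>2)) ^ n * (num_partials n * (e * A) * sqrt (r\<^sup>2) powr (three_over q2 - three_over q1))
      = num_partials n * e * c3 * r powr (three_over q2 - real n - 1)"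
    proof -
      have n: "(1 / r) ^ n = r powr (- real n)" using r by (simp add: powr_minus powr_realpow power_divide divide_inverse power_inverse)
      have "r powr (- real n) * (r powr (three_over q1 - 1) * r powr (three_over q2 - three_over q1)) = r powr (three_over q2 - real n - 1)"
        by (simp add: powr_add[symmetric] algebra_simps)
      then show ?thesis using r by (simp add: n A_def mult_ac)
    qed
    also have "ennreal \<dots> < ennreal (c1 * r powr (three_over q2 - real n - 1))"
      using c1 r by (intro ennreal_lessI) (auto simp: c1_def)
    finally show "grad_norm n q2 (u (t0 + r\<^sup>2)) < ennreal (c1 * r powr (three_over q2 - real n - 1))" .
  qed (rule c1 c3)+
qed

theorem theorem1p3:
  fixes q1 q2 :: ennreal and n :: nat
  assumes "3 < q1" and "q1 \<le> q2"
  shows "\<exists>c1 c2 c3 :: real. c1 > 0 \<and> c2 > 0 \<and> c3 > 0 \<and>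
    (\<forall>(u :: real \<Rightarrow> real^3 \<Rightarrow> real^3) (T1 :: real) (T2 :: real).
       navier_stokes_solution T2 u \<and> 0 \<le> T1 \<and> T1 \<le> T2 \<longrightarrow>
       (\<forall>r\<in>{0<..<sqrt (T2 - T1)}.
          time_measure (large_times u n q2 (T1 + r\<^sup>2) T2 (c1 * r powr (three_over q2 - real n - 1)))
          \<le> ennreal c2 *
            time_measure (large_times u 0 q1 T1 T2 (c3 * r powr (three_over q1 - 1)))))"
proof -
  obtain c1 c3 :: real where c: "0 < c1" "0 < c3"
    and good: "\<And>u T t0 r. navier_stokes_solution T u \<Longrightarrow> 0 \<le> t0 \<Longrightarrow> 0 < r \<Longrightarrow> t0 + r\<^sup>2 \<le> T \<Longrightarrow>
      grad_norm 0 q1 (u t0) < ennreal (c3 * r powr (three_over q1 - 1)) \<Longrightarrow>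
      grad_norm n q2 (u (t0 + r\<^sup>2)) < ennreal (c1 * r powr (three_over q2 - real n - 1))"
    using smoothing_from_good_time[OF assms, of n] by blast
  show ?thesis
  proof (rule exI[of _ c1], rule exI[of _ 1], rule exI[of _ c3], intro conjI allI impI ballI c zero_less_one)
    fix u :: "real \<Rightarrow> real^3 \<Rightarrow> real^3" and T1 T2 r :: real
    assume u: "navier_stokes_solution T2 u \<and> 0 \<le> T1 \<and> T1 \<le> T2" and r: "r \<in> {0<..<sqrt (T2 - T1)}"
    have "time_measure (large_times u n q2 (T1 + r\<^sup>2) T2 (c1 * r powr (three_over q2 - real n - 1)))
        \<le> time_measure (large_times u 0 q1 T1 T2 (c3 * r powr (three_over q1 - 1)))"
    proof (rule time_measure_shift_le[where c="r\<^sup>2"])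
      fix t assume t: "t \<in> large_times u n q2 (T1 + r\<^sup>2) T2 (c1 * r powr (three_over q2 - real n - 1))"
      then have range: "T1 \<le> t - r\<^sup>2" "t \<le> T2" by (auto simp: large_times_def)
      \<comment> \<open>The earlier time is admissible because
        \<open>0 \<le> T1 \<le> t - r\<^sup>2\<close>, and the later one because
        \<open>t \<le> T2\<close>. This is why the first interval starts at
        \<open>T1 + r\<^sup>2\<close>.\<close>
      have "\<not> grad_norm 0 q1 (u (t - r\<^sup>2)) < ennreal (c3 * r powr (three_over q1 - 1))"
        using good[of T2 u "t - r\<^sup>2" r] u r range t by (auto simp: large_times_def)
      moreover have "t - r\<^sup>2 \<le> T2" using range zero_le_power2[of r] by linarith
      ultimately show "t - r\<^sup>2 \<in> large_times u 0 q1 T1 T2 (c3 * r powr (three_over q1 - 1))"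
        using range by (simp add: large_times_def not_less)
    qed
    then show "time_measure (large_times u n q2 (T1 + r\<^sup>2) T2 (c1 * r powr (three_over q2 - real n - 1)))
          \<le> ennreal 1 * time_measure (large_times u 0 q1 T1 T2 (c3 * r powr (three_over q1 - 1)))"
      by simp
  qed
qed

end
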